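(* The form $\tau$ is bounded below and closed (as a form in the Hilbert space $\mathcal H_\Gamma$).
   Context: **Setting.** $\mathbb K\in\{\mathbb R,\mathbb C\}$; all function spaces consist of $\mathbb K$-valued functions. $\Gamma=(V,E,\gamma)$ is a finite directed graph: $V$ (vertices) and $E$ (edges) are finite disjoint sets and $\gamma=(\gamma_0,\gamma_1)\colon E\to V\times V$ assigns to each edge a starting vertex $\gamma_0(e)$ and an end vertex $\gamma_1(e)$. Each $e\in E$ corresponds to an interval $[a_e,b_e]\subseteq\mathbb R$, $a_e<b_e$, and carries a finite Borel measure $\mu_e$ on $[a_e,b_e]$ such that either $\mu_e=0$, or $a_e,b_e\in\operatorname{spt}\mu_e$ and $\mu_e(\{a_e,b_e\})=0$. Put $E_0:=\{e\in E:\mu_e=0\}$, $E_1:=E\setminus E_0$. Each $v\in V$ has a weight $\mu_v\geq0$; put $V_0:=\{v\in V:\mu_v=0\}$, $V_1:=V\setminus V_0$. **Hilbert space.** $\mathcal H_\Gamma:=\mathcal H_E\oplus\mathbb K^{V_1}$ with $\mathcal H_E:=\bigoplus_{e\in E_1}L_2([a_e,b_e],\mu_e)$ and scalar product $(f\mid g)_{\mathcal H_\Gamma}=\sum_{e\in E_1}(f_e\mid g_e)_{L_2([a_e,b_e],\mu_e)}+\sum_{v\in V_1}f_v\overline{g_v}\,\mu_v$ for $f=((f_e)_{e\in E_1},(f_v)_{v\in V_1})$ and $g$ likewise. **The map $\iota$.** For $e\in E_1$ let $C_{\mu_e}[a_e,b_e]$ be the set of $f\in C[a_e,b_e]$ that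 are affine linear on the components of $[a_e,b_e]\setminus\operatorname{spt}\mu_e$, and $W^1_{2,\mu_e}(a_e,b_e):=W^1_2(a_e,b_e)\cap C_{\mu_e}[a_e,b_e]$. Let $D(\iota_e)$ be the set of $f\in L_2([a_e,b_e],\mu_e)$ for which there is $g\in W^1_2(a_e,b_e)\cap C[a_e,b_e]$ with $g=f$ $\mu_e$-a.e. For $f\in D(\iota_e)$, $\iota_ef$ denotes the unique $g\in W^1_{2,\mu_e}(a_e,b_e)$ with $g=f$ $\mu_e$-a.e. (existence and uniqueness are known). Define $D(\iota):=\{f\in\mathcal H_\Gamma: f_e\in D(\iota_e)\ (e\in E_1)\}$, $(\iota f)_e:=\iota_ef_e$ $(e\in E_1)$, $(\iota f)_v:=f_v$ $(v\in V_1)$. **Trace.** With $E_1':=E_1\times\{0,1\}$, define $\operatorname{tr}\colon\prod_{e\in E_1}C[a_e,b_e]\times\mathbb K^{V_1}\to\mathbb K^{E_1'\cup V_1}$ by $\operatorname{tr}f(e,0):=f_e(a_e)$, $\operatorname{tr}f(e,1):=f_e(b_e)$ $(e\in E_1)$, $\operatorname{tr}f(v):=f_v$ $(v\in V_1)$. The space $\mathbb K^{E_1'\cup V_1}$ has the scalar product $(\xi\mid\eta):=\sum_{(e,j)\in E_1'}\xi(e,j)\overline{\eta(e,j)}+\sum_{v\in V_1}\xi(v)\overline{\eta(v)}\,\mu_v$. **Form.** Let $X$ be a subspace of $\mathbb K^{E_1'\cup V_1}$ and $L$ a self-adjoint operator in $X$ (with respect to the scalar product $(\xi\mid\eta)=\sum_{(e,j)\in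 E_1'}\xi(e,j)\overline{\eta(e,j)}+\sum_{v\in V_1}\xi(v)\overline{\eta(v)}\,\mu_v$ of $\mathbb K^{E_1'\cup V_1}$, restricted to $X$). Define $$D(\tau):=\{f\in D(\iota):\operatorname{tr}(\iota f)\in X\},$$ $$\tau(f,g):=\sum_{e\in E_1}\int_{a_e}^{b_e}(\iota_ef_e)'(x)\overline{(\iota_eg_e)'(x)}\,dx+\bigl(L\operatorname{tr}(\iota f)\mid\operatorname{tr}(\iota g)\bigr)\qquad(f,g\in D(\tau)).$$ Bounded below means that there is $c\in\mathbb R$ with $\tau(f,f)\geq c\|f\|_{\mathcal H_\Gamma}^2$ for all $f\in D(\tau)$; closed means that $D(\tau)$ is complete for the form norm $(\tau(f,f)+(1-c)\|f\|^2_{\mathcal H_\Gamma})^{1/2}$. *)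

theory Defs
  imports
    "HOL-Analysis.Analysis"
    "HOL-Library.Function_Algebras"
    "Graph_Theory.Digraph"
begin

text \<open>
  The scalar field is a set \<^term>\<open>K :: complex set\<close>, which is either the set \<^term>\<open>\<real> :: complex set\<close>
  of real numbers or all of \<^term>\<open>UNIV :: complex set\<close>.  Functions with a prescribed domain
  are total functions that are set to 0 off that domain, so that the vector space operations
  are the pointwise ones.
\<close>

definition funs :: "complex set \<Rightarrow> 'i set \<Rightarrow> ('i \<Rightarrow> complex) set" where
  "funs K S = {f. (\<forall>x\<in>S. f x \<in> K) \<and> (\<forall>x. x \<notin> S \<longrightarrow> f x = 0)}"

definition C_on :: "complex set \<Rightarrow> real \<Rightarrow> real \<Rightarrow> (real \<Rightarrow> complex) set" where
  "C_on K a b = {f \<in> funs K {a..b}. continuous_on {a..b} f}"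

text \<open>
  Elements of \<open>L2 K M\<close> are representatives; identification modulo null functions is left
  implicit.  The scalar product does not depend on the choice of representatives.
\<close>

definition L2 :: "complex set \<Rightarrow> real measure \<Rightarrow> (real \<Rightarrow> complex) set" where
  "L2 K M = {f \<in> funs K (space M). f \<in> borel_measurable M \<and> integrable M (\<lambda>x. (cmod (f x))\<^sup>2)}"

definition L2_inner :: "real measure \<Rightarrow> (real \<Rightarrow> complex) \<Rightarrow> (real \<Rightarrow> complex) \<Rightarrow> complex" where
  "L2_inner M f g = (LINT x|M. f x * cnj (g x))"


subsection \<open>The Sobolev space \<open>W\<^sup>1\<^sub>2(a,b)\<close>\<close>

text \<open>
  Lebesgue measure on the closed interval; the end points are null sets, so its \<open>L2\<close> is
  the \<open>L2\<close> space of the open interval.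
\<close>

definition leb :: "real \<Rightarrow> real \<Rightarrow> real measure" where
  "leb a b = restrict_space lborel {a..b}"

definition test_functions :: "real \<Rightarrow> real \<Rightarrow> (real \<Rightarrow> real) set" where
  "test_functions a b = {\<phi>. (\<forall>n x. (deriv ^^ n) \<phi> differentiable (at x)) \<and>
     closure {x. \<phi> x \<noteq> 0} \<subseteq> {a<..<b}}"

definition has_weak_deriv ::
  "complex set \<Rightarrow> real \<Rightarrow> real \<Rightarrow> (real \<Rightarrow> complex) \<Rightarrow> (real \<Rightarrow> complex) \<Rightarrow> bool" where
  "has_weak_deriv K a b u h \<longleftrightarrow> h \<in> L2 K (leb a b) \<and>
     (\<forall>\<phi>\<in>test_functions a b.
        (LINT x|leb a b. u x * of_real (deriv \<phi> x)) = - (LINT x|leb a b. h x * of_real (\<phi> x)))"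

definition W12 :: "complex set \<Rightarrow> real \<Rightarrow> real \<Rightarrow> (real \<Rightarrow> complex) set" where
  "W12 K a b = {u \<in> L2 K (leb a b). \<exists>h. has_weak_deriv K a b u h}"

text \<open>A representative of the weak derivative, which is unique up to null functions.\<close>

definition weak_deriv :: "complex set \<Rightarrow> real \<Rightarrow> real \<Rightarrow> (real \<Rightarrow> complex) \<Rightarrow> real \<Rightarrow> complex" where
  "weak_deriv K a b u = (SOME h. has_weak_deriv K a b u h)"


subsection \<open>The map \<open>\<iota>\<^sub>e\<close>\<close>

definition spt :: "real measure \<Rightarrow> real set" where
  "spt M = {x \<in> space M. \<forall>U. open U \<and> x \<in> U \<longrightarrow> emeasure M (U \<inter> space M) > 0}"

definition C_mu :: "complex set \<Rightarrow> real \<Rightarrow> real \<Rightarrow> real measure \<Rightarrow> (real \<Rightarrow> complex) set" where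
  "C_mu K a b M = {f \<in> C_on K a b.
     \<forall>I \<in> components ({a..b} - spt M). \<exists>\<alpha>\<in>K. \<exists>\<beta>\<in>K. \<forall>x\<in>I. f x = \<alpha> + \<beta> * of_real x}"

definition W12_mu :: "complex set \<Rightarrow> real \<Rightarrow> real \<Rightarrow> real measure \<Rightarrow> (real \<Rightarrow> complex) set" where
  "W12_mu K a b M = W12 K a b \<inter> C_mu K a b M"

definition D_iota_e :: "complex set \<Rightarrow> real \<Rightarrow> real \<Rightarrow> real measure \<Rightarrow> (real \<Rightarrow> complex) set" where
  "D_iota_e K a b M = {f \<in> L2 K M. \<exists>g \<in> W12 K a b \<inter> C_on K a b. AE x in M. g x = f x}"

definition iota_e ::
  "complex set \<Rightarrow> real \<Rightarrow> real \<Rightarrow> real measure \<Rightarrow> (real \<Rightarrow> complex) \<Rightarrow> real \<Rightarrow> complex" where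
  "iota_e K a b M f = (THE g. g \<in> W12_mu K a b M \<and> (AE x in M. g x = f x))"

text \<open>Both notions depend only on the class of \<open>f\<close> modulo \<open>M\<close>-null functions.\<close>

lemma iota_e_cong:
  assumes "AE x in M. f x = f' x"
  shows "iota_e K a b M f = iota_e K a b M f'"
proof -
  have "(AE x in M. g x = f x) \<longleftrightarrow> (AE x in M. g x = f' x)" for g
    using assms by (auto elim: eventually_elim2)
  then show ?thesis by (simp add: iota_e_def)
qed

lemma D_iota_e_cong:
  assumes "AE x in M. f x = f' x" "f \<in> L2 K M" "f' \<in> L2 K M"
  shows "f \<in> D_iota_e K a b M \<longleftrightarrow> f' \<in> D_iota_e K a b M"
proof -
  have "(AE x in M. g x = f x) \<longleftrightarrow> (AE x in M. g x = f' x)" for g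
    using assms(1) by (auto elim: eventually_elim2)
  then show ?thesis using assms by (simp add: D_iota_e_def)
qed


subsection \<open>Graphs with edge measures and vertex weights\<close>

record ('v, 'e) measure_graph = "('v, 'e) pre_digraph" +
  lo :: "'e \<Rightarrow> real"
  hi :: "'e \<Rightarrow> real"
  emeas :: "'e \<Rightarrow> real measure"
  vwt :: "'v \<Rightarrow> real"

text \<open>
  \<^term>\<open>tail\<close> and \<^term>\<open>head\<close> are \<open>\<gamma>\<^sub>0\<close> and \<open>\<gamma>\<^sub>1\<close>; loops and multiple edges are allowed, and
  vertices and edges are disjoint because they have different types.
\<close>

definition is_measure_graph :: "('v, 'e) measure_graph \<Rightarrow> bool" where
  "is_measure_graph \<Gamma> \<longleftrightarrow> fin_digraph (pre_digraph.truncate \<Gamma>) \<and>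
     (\<forall>e\<in>arcs \<Gamma>. lo \<Gamma> e < hi \<Gamma> e \<and>
        finite_measure (emeas \<Gamma> e) \<and>
        space (emeas \<Gamma> e) = {lo \<Gamma> e..hi \<Gamma> e} \<and>
        sets (emeas \<Gamma> e) = sets (restrict_space borel {lo \<Gamma> e..hi \<Gamma> e}) \<and>
        (emeasure (emeas \<Gamma> e) (space (emeas \<Gamma> e)) = 0 \<or>
         lo \<Gamma> e \<in> spt (emeas \<Gamma> e) \<and> hi \<Gamma> e \<in> spt (emeas \<Gamma> e) \<and>
         emeasure (emeas \<Gamma> e) {lo \<Gamma> e, hi \<Gamma> e} = 0)) \<and>
     (\<forall>v\<in>verts \<Gamma>. vwt \<Gamma> v \<ge> 0)"

definition E1 :: "('v, 'e) measure_graph \<Rightarrow> 'e set" where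
  "E1 \<Gamma> = {e \<in> arcs \<Gamma>. emeasure (emeas \<Gamma> e) (space (emeas \<Gamma> e)) \<noteq> 0}"

definition V1 :: "('v, 'e) measure_graph \<Rightarrow> 'v set" where
  "V1 \<Gamma> = {v \<in> verts \<Gamma>. vwt \<Gamma> v \<noteq> 0}"


subsection \<open>The Hilbert space \<open>\<H>\<^sub>\<Gamma>\<close> and the map \<open>\<iota>\<close>\<close>

type_synonym ('v, 'e) elem = "('e \<Rightarrow> real \<Rightarrow> complex) \<times> ('v \<Rightarrow> complex)"

definition HG :: "complex set \<Rightarrow> ('v, 'e) measure_graph \<Rightarrow> ('v, 'e) elem set" where
  "HG K \<Gamma> = {f. (\<forall>e\<in>E1 \<Gamma>. fst f e \<in> L2 K (emeas \<Gamma> e)) \<and> (\<forall>e. e \<notin> E1 \<Gamma> \<longrightarrow> fst f e = 0) \<and>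
     snd f \<in> funs K (V1 \<Gamma>)}"

definition HG_inner ::
  "('v, 'e) measure_graph \<Rightarrow> ('v, 'e) elem \<Rightarrow> ('v, 'e) elem \<Rightarrow> complex" where
  "HG_inner \<Gamma> f g = (\<Sum>e\<in>E1 \<Gamma>. L2_inner (emeas \<Gamma> e) (fst f e) (fst g e)) +
     (\<Sum>v\<in>V1 \<Gamma>. snd f v * cnj (snd g v) * of_real (vwt \<Gamma> v))"

definition HG_norm :: "('v, 'e) measure_graph \<Rightarrow> ('v, 'e) elem \<Rightarrow> real" where
  "HG_norm \<Gamma> f = sqrt (Re (HG_inner \<Gamma> f f))"

definition D_iota :: "complex set \<Rightarrow> ('v, 'e) measure_graph \<Rightarrow> ('v, 'e) elem set" where
  "D_iota K \<Gamma> = {f \<in> HG K \<Gamma>.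
     \<forall>e\<in>E1 \<Gamma>. fst f e \<in> D_iota_e K (lo \<Gamma> e) (hi \<Gamma> e) (emeas \<Gamma> e)}"

definition iota ::
  "complex set \<Rightarrow> ('v, 'e) measure_graph \<Rightarrow> ('v, 'e) elem \<Rightarrow> ('v, 'e) elem" where
  "iota K \<Gamma> f =
     (\<lambda>e. if e \<in> E1 \<Gamma> then iota_e K (lo \<Gamma> e) (hi \<Gamma> e) (emeas \<Gamma> e) (fst f e) else 0, snd f)"


subsection \<open>The trace space\<close>

text \<open>The index set \<open>E\<^sub>1' \<union> V\<^sub>1\<close>, as a disjoint sum.\<close>

definition bd :: "('v, 'e) measure_graph \<Rightarrow> (('e \<times> nat) + 'v) set" where
  "bd \<Gamma> = (E1 \<Gamma> \<times> {0, 1}) <+> V1 \<Gamma>"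

definition bd_inner ::
  "('v, 'e) measure_graph \<Rightarrow> (('e \<times> nat) + 'v \<Rightarrow> complex) \<Rightarrow> (('e \<times> nat) + 'v \<Rightarrow> complex) \<Rightarrow> complex"
  where
  "bd_inner \<Gamma> \<xi> \<eta> = (\<Sum>p\<in>E1 \<Gamma> \<times> {0, 1}. \<xi> (Inl p) * cnj (\<eta> (Inl p))) +
     (\<Sum>v\<in>V1 \<Gamma>. \<xi> (Inr v) * cnj (\<eta> (Inr v)) * of_real (vwt \<Gamma> v))"

definition tr ::
  "('v, 'e) measure_graph \<Rightarrow> ('v, 'e) elem \<Rightarrow> ('e \<times> nat) + 'v \<Rightarrow> complex" where
  "tr \<Gamma> f i = (if i \<in> bd \<Gamma> then
      (case i of Inl (e, j) \<Rightarrow> fst f e (if j = 0 then lo \<Gamma> e else hi \<Gamma> e) | Inr v \<Rightarrow> snd f v)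
    else 0)"

definition is_subspace :: "complex set \<Rightarrow> ('i \<Rightarrow> complex) set \<Rightarrow> ('i \<Rightarrow> complex) set \<Rightarrow> bool" where
  "is_subspace K Y X \<longleftrightarrow> X \<subseteq> Y \<and> 0 \<in> X \<and> (\<forall>\<xi>\<in>X. \<forall>\<eta>\<in>X. \<xi> + \<eta> \<in> X) \<and>
     (\<forall>k\<in>K. \<forall>\<xi>\<in>X. (\<lambda>i. k * \<xi> i) \<in> X)"

text \<open>
  As \<open>X\<close> is finite-dimensional, a self-adjoint operator in \<open>X\<close>, being densely defined, is
  defined on all of \<open>X\<close>.
\<close>

definition is_self_adjoint ::
  "complex set \<Rightarrow> (('i \<Rightarrow> complex) \<Rightarrow> ('i \<Rightarrow> complex) \<Rightarrow> complex) \<Rightarrow> ('i \<Rightarrow> complex) set \<Rightarrow>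
    (('i \<Rightarrow> complex) \<Rightarrow> 'i \<Rightarrow> complex) \<Rightarrow> bool" where
  "is_self_adjoint K ip X L \<longleftrightarrow>
     (\<forall>\<xi>\<in>X. L \<xi> \<in> X) \<and>
     (\<forall>\<xi>\<in>X. \<forall>\<eta>\<in>X. L (\<xi> + \<eta>) = L \<xi> + L \<eta>) \<and>
     (\<forall>k\<in>K. \<forall>\<xi>\<in>X. L (\<lambda>i. k * \<xi> i) = (\<lambda>i. k * L \<xi> i)) \<and>
     (\<forall>\<xi>\<in>X. \<forall>\<eta>\<in>X. ip (L \<xi>) \<eta> = ip \<xi> (L \<eta>))"


subsection \<open>The form \<open>\<tau>\<close>\<close>

definition D_tau ::
  "complex set \<Rightarrow> ('v, 'e) measure_graph \<Rightarrow> (('e \<times> nat) + 'v \<Rightarrow> complex) set \<Rightarrow> ('v, 'e) elem set"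
  where
  "D_tau K \<Gamma> X = {f \<in> D_iota K \<Gamma>. tr \<Gamma> (iota K \<Gamma> f) \<in> X}"

definition tau ::
  "complex set \<Rightarrow> ('v, 'e) measure_graph \<Rightarrow>
    ((('e \<times> nat) + 'v \<Rightarrow> complex) \<Rightarrow> ('e \<times> nat) + 'v \<Rightarrow> complex) \<Rightarrow>
    ('v, 'e) elem \<Rightarrow> ('v, 'e) elem \<Rightarrow> complex" where
  "tau K \<Gamma> L f g =
     (\<Sum>e\<in>E1 \<Gamma>. LINT x|leb (lo \<Gamma> e) (hi \<Gamma> e).
        weak_deriv K (lo \<Gamma> e) (hi \<Gamma> e) (fst (iota K \<Gamma> f) e) x *
        cnj (weak_deriv K (lo \<Gamma> e) (hi \<Gamma> e) (fst (iota K \<Gamma> g) e) x)) +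
     bd_inner \<Gamma> (L (tr \<Gamma> (iota K \<Gamma> f))) (tr \<Gamma> (iota K \<Gamma> g))"


subsection \<open>Forms that are bounded below and closed\<close>

text \<open>
  \<open>N\<close> is the norm of the ambient Hilbert space, \<open>D\<close> the domain of the form \<open>q\<close>.  The
  inequality \<open>q f f \<ge> c * (N f)\<^sup>2\<close> includes that \<open>q f f\<close> is real.
\<close>

definition form_lower_bound ::
  "('h \<Rightarrow> real) \<Rightarrow> 'h set \<Rightarrow> ('h \<Rightarrow> 'h \<Rightarrow> complex) \<Rightarrow> real \<Rightarrow> bool" where
  "form_lower_bound N D q c \<longleftrightarrow> (\<forall>f\<in>D. q f f \<in> \<real> \<and> Re (q f f) \<ge> c * (N f)\<^sup>2)"

definition form_bounded_below ::
  "('h \<Rightarrow> real) \<Rightarrow> 'h set \<Rightarrow> ('h \<Rightarrow> 'h \<Rightarrow> complex) \<Rightarrow> bool" where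
  "form_bounded_below N D q \<longleftrightarrow> (\<exists>c. form_lower_bound N D q c)"

definition form_norm :: "('h \<Rightarrow> real) \<Rightarrow> ('h \<Rightarrow> 'h \<Rightarrow> complex) \<Rightarrow> real \<Rightarrow> 'h \<Rightarrow> real" where
  "form_norm N q c f = sqrt (Re (q f f) + (1 - c) * (N f)\<^sup>2)"

text \<open>
  Completeness is stated by Cauchy sequences of representatives; since the form norm of a
  representative is that of its class, this is completeness of the space of classes.
\<close>

definition form_complete ::
  "('h :: ab_group_add \<Rightarrow> real) \<Rightarrow> 'h set \<Rightarrow> ('h \<Rightarrow> 'h \<Rightarrow> complex) \<Rightarrow> real \<Rightarrow> bool" where
  "form_complete N D q c \<longleftrightarrow>
     (\<forall>s :: nat \<Rightarrow> 'h. (\<forall>n. s n \<in> D) \<and>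
        (\<forall>\<epsilon>>0. \<exists>M. \<forall>m\<ge>M. \<forall>n\<ge>M. form_norm N q c (s m - s n) < \<epsilon>) \<longrightarrow>
        (\<exists>f\<in>D. (\<lambda>n. form_norm N q c (s n - f)) \<longlonglongrightarrow> 0))"

text \<open>The form norm is formed with an arbitrary lower bound \<open>c\<close>.\<close>

definition form_closed ::
  "('h :: ab_group_add \<Rightarrow> real) \<Rightarrow> 'h set \<Rightarrow> ('h \<Rightarrow> 'h \<Rightarrow> complex) \<Rightarrow> bool" where
  "form_closed N D q \<longleftrightarrow> form_bounded_below N D q \<and>
     (\<forall>c. form_lower_bound N D q c \<longrightarrow> form_complete N D q c)"

end

theory Submission
  imports Defs "HOL-Probability.Conditional_Expectation"
begin

text \<open>
  The form \<open>\<tau>\<close> is the sum of the energy \<open>\<Sum>\<^sub>e \<parallel>(\<iota>\<^sub>e f\<^sub>e)'\<parallel>\<^sup>2\<close> and of the boundary term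
  \<open>(L tr(\<iota>f) | tr(\<iota>f))\<close>.  As \<open>L\<close> acts in a finite-dimensional space, it is bounded, so the boundary
  term is at most a constant times the squared length of the trace.  The trace is a small
  perturbation: since the end points of an edge belong to the support of \<open>\<mu>\<^sub>e\<close>, a function with
  square integrable derivative cannot be large at an end point without either being large on a
  set of positive \<open>\<mu>\<^sub>e\<close>-measure or having large energy, and for every \<open>\<epsilon> > 0\<close>
  \<open>|\<iota>\<^sub>e f(p)|\<^sup>2 \<le> \<epsilon> \<parallel>(\<iota>\<^sub>e f)'\<parallel>\<^sup>2 + C \<parallel>f\<parallel>\<^sup>2\<close> (lemma \<open>trace_bound\<close>).  So half of the energy absorbs the
  boundary term, which gives the lower bound and makes the form norm equivalent to the square root
  of energy plus squared norm in the Hilbert space (lemma \<open>tau_comparable\<close>).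

  For this equivalent norm completeness can be checked edge by edge (theorem \<open>iota_complete\<close>).  A
  Cauchy sequence has derivatives that converge in \<open>L2\<close> (theorem \<open>L2_complete\<close>) and convergent
  values at an end point, hence it converges uniformly to the primitive of the limit of the
  derivatives.  Affinity on the gaps of the support and the condition that the trace lie in \<open>X\<close>
  survive pointwise limits, the latter because finite-dimensional subspaces are closed.

  Two classical facts underlie this argument.  A continuous function has weak derivative \<open>h\<close>
  precisely if it is a constant plus the primitive of \<open>h\<close>; one direction is Fubini's theorem, the
  other is the du Bois-Reymond lemma.  Moreover, \<open>\<iota>\<^sub>e\<close> is well defined: uniqueness holds because a
  function that is affine on a gap is determined by its values at the ends of the gap, and existence
  is obtained by averaging the derivative over the gaps, that is, by taking a conditional
  expectation (theorem \<open>gap_linearization\<close>).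
\<close>

section \<open>Smooth test functions\<close>

definition smooth :: "(real \<Rightarrow> real) \<Rightarrow> bool" where
  "smooth f \<longleftrightarrow> (\<forall>n x. (deriv ^^ n) f differentiable (at x))"

text \<open>
  Smoothness is a coinductive property: it suffices to exhibit a family of differentiable
  functions that contains the derivatives of its members.  All closure properties below are
  obtained by naming a suitable family.
\<close>

lemma smoothI:
  assumes "f \<in> F"
    and step: "\<And>g. g \<in> F \<Longrightarrow> \<exists>g'\<in>F. \<forall>x. (g has_real_derivative g' x) (at x)"
  shows "smooth f"
proof -
  have deriv_in: "deriv g \<in> F" if "g \<in> F" for g
  proof -
    from step[OF that] obtain g' where g': "g' \<in> F" "\<forall>x. (g has_real_derivative g' x) (at x)"
      by blast
    then have "deriv g = g'" by (intro ext DERIV_imp_deriv) simp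
    with g' show ?thesis by simp
  qed
  have "(deriv ^^ n) f \<in> F" for n
    by (induction n) (auto simp: assms deriv_in)
  then show ?thesis
    unfolding smooth_def using step real_differentiable_def by blast
qed

lemma smooth_has_deriv: "smooth f \<Longrightarrow> (f has_real_derivative deriv f x) (at x)"
  unfolding smooth_def
  by (metis DERIV_imp_deriv funpow_0 real_differentiable_def)

lemma smooth_deriv: "smooth f \<Longrightarrow> smooth (deriv f)"
  unfolding smooth_def by (metis funpow_Suc_right comp_apply)

lemma smooth_antiderivative:
  assumes "\<And>x. (f has_real_derivative g x) (at x)" "smooth g"
  shows "smooth f"
proof (rule smoothI[of _ "insert f {g. smooth g}"])
  fix h assume h: "h \<in> insert f {g. smooth g}"
  show "\<exists>h'\<in>insert f {g. smooth g}. \<forall>x. (h has_real_derivative h' x) (at x)"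
  proof (cases "h = f")
    case True
    then show ?thesis using assms by (intro bexI[of _ g]) auto
  next
    case False
    then have "smooth h" using h by simp
    then show ?thesis
      by (intro bexI[of _ "deriv h"]) (auto intro: smooth_has_deriv smooth_deriv)
  qed
qed simp

lemma smooth_diff:
  assumes "smooth f" "smooth g"
  shows "smooth (\<lambda>x. f x - g x)"
proof (rule smoothI[of _ "{\<lambda>x. f x - g x | f g. smooth f \<and> smooth g}"])
  fix h assume "h \<in> {\<lambda>x. f x - g x | f g. smooth f \<and> smooth g}"
  then obtain f g where h: "h = (\<lambda>x. f x - g x)" "smooth f" "smooth g" by blast
  then have "\<forall>x. (h has_real_derivative deriv f x - deriv g x) (at x)"
    by (auto intro!: DERIV_diff smooth_has_deriv)
  then show "\<exists>g'\<in>{\<lambda>x. f x - g x | f g. smooth f \<and> smooth g}.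
      \<forall>x. (h has_real_derivative g' x) (at x)"
    using smooth_deriv[OF h(2)] smooth_deriv[OF h(3)]
    by (intro bexI[of _ "\<lambda>x. deriv f x - deriv g x"] CollectI exI[of _ "deriv f"]
        exI[of _ "deriv g"] conjI refl) auto
next
  show "(\<lambda>x. f x - g x) \<in> {\<lambda>x. f x - g x | f g. smooth f \<and> smooth g}"
    by (intro CollectI exI[of _ f] exI[of _ g] conjI refl assms)
qed

lemma smooth_affine:
  assumes "smooth f"
  shows "smooth (\<lambda>x. f (c * x + d))"
proof (rule smoothI[of _ "{\<lambda>x. k * g (c * x + d) | k g. smooth g}"])
  show "(\<lambda>x. f (c * x + d)) \<in> {\<lambda>x. k * g (c * x + d) | k g. smooth g}"
    by (intro CollectI exI[of _ 1] exI[of _ f] conjI assms) simp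
next
  fix h assume "h \<in> {\<lambda>x. k * g (c * x + d) | k g. smooth g}"
  then obtain k g where h: "h = (\<lambda>x. k * g (c * x + d))" "smooth g" by blast
  have "(h has_real_derivative (k * c) * deriv g (c * x + d)) (at x)" for x
    unfolding h(1)
    by (rule DERIV_cong[OF DERIV_cmult[OF DERIV_chain'[OF _ smooth_has_deriv[OF h(2)]]]])
       (auto intro!: derivative_eq_intros)
  then show "\<exists>g'\<in>{\<lambda>x. k * g (c * x + d) | k g. smooth g}.
      \<forall>x. (h has_real_derivative g' x) (at x)"
    using smooth_deriv[OF h(2)]
    by (intro bexI[of _ "\<lambda>x. (k * c) * deriv g (c * x + d)"] CollectI exI[of _ "k * c"]
        exI[of _ "deriv g"] conjI refl) auto
qed

text \<open>
  By the Leibniz rule the derivative of a product is a sum of two products, so the family that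
  witnesses smoothness of products has to contain finite sums.
\<close>

inductive_set smooth_products :: "(real \<Rightarrow> real) set" where
  mult: "smooth f \<Longrightarrow> smooth g \<Longrightarrow> (\<lambda>x. f x * g x) \<in> smooth_products"
| add: "f \<in> smooth_products \<Longrightarrow> g \<in> smooth_products \<Longrightarrow> (\<lambda>x. f x + g x) \<in> smooth_products"

lemma smooth_mult:
  assumes "smooth f" "smooth g"
  shows "smooth (\<lambda>x. f x * g x)"
proof (rule smoothI[of _ smooth_products])
  fix h assume "h \<in> smooth_products"
  then show "\<exists>h'\<in>smooth_products. \<forall>x. (h has_real_derivative h' x) (at x)"
  proof induction
    case (mult f g)
    have "((\<lambda>x. f x * g x) has_real_derivative f x * deriv g x + deriv f x * g x) (at x)" for x
      by (rule DERIV_mult'[OF smooth_has_deriv smooth_has_deriv]) (use mult in auto)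
    moreover have "(\<lambda>x. f x * deriv g x + deriv f x * g x) \<in> smooth_products"
      by (intro smooth_products.intros mult smooth_deriv)
    ultimately show ?case
      by (intro bexI[of _ "\<lambda>x. f x * deriv g x + deriv f x * g x"]) auto
  next
    case (add f g)
    then obtain f' g' where *: "f' \<in> smooth_products" "g' \<in> smooth_products"
      "\<And>x. (f has_real_derivative f' x) (at x)" "\<And>x. (g has_real_derivative g' x) (at x)"
      by blast
    then have "((\<lambda>x. f x + g x) has_real_derivative f' x + g' x) (at x)" for x
      by (intro DERIV_add)
    with smooth_products.add[OF *(1,2)] show ?case
      by (intro bexI[of _ "\<lambda>x. f' x + g' x"]) auto
  qed
qed (use assms in \<open>rule smooth_products.mult\<close>)

text \<open>
  The functions \<open>P(1/x) exp(-1/x)\<close>, cut off at \<open>0\<close>.  With the polynomial \<open>P\<close> as a parameter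
  they form a family that is closed under differentiation, which makes the flat function
  \<open>exp(-1/x)\<close> smooth.
\<close>

definition flat_exp :: "real poly \<Rightarrow> real \<Rightarrow> real" where
  "flat_exp p x = (if x > 0 then poly p (1 / x) * exp (- (1 / x)) else 0)"

lemma poly_times_exp_minus_tendsto_0:
  "((\<lambda>y::real. poly p y * exp (- y)) \<longlongrightarrow> 0) at_top"
proof -
  have "((\<lambda>y::real. \<Sum>i\<le>degree p. coeff p i * (y ^ i / exp y)) \<longlongrightarrow> (\<Sum>i\<le>degree p. coeff p i * 0)) at_top"
    by (intro tendsto_sum tendsto_mult tendsto_const tendsto_power_div_exp_0)
  then show ?thesis
    by (simp add: poly_altdef sum_distrib_right exp_minus divide_inverse mult.assoc)
qed

lemma flat_exp_has_derivative:
  "(flat_exp p has_real_derivative flat_exp ([:0, 0, 1:] * (p - pderiv p)) x) (at x)"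
proof -
  consider "x < 0" | "x = 0" | "x > 0" by linarith
  then show ?thesis
  proof cases
    case 1
    have "((\<lambda>_. 0) has_real_derivative 0) (at x)" by simp
    then have "(flat_exp p has_real_derivative 0) (at x)"
      by (rule has_field_derivative_transform_within_open[of _ _ _ "{..<0}"])
         (use 1 in \<open>auto simp: flat_exp_def\<close>)
    with 1 show ?thesis by (simp add: flat_exp_def)
  next
    case 2
    \<comment> \<open>The difference quotient at 0 is \<open>Q(1/h) exp(-1/h)\<close> with \<open>Q(y) = y P(y)\<close>.\<close>
    have "((\<lambda>h. poly (pCons 0 p) (inverse h) * exp (- inverse h)) \<longlongrightarrow> 0) (at_right 0)"
      using filterlim_compose[OF poly_times_exp_minus_tendsto_0 filterlim_inverse_at_top_right] .
    moreover have "\<forall>\<^sub>F h in at_right (0::real).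
        poly (pCons 0 p) (inverse h) * exp (- inverse h) = (flat_exp p h - flat_exp p 0) / h"
      by (simp add: eventually_at_filter flat_exp_def field_simps inverse_eq_divide)
    ultimately have "((\<lambda>h. (flat_exp p h - flat_exp p 0) / h) \<longlongrightarrow> 0) (at_right 0)"
      by (rule Lim_transform_eventually)
    moreover have "((\<lambda>h. (flat_exp p h - flat_exp p 0) / h) \<longlongrightarrow> 0) (at_left 0)"
      by (rule Lim_transform_eventually[OF tendsto_const])
         (simp add: eventually_at_filter flat_exp_def)
    ultimately have "((\<lambda>h. (flat_exp p (0 + h) - flat_exp p 0) / h) \<longlongrightarrow> 0) (at 0)"
      by (simp add: filterlim_split_at)
    with 2 show ?thesis by (simp add: DERIV_def flat_exp_def)
  next
    case 3
    have "((\<lambda>x. poly p (1 / x) * exp (- (1 / x))) has_real_derivative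
        flat_exp ([:0, 0, 1:] * (p - pderiv p)) x) (at x)"
      using 3 by (auto intro!: derivative_eq_intros poly_DERIV[THEN DERIV_chain2]
          simp: flat_exp_def power2_eq_square field_simps)
    then show ?thesis
      by (rule has_field_derivative_transform_within_open[of _ _ _ "{0<..}"])
         (use 3 in \<open>auto simp: flat_exp_def\<close>)
  qed
qed

lemma smooth_flat_exp: "smooth (flat_exp p)"
  by (rule smoothI[of _ "range flat_exp"])
     (auto intro!: bexI[of _ "flat_exp _"] flat_exp_has_derivative)

lemma smooth_imp_continuous_on: "smooth f \<Longrightarrow> continuous_on A f"
  by (meson smooth_has_deriv DERIV_isCont continuous_at_imp_continuous_on)

text \<open>
  The step \<open>S\<close> rises from \<open>0\<close> to \<open>c\<close> on the unit interval.  A difference of two rescaled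
  translates of \<open>S\<close> is a test function whose derivative is a difference of two bumps of equal
  mass; these are the test functions needed in the du Bois-Reymond lemma.
\<close>

lemma smooth_step_exists:
  obtains S \<beta> :: "real \<Rightarrow> real" and c :: real
  where "smooth S" "\<And>x. (S has_real_derivative \<beta> x) (at x)" "continuous_on UNIV \<beta>"
    "\<And>x. 0 \<le> \<beta> x" "\<And>x. x \<le> 0 \<or> 1 \<le> x \<Longrightarrow> \<beta> x = 0"
    "\<And>x. x \<le> 0 \<Longrightarrow> S x = 0" "\<And>x. 1 \<le> x \<Longrightarrow> S x = c" "0 < c"
proof -
  define \<beta> where "\<beta> = (\<lambda>x. flat_exp 1 x * flat_exp 1 (- 1 * x + 1))"
  have smooth: "smooth \<beta>"
    unfolding \<beta>_def by (intro smooth_mult smooth_affine smooth_flat_exp)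
  have zero: "\<beta> x = 0" if "x \<le> 0 \<or> 1 \<le> x" for x
    using that by (auto simp: \<beta>_def flat_exp_def)
  have pos: "0 < \<beta> x" if "0 < x" "x < 1" for x
    using that by (auto simp: \<beta>_def flat_exp_def)
  have nonneg: "0 \<le> \<beta> x" for x
    using zero[of x] pos[of x] by (cases "x \<le> 0 \<or> 1 \<le> x") auto
  have cont: "continuous_on A \<beta>" for A
    using smooth by (rule smooth_imp_continuous_on)
  \<comment> \<open>Integrating from \<open>-1\<close> rather than \<open>0\<close> puts a neighbourhood of \<open>0\<close> inside the range of
    the fundamental theorem.\<close>
  define S where "S = (\<lambda>x. integral {-1..x} \<beta>)"
  have S_neg: "S x = 0" if "x \<le> 0" for x
    using Henstock_Kurzweil_Integration.integral_cong[of "{-1..x}" \<beta> "\<lambda>_. 0"] that zero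
    by (simp add: S_def)
  have deriv: "(S has_real_derivative \<beta> x) (at x)" for x
  proof (cases "x < 0")
    case True
    have "((\<lambda>_. 0) has_real_derivative 0) (at x)" by simp
    then have "(S has_real_derivative 0) (at x)"
      by (rule has_field_derivative_transform_within_open[of _ _ _ "{..<0}"])
         (use True S_neg in auto)
    with True show ?thesis by (simp add: zero)
  next
    case False
    have "(S has_real_derivative \<beta> x) (at x within {-1..x+1})"
      unfolding S_def by (rule integral_has_real_derivative) (use False cont in auto)
    moreover have "x \<in> interior {-1..x+1}" using False by (simp add: interior_atLeastAtMost_real)
    ultimately show ?thesis using at_within_interior by metis
  qed
  have S_const: "S x = S 1" if "1 \<le> x" for x
  proof -
    have "\<beta> integrable_on {-1..x}" by (rule integrable_continuous_real[OF cont])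
    then have "integral {-1..1} \<beta> + integral {1..x} \<beta> = integral {-1..x} \<beta>"
      by (intro Henstock_Kurzweil_Integration.integral_combine) (use that in auto)
    moreover have "integral {1..x} \<beta> = 0"
      using Henstock_Kurzweil_Integration.integral_cong[of "{1..x}" \<beta> "\<lambda>_. 0"] zero by simp
    ultimately show ?thesis by (simp add: S_def)
  qed
  have "S 0 < S 1"
    by (rule DERIV_pos_imp_increasing_open)
       (use deriv pos in \<open>auto intro!: continuous_at_imp_continuous_on DERIV_isCont\<close>)
  then have "0 < S 1" by (simp add: S_neg)
  with that[of S \<beta> "S 1"] smooth_antiderivative[OF deriv smooth] deriv cont nonneg zero S_neg S_const
  show thesis by blast
qed

section \<open>Square integrable functions\<close>

definition L2_sq :: "real measure \<Rightarrow> (real \<Rightarrow> complex) \<Rightarrow> real" where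
  "L2_sq M f = (LINT x|M. (cmod (f x))\<^sup>2)"

definition sq_integrable :: "real measure \<Rightarrow> (real \<Rightarrow> complex) \<Rightarrow> bool" where
  "sq_integrable M f \<longleftrightarrow> f \<in> borel_measurable M \<and> integrable M (\<lambda>x. (cmod (f x))\<^sup>2)"

lemma L2_iff: "f \<in> L2 K M \<longleftrightarrow> f \<in> funs K (space M) \<and> sq_integrable M f"
  by (simp add: L2_def sq_integrable_def)

lemma L2_sq_nonneg [simp]: "0 \<le> L2_sq M f"
  by (simp add: L2_sq_def)

lemma L2_sq_cong_AE:
  assumes "AE x in M. f x = g x" "f \<in> borel_measurable M" "g \<in> borel_measurable M"
  shows "L2_sq M f = L2_sq M g"
  unfolding L2_sq_def
  by (rule integral_cong_AE) (use assms in \<open>auto elim: eventually_mono\<close>)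

lemma cmod_diff_sq_le: "(cmod (x - y))\<^sup>2 \<le> 2 * (cmod x)\<^sup>2 + 2 * (cmod y)\<^sup>2"
proof -
  have "(cmod (x - y))\<^sup>2 \<le> (cmod x + cmod y)\<^sup>2"
    by (intro power_mono norm_triangle_ineq4) simp
  also have "\<dots> \<le> 2 * (cmod x)\<^sup>2 + 2 * (cmod y)\<^sup>2"
    using zero_le_power2[of "cmod x - cmod y"] by (simp add: power2_eq_square algebra_simps)
  finally show ?thesis .
qed

lemma sq_integrable_diff:
  assumes "sq_integrable M f" "sq_integrable M g"
  shows "sq_integrable M (\<lambda>x. f x - g x)"
proof -
  have [measurable]: "f \<in> borel_measurable M" "g \<in> borel_measurable M"
    using assms by (auto simp: sq_integrable_def)
  have "integrable M (\<lambda>x. (cmod (f x - g x))\<^sup>2)"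
    by (rule Bochner_Integration.integrable_bound[of _ "\<lambda>x. 2 * (cmod (f x))\<^sup>2 + 2 * (cmod (g x))\<^sup>2"])
       (use assms cmod_diff_sq_le in \<open>auto simp: sq_integrable_def\<close>)
  then show ?thesis by (simp add: sq_integrable_def)
qed

lemma sq_integrable_imp_integrable:
  assumes "finite_measure M" "sq_integrable M f"
  shows "integrable M f"
proof -
  interpret finite_measure M by fact
  have "cmod (f x) \<le> 1 + (cmod (f x))\<^sup>2" for x
  proof -
    have "2 * cmod (f x) \<le> 1 + (cmod (f x))\<^sup>2"
      using sum_squares_bound[of 1 "cmod (f x)"] by simp
    then show ?thesis using norm_ge_zero[of "f x"] by linarith
  qed
  then have bound: "AE x in M. norm (f x) \<le> norm (1 + (cmod (f x))\<^sup>2)"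
    by (intro always_eventually allI) (metis abs_ge_self order_trans real_norm_def)
  have "integrable M (\<lambda>x. 1 + (cmod (f x))\<^sup>2)" "f \<in> borel_measurable M"
    using assms(2) by (simp_all add: sq_integrable_def)
  then show ?thesis
    using bound by (rule Bochner_Integration.integrable_bound)
qed

lemma sq_integrable_bounded:
  assumes "finite_measure M" "f \<in> borel_measurable M" "\<And>x. x \<in> space M \<Longrightarrow> cmod (f x) \<le> B"
  shows "sq_integrable M f" "L2_sq M f \<le> B\<^sup>2 * measure M (space M)"
proof -
  interpret finite_measure M by fact
  have bound: "(cmod (f x))\<^sup>2 \<le> B\<^sup>2" if "x \<in> space M" for x
    using assms(3)[OF that] by (intro power_mono) auto
  show sq: "sq_integrable M f"
    unfolding sq_integrable_def
    using assms(2) bound by (auto intro!: integrable_const_bound[of _ "B\<^sup>2"] AE_I2)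
  have "L2_sq M f \<le> (LINT x|M. B\<^sup>2)"
    unfolding L2_sq_def
    using sq bound by (intro integral_mono) (auto simp: sq_integrable_def)
  then show "L2_sq M f \<le> B\<^sup>2 * measure M (space M)" by (simp add: mult.commute)
qed

text \<open>
  With \<open>I = \<integral>\<^sub>A |f|\<close> and \<open>J = \<integral> |f|\<^sup>2\<close>, integrating \<open>(|f| - s)\<^sup>2 \<ge> 0\<close> over \<open>A\<close> gives
  \<open>0 \<le> J - 2 s I + s\<^sup>2 M(A)\<close> for every real \<open>s\<close>; the claim is the sign of the discriminant.
\<close>

lemma Cauchy_Schwarz_set_integral:
  assumes "finite_measure M" "sq_integrable M f" "A \<in> sets M"
  shows "(cmod (LINT x:A|M. f x))\<^sup>2 \<le> measure M A * L2_sq M f"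
    and "(LINT x:A|M. cmod (f x))\<^sup>2 \<le> measure M A * L2_sq M f"
proof -
  interpret finite_measure M by fact
  define t where "t = measure M A"
  define I where "I = (LINT x:A|M. cmod (f x))"
  define J where "J = L2_sq M f"
  have f_int: "integrable M f" using assms(1,2) by (rule sq_integrable_imp_integrable)
  have f_sq: "integrable M (\<lambda>x. (cmod (f x))\<^sup>2)" using assms(2) by (simp add: sq_integrable_def)
  have int_A: "integrable M (\<lambda>x. indicator A x * cmod (f x))"
    using integrable_mult_indicator[OF assms(3) integrable_norm[OF f_int]] by simp
  have int_1: "integrable M (\<lambda>x. indicator A x :: real)"
    using assms(3) by (simp add: emeasure_eq_measure)
  have discr: "0 \<le> J - 2 * s * I + s\<^sup>2 * t" for s
  proof -
    have "(LINT x|M. 2 * s * (indicator A x * cmod (f x)) - s\<^sup>2 * indicator A x) \<le> J"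
      unfolding J_def L2_sq_def
    proof (rule integral_mono)
      show "2 * s * (indicator A x * cmod (f x)) - s\<^sup>2 * indicator A x \<le> (cmod (f x))\<^sup>2" for x
        using zero_le_power2[of "cmod (f x) - s"]
        by (auto simp: indicator_def power2_eq_square algebra_simps)
    qed (intro Bochner_Integration.integrable_diff integrable_mult_right int_A int_1 f_sq)+
    also have "(LINT x|M. 2 * s * (indicator A x * cmod (f x)) - s\<^sup>2 * indicator A x) = 2 * s * I - s\<^sup>2 * t"
      using Bochner_Integration.integral_diff[OF integrable_mult_right[OF int_A, of "2 * s"]
          integrable_mult_right[OF int_1, of "s\<^sup>2"]] sets.sets_into_space[OF assms(3)]
      by (simp add: I_def t_def set_lebesgue_integral_def Int_absorb2)
    finally show ?thesis by simp
  qed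
  have I_nonneg: "0 \<le> I" by (simp add: I_def set_lebesgue_integral_def)
  have I_le: "I\<^sup>2 \<le> t * J"
  proof (cases "t = 0")
    case True
    have "I = 0"
    proof (rule ccontr)
      assume "I \<noteq> 0"
      with discr[of "(J + 1) / (2 * I)"] True show False by simp
    qed
    with True show ?thesis by simp
  next
    case False
    then have "0 < t" by (simp add: t_def order_less_le)
    with discr[of "I / t"] show ?thesis by (simp add: field_simps power2_eq_square)
  qed
  then show "(LINT x:A|M. cmod (f x))\<^sup>2 \<le> measure M A * L2_sq M f"
    by (simp add: I_def t_def J_def)
  have "cmod (LINT x:A|M. f x) \<le> I"
    unfolding I_def set_lebesgue_integral_def
    using integral_norm_bound[of M "\<lambda>x. indicat_real A x *\<^sub>R f x"] by simp
  then have "(cmod (LINT x:A|M. f x))\<^sup>2 \<le> I\<^sup>2" by (intro power_mono) auto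
  with I_le show "(cmod (LINT x:A|M. f x))\<^sup>2 \<le> measure M A * L2_sq M f"
    by (simp add: I_def t_def J_def)
qed

text \<open>
  Fatou's lemma in the form in which it is used for completeness.
\<close>

lemma L2_sq_limit_le:
  assumes "\<And>n. sq_integrable M (u n)" "\<And>n. L2_sq M (u n) \<le> B"
    and "AE x in M. (\<lambda>n. u n x) \<longlonglongrightarrow> v x" "v \<in> borel_measurable M"
  shows "sq_integrable M v" "L2_sq M v \<le> B"
proof -
  have [measurable]: "u n \<in> borel_measurable M" "v \<in> borel_measurable M" for n
    using assms by (auto simp: sq_integrable_def)
  have "0 \<le> B" using assms(2)[of 0] L2_sq_nonneg[of M "u 0"] by linarith
  have "(\<integral>\<^sup>+x. ennreal ((cmod (v x))\<^sup>2) \<partial>M) = (\<integral>\<^sup>+x. liminf (\<lambda>n. ennreal ((cmod (u n x))\<^sup>2)) \<partial>M)"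
  proof (rule nn_integral_cong_AE, rule eventually_mono[OF assms(3)])
    fix x assume "(\<lambda>n. u n x) \<longlonglongrightarrow> v x"
    then have "(\<lambda>n. ennreal ((cmod (u n x))\<^sup>2)) \<longlonglongrightarrow> ennreal ((cmod (v x))\<^sup>2)"
      by (intro tendsto_ennrealI tendsto_power tendsto_norm)
    then show "ennreal ((cmod (v x))\<^sup>2) = liminf (\<lambda>n. ennreal ((cmod (u n x))\<^sup>2))"
      using lim_imp_Liminf trivial_limit_sequentially by metis
  qed
  also have "\<dots> \<le> liminf (\<lambda>n. \<integral>\<^sup>+x. ennreal ((cmod (u n x))\<^sup>2) \<partial>M)"
    by (intro nn_integral_liminf) simp
  also have "\<dots> \<le> liminf (\<lambda>n. ennreal B)"
  proof (intro Liminf_mono always_eventually allI)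
    fix n
    have "(\<integral>\<^sup>+x. ennreal ((cmod (u n x))\<^sup>2) \<partial>M) = ennreal (L2_sq M (u n))"
      unfolding L2_sq_def using assms(1) by (intro nn_integral_eq_integral) (auto simp: sq_integrable_def)
    then show "(\<integral>\<^sup>+x. ennreal ((cmod (u n x))\<^sup>2) \<partial>M) \<le> ennreal B"
      using assms(2) by (simp add: ennreal_leI)
  qed
  finally have le: "(\<integral>\<^sup>+x. ennreal ((cmod (v x))\<^sup>2) \<partial>M) \<le> ennreal B"
    by (simp add: Liminf_const)
  then have "(\<integral>\<^sup>+x. ennreal (norm ((cmod (v x))\<^sup>2)) \<partial>M) < \<infinity>"
    by (simp add: order_le_less_trans)
  then have int: "integrable M (\<lambda>x. (cmod (v x))\<^sup>2)"
    by (intro integrableI_bounded) auto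
  then show "sq_integrable M v" by (simp add: sq_integrable_def)
  have "ennreal (L2_sq M v) \<le> ennreal B"
    using le nn_integral_eq_integral[OF int] by (simp add: L2_sq_def)
  with \<open>0 \<le> B\<close> show "L2_sq M v \<le> B" by simp
qed

text \<open>
  Riesz-Fischer.  On a finite measure space the \<open>L2\<close> norm controls the \<open>L1\<close> norm, so along a
  subsequence whose consecutive distances decay geometrically the increments are absolutely
  summable almost everywhere; Fatou's lemma turns the resulting pointwise limit into an \<open>L2\<close>
  limit of the whole sequence.  The limit is set to \<open>0\<close> on the null set of divergence so that
  it takes its values in \<open>K\<close> at every point.
\<close>

theorem L2_complete:
  assumes "finite_measure M" "closed K" "0 \<in> K"
    and s: "\<And>n. s n \<in> L2 K M"
    and cauchy: "\<And>\<epsilon>. \<epsilon> > 0 \<Longrightarrow> \<exists>N. \<forall>m\<ge>N. \<forall>n\<ge>N. L2_sq M (\<lambda>x. s m x - s n x) < \<epsilon>"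
  obtains f where "f \<in> L2 K M" "(\<lambda>n. L2_sq M (\<lambda>x. s n x - f x)) \<longlonglongrightarrow> 0"
proof -
  interpret finite_measure M by fact
  have sq: "sq_integrable M (s n)" for n using s by (simp add: L2_iff)
  then have [measurable]: "s n \<in> borel_measurable M" for n by (simp add: sq_integrable_def)
  have "\<forall>k. \<exists>N. \<forall>m\<ge>N. \<forall>n\<ge>N. L2_sq M (\<lambda>x. s m x - s n x) < (1/4) ^ k"
    using cauchy by simp
  then obtain R where R: "\<And>k m n. m \<ge> R k \<Longrightarrow> n \<ge> R k \<Longrightarrow> L2_sq M (\<lambda>x. s m x - s n x) < (1/4) ^ k"
    by metis
  \<comment> \<open>Partial sums make the chosen indices monotone.\<close>
  define r where "r k = (\<Sum>j\<le>k. R j)" for k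
  have r: "R k \<le> r k" "r k \<le> r (Suc k)" for k
    unfolding r_def by (auto intro: member_le_sum)
  define D where "D k x = cmod (s (r (Suc k)) x - s (r k) x)" for k x
  have [measurable]: "D k \<in> borel_measurable M" for k unfolding D_def by measurable
  have D_int: "integrable M (D k)" for k
    unfolding D_def using sq_integrable_imp_integrable[OF assms(1) sq_integrable_diff[OF sq sq]] by auto
  have D_nonneg: "0 \<le> D k x" for k x by (simp add: D_def)
  define V where "V = measure M (space M)"
  have D_le: "(LINT x|M. D k x) \<le> sqrt V * (1/2) ^ k" for k
  proof -
    have "(LINT x:space M|M. D k x)\<^sup>2 \<le> V * L2_sq M (\<lambda>x. s (r (Suc k)) x - s (r k) x)"
      unfolding V_def D_def
      by (intro Cauchy_Schwarz_set_integral(2) sq_integrable_diff sq assms) simp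
    also have "\<dots> \<le> V * (1/4) ^ k"
      using R[of k "r (Suc k)" "r k"] r[of k] by (intro mult_left_mono) (auto simp: V_def)
    also have "\<dots> = (sqrt V * (1/2) ^ k)\<^sup>2"
    proof -
      have "((1/2::real) ^ k)\<^sup>2 = (1/4) ^ k"
        by (simp add: power2_eq_square flip: power_mult_distrib)
      then show ?thesis by (simp add: V_def power_mult_distrib)
    qed
    finally have "(LINT x:space M|M. D k x) \<le> sqrt V * (1/2) ^ k"
      by (rule power2_le_imp_le) (simp add: V_def)
    moreover have "(LINT x:space M|M. D k x) = (LINT x|M. D k x)"
      unfolding set_lebesgue_integral_def by (intro Bochner_Integration.integral_cong) auto
    ultimately show ?thesis by simp
  qed
  have "(\<integral>\<^sup>+x. (\<Sum>k. ennreal (D k x)) \<partial>M) = (\<Sum>k. \<integral>\<^sup>+x. ennreal (D k x) \<partial>M)"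
    by (intro nn_integral_suminf) simp
  also have "\<dots> = (\<Sum>k. ennreal (LINT x|M. D k x))"
    using D_int by (intro suminf_cong nn_integral_eq_integral) (auto simp: D_nonneg)
  also have "\<dots> \<le> (\<Sum>k. ennreal (sqrt V * (1/2) ^ k))"
    using D_le by (intro suminf_le ennreal_leI) auto
  also have "\<dots> < \<infinity>"
    by (subst suminf_ennreal2) (auto simp: V_def intro!: summable_mult summable_geometric)
  finally have "AE x in M. (\<Sum>k. ennreal (D k x)) \<noteq> \<infinity>"
    by (intro nn_integral_PInf_AE) auto
  then have conv: "AE x in M. convergent (\<lambda>k. s (r k) x)"
  proof eventually_elim
    fix x assume "(\<Sum>k. ennreal (D k x)) \<noteq> \<infinity>"
    then have "summable (\<lambda>k. D k x)"
      by (intro summable_suminf_not_top) (auto simp: D_def)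
    then have "summable (\<lambda>k. s (r (Suc k)) x - s (r k) x)"
      unfolding D_def by (rule summable_norm_cancel)
    then have "(\<lambda>n. \<Sum>k<n. s (r (Suc k)) x - s (r k) x) \<longlonglongrightarrow> (\<Sum>k. s (r (Suc k)) x - s (r k) x)"
      by (rule summable_LIMSEQ)
    then have "(\<lambda>n. s (r n) x - s (r 0) x) \<longlonglongrightarrow> (\<Sum>k. s (r (Suc k)) x - s (r k) x)"
      using sum_lessThan_telescope[of "\<lambda>k. s (r k) x"] by simp
    from tendsto_add[OF this tendsto_const[of "s (r 0) x"]]
    show "convergent (\<lambda>k. s (r k) x)" by (auto simp: convergent_def)
  qed
  define f where "f x = (if x \<in> {x \<in> space M. Cauchy (\<lambda>k. s (r k) x)} then lim (\<lambda>k. s (r k) x) else 0)" for x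
  have f_meas [measurable]: "f \<in> borel_measurable M"
    unfolding f_def by measurable
  have f_lim: "AE x in M. (\<lambda>k. s (r k) x) \<longlonglongrightarrow> f x"
    using conv AE_space
    by eventually_elim (simp add: f_def convergent_LIMSEQ_iff convergent_Cauchy)
  have f_funs: "f \<in> funs K (space M)"
  proof -
    have "lim (\<lambda>k. s (r k) x) \<in> K" if "x \<in> space M" "Cauchy (\<lambda>k. s (r k) x)" for x
    proof (rule closed_sequentially[OF assms(2)])
      show "\<And>k. s (r k) x \<in> K" using s that by (auto simp: L2_def funs_def)
      show "(\<lambda>k. s (r k) x) \<longlonglongrightarrow> lim (\<lambda>k. s (r k) x)"
        using that by (simp add: Cauchy_convergent_iff convergent_LIMSEQ_iff)
    qed
    then show ?thesis using \<open>0 \<in> K\<close> by (auto simp: funs_def f_def)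
  qed
  have diff: "sq_integrable M (\<lambda>x. s m x - f x)" "L2_sq M (\<lambda>x. s m x - f x) \<le> (1/4) ^ k" if "m \<ge> R k" for m k
  proof -
    have mono: "r k \<le> r (j + k)" for j
      by (induction j) (auto intro: order_trans r(2))
    have le: "L2_sq M (\<lambda>x. s m x - s (r (j + k)) x) \<le> (1/4) ^ k" for j
      using R[OF that, of "r (j + k)"] r(1)[of k] mono[of j] by simp
    have lim: "AE x in M. (\<lambda>j. s m x - s (r (j + k)) x) \<longlonglongrightarrow> s m x - f x"
      using f_lim by eventually_elim (intro tendsto_diff tendsto_const LIMSEQ_ignore_initial_segment)
    show "sq_integrable M (\<lambda>x. s m x - f x)" "L2_sq M (\<lambda>x. s m x - f x) \<le> (1/4) ^ k"
      by (rule L2_sq_limit_le[OF sq_integrable_diff[OF sq sq] le lim]; simp)+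
  qed
  have "sq_integrable M (\<lambda>x. s (R 0) x - (s (R 0) x - f x))"
    by (intro sq_integrable_diff sq diff(1)[of 0]) simp
  then have "f \<in> L2 K M" using f_funs by (simp add: L2_iff)
  moreover have "(\<lambda>n. L2_sq M (\<lambda>x. s n x - f x)) \<longlonglongrightarrow> 0"
  proof (rule LIMSEQ_I)
    fix e :: real assume "0 < e"
    obtain k where k: "(1/4) ^ k < e" using real_arch_pow_inv[OF \<open>0 < e\<close>, of "1/4"] by auto
    show "\<exists>no. \<forall>n\<ge>no. norm (L2_sq M (\<lambda>x. s n x - f x) - 0) < e"
      using diff(2) k by (intro exI[of _ "R k"]) (auto intro: order_le_less_trans)
  qed
  ultimately show thesis by (rule that)
qed

text \<open>
  The positive and the negative part of \<open>h\<close> are densities of finite measures that agree on all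
  half-lines, hence everywhere; equal densities agree almost everywhere.
\<close>

lemma AE_zero_if_interval_integrals_zero:
  fixes h :: "real \<Rightarrow> real"
  assumes int: "integrable lborel h" and zero: "\<And>x. (LINT t:{x<..}|lborel. h t) = 0"
  shows "AE x in lborel. h x = 0"
proof -
  have [measurable]: "h \<in> borel_measurable borel" using int by auto
  define p where "p x = max (h x) 0" for x
  define q where "q x = max (- h x) 0" for x
  have [measurable]: "p \<in> borel_measurable borel" "q \<in> borel_measurable borel"
    unfolding p_def q_def by measurable
  have pq: "integrable lborel p" "integrable lborel q" "\<And>x. h x = p x - q x" "\<And>x. 0 \<le> p x" "\<And>x. 0 \<le> q x"
    unfolding p_def q_def using int by auto
  have em: "emeasure (density lborel (\<lambda>x. ennreal (f x))) {x<..} = ennreal (LINT t:{x<..}|lborel. f t)"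
    if [measurable]: "f \<in> borel_measurable borel" and f: "integrable lborel f" "\<And>x. 0 \<le> f x" for f :: "real \<Rightarrow> real" and x
  proof -
    have "emeasure (density lborel (\<lambda>x. ennreal (f x))) {x<..} = (\<integral>\<^sup>+t. ennreal (indicator {x<..} t * f t) \<partial>lborel)"
      by (subst emeasure_density) (auto intro!: nn_integral_cong simp: indicator_def)
    also have "\<dots> = ennreal (LINT t:{x<..}|lborel. f t)"
      unfolding set_lebesgue_integral_def real_scaleR_def
      using integrable_mult_indicator[OF _ f(1), of "{x<..}"] f(2)
      by (intro nn_integral_eq_integral) auto
    finally show ?thesis .
  qed
  have set_int: "set_integrable lborel {x<..} p" "set_integrable lborel {x<..} q" for x
    unfolding set_integrable_def by (rule integrable_mult_indicator; use pq in simp)+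
  have eq: "(LINT t:{x<..}|lborel. p t) = (LINT t:{x<..}|lborel. q t)" for x
    using zero[of x] set_integral_diff(2)[OF set_int[of x]] pq(3) by simp
  have "density lborel (\<lambda>x. ennreal (p x)) = density lborel (\<lambda>x. ennreal (q x))"
    by (rule measure_eqI_lessThan) (auto simp: em pq eq)
  then have "AE x in lborel. ennreal (p x) = ennreal (q x)"
    by (subst (asm) sigma_finite_measure.density_unique_iff[OF sigma_finite_lborel]) auto
  then show ?thesis
    by eventually_elim (use pq in \<open>simp add: ennreal_inj\<close>)
qed

section \<open>Weak derivatives on an interval\<close>

locale scalar_field =
  fixes K :: "complex set"
  assumes K: "K = \<real> \<or> K = UNIV"
begin

lemma closed_K: "closed K"
  using K closed_complex_Reals by auto

lemma K_simps [simp, intro]: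
  "0 \<in> K" "1 \<in> K" "x \<in> K \<Longrightarrow> y \<in> K \<Longrightarrow> x + y \<in> K" "x \<in> K \<Longrightarrow> y \<in> K \<Longrightarrow> x - y \<in> K"
  "x \<in> K \<Longrightarrow> y \<in> K \<Longrightarrow> x * y \<in> K" "x \<in> K \<Longrightarrow> y \<in> K \<Longrightarrow> x / y \<in> K" "x \<in> K \<Longrightarrow> - x \<in> K"
  "complex_of_real r \<in> K"
  using K by auto

lemma lim_in_K: "(\<And>n. s n \<in> K) \<Longrightarrow> s \<longlonglongrightarrow> x \<Longrightarrow> x \<in> K"
  using closed_sequentially[OF closed_K] .

lemma integral_in_K:
  assumes "\<And>x. x \<in> space M \<Longrightarrow> f x \<in> K"
  shows "(LINT x|M. f x) \<in> K"
proof (cases "K = UNIV")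
  case False
  then have "K = \<real>" using K by simp
  then have "(LINT x|M. f x) = (LINT x|M. complex_of_real (Re (f x)))"
    using assms by (intro Bochner_Integration.integral_cong refl) (metis Reals_cases Re_complex_of_real)
  then show ?thesis by simp
qed simp

lemma funs_diff: "f \<in> funs K S \<Longrightarrow> g \<in> funs K S \<Longrightarrow> (\<lambda>x. f x - g x) \<in> funs K S"
  by (auto simp: funs_def)

lemma C_on_diff: "f \<in> C_on K a b \<Longrightarrow> g \<in> C_on K a b \<Longrightarrow> (\<lambda>x. f x - g x) \<in> C_on K a b"
  by (auto simp: C_on_def funs_diff intro: continuous_on_diff)

lemma L2_diff: "f \<in> L2 K M \<Longrightarrow> g \<in> L2 K M \<Longrightarrow> (\<lambda>x. f x - g x) \<in> L2 K M"
  by (simp add: L2_iff funs_diff sq_integrable_diff)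

end

locale interval = scalar_field K for K +
  fixes a b :: real
  assumes ab: "a < b"
begin

abbreviation "LEB \<equiv> leb a b"

lemma space_leb [simp]: "space LEB = {a..b}"
  by (simp add: leb_def space_restrict_space)

lemma sets_leb: "sets LEB = sets (restrict_space borel {a..b})"
  unfolding leb_def by (intro sets_restrict_space_cong) simp

lemma in_sets_leb: "A \<in> sets borel \<Longrightarrow> A \<subseteq> {a..b} \<Longrightarrow> A \<in> sets LEB"
  unfolding sets_leb by (subst sets_restrict_space_iff) auto

lemma emeasure_leb: "A \<subseteq> {a..b} \<Longrightarrow> emeasure LEB A = emeasure lborel A"
  unfolding leb_def by (intro emeasure_restrict_space) auto

lemma finite_leb: "finite_measure LEB"
  by (rule finite_measureI) (simp add: emeasure_leb emeasure_lborel_Icc[OF less_imp_le[OF ab]])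

sublocale leb: finite_measure LEB
  by (rule finite_leb)

lemma measurable_leb: "f \<in> borel_measurable borel \<Longrightarrow> f \<in> borel_measurable LEB"
  unfolding leb_def by (intro measurable_restrict_space1) simp

lemma id_measurable_leb [measurable]: "(\<lambda>x. x) \<in> borel_measurable LEB"
  by (rule measurable_leb) simp

lemma continuous_measurable_leb:
  fixes f :: "real \<Rightarrow> 'a::{second_countable_topology, real_normed_vector}"
  shows "continuous_on {a..b} f \<Longrightarrow> f \<in> borel_measurable LEB"
  unfolding measurable_cong_sets[OF sets_leb refl]
  by (rule borel_measurable_continuous_on_restrict)

lemma integral_leb:
  fixes f :: "real \<Rightarrow> 'a::{banach, second_countable_topology}"
  shows "(LINT x|LEB. f x) = (LINT x:{a..b}|lborel. f x)"
  unfolding leb_def set_lebesgue_integral_def by (intro integral_restrict_space) simp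

lemma continuous_sq_integrable:
  assumes "continuous_on {a..b} f"
  shows "sq_integrable LEB f"
proof -
  obtain B where "\<forall>x\<in>{a..b}. cmod (f x) \<le> B"
    using compact_imp_bounded[OF compact_continuous_image[OF assms compact_Icc]]
    unfolding bounded_iff by auto
  then show ?thesis
    using sq_integrable_bounded(1)[OF finite_leb continuous_measurable_leb[OF assms], of B] by simp
qed

lemma C_on_subset_L2: "C_on K a b \<subseteq> L2 K LEB"
  by (auto simp: C_on_def L2_iff continuous_sq_integrable)

lemma L2_integrable: "h \<in> L2 K LEB \<Longrightarrow> integrable LEB h"
  by (simp add: L2_iff sq_integrable_imp_integrable finite_leb)

text \<open>
  The absolutely continuous function with derivative \<open>h\<close> that vanishes at \<open>a\<close>.
\<close>

definition primitive :: "(real \<Rightarrow> complex) \<Rightarrow> real \<Rightarrow> complex" where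
  "primitive h x = (LINT t:{a..x}|LEB. h t)"

lemma AE_leb_neq: "AE t in LEB. t \<noteq> p"
proof -
  have "AE t in lborel. t \<noteq> p" by (rule AE_lborel_singleton)
  then show ?thesis unfolding leb_def by (subst AE_restrict_space_iff) auto
qed

lemma primitive_a [simp]: "primitive h a = 0"
  unfolding primitive_def set_lebesgue_integral_def
  using AE_leb_neq[of a] by (intro integral_eq_zero_AE) (auto elim!: eventually_mono)

lemma set_integrable_leb:
  fixes h :: "real \<Rightarrow> complex"
  shows "integrable LEB h \<Longrightarrow> A \<in> sets borel \<Longrightarrow> A \<subseteq> {a..b} \<Longrightarrow> set_integrable LEB A h"
  unfolding set_integrable_def by (intro integrable_mult_indicator in_sets_leb)

lemma primitive_increment:
  fixes h :: "real \<Rightarrow> complex"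
  assumes "integrable LEB h" "a \<le> x" "x \<le> y" "y \<le> b"
  shows "primitive h y - primitive h x = (LINT t:{x<..y}|LEB. h t)"
proof -
  have "{a..y} = {a..x} \<union> {x<..y}" using assms by auto
  then have "primitive h y = primitive h x + (LINT t:{x<..y}|LEB. h t)"
    unfolding primitive_def
    using assms by (simp only:) (intro set_integral_Un set_integrable_leb; auto)
  then show ?thesis by simp
qed

lemma primitive_diff:
  assumes "integrable LEB h" "integrable LEB k" "x \<in> {a..b}"
  shows "primitive (\<lambda>t. h t - k t) x = primitive h x - primitive k x"
  unfolding primitive_def
  using assms by (intro set_integral_diff set_integrable_leb) auto

lemma primitive_Hoelder:
  assumes "sq_integrable LEB h" "x \<in> {a..b}" "y \<in> {a..b}"
  shows "(cmod (primitive h y - primitive h x))\<^sup>2 \<le> \<bar>y - x\<bar> * L2_sq LEB h"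
  using assms(2,3)
proof (induction x y rule: linorder_wlog)
  case (le x y)
  have "{x<..y} \<in> sets LEB" using le by (intro in_sets_leb) auto
  from Cauchy_Schwarz_set_integral(1)[OF finite_leb assms(1) this]
  have "(cmod (primitive h y - primitive h x))\<^sup>2 \<le> measure LEB {x<..y} * L2_sq LEB h"
    using le sq_integrable_imp_integrable[OF finite_leb assms(1)]
    by (subst primitive_increment) auto
  also have "measure LEB {x<..y} = \<bar>y - x\<bar>"
    using le by (subst measure_def, subst emeasure_leb) auto
  finally show ?case .
next
  case (sym x y)
  then show ?case by (simp add: norm_minus_commute abs_minus_commute)
qed

text \<open>
  The estimate of the hypothesis is the one that functions with square integrable derivative
  satisfy; it is the embedding of \<open>W\<^sup>1\<^sub>2\<close> into the functions that are Hoelder continuous with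
  exponent \<open>1/2\<close>.
\<close>

lemma Hoelder_imp_continuous_on:
  fixes f :: "real \<Rightarrow> complex"
  assumes "\<And>x y. x \<in> S \<Longrightarrow> y \<in> S \<Longrightarrow> (cmod (f y - f x))\<^sup>2 \<le> \<bar>y - x\<bar> * J"
  shows "continuous_on S f"
  unfolding continuous_on_def
proof
  fix x assume x: "x \<in> S"
  have "((\<lambda>y. sqrt (\<bar>y - x\<bar> * J)) \<longlongrightarrow> sqrt (\<bar>x - x\<bar> * J)) (at x within S)"
    by (intro tendsto_intros)
  then have lim: "((\<lambda>y. sqrt (\<bar>y - x\<bar> * J)) \<longlongrightarrow> 0) (at x within S)" by simp
  have "\<forall>\<^sub>F y in at x within S. norm (f y - f x) \<le> sqrt (\<bar>y - x\<bar> * J)"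
    unfolding eventually_at_filter
    by (intro always_eventually allI impI real_le_rsqrt assms x)
  then show "(f \<longlongrightarrow> f x) (at x within S)"
    by (rule LIM_zero_cancel[OF Lim_null_comparison[OF _ lim]])
qed

lemma primitive_continuous: "sq_integrable LEB h \<Longrightarrow> continuous_on {a..b} (primitive h)"
  by (rule Hoelder_imp_continuous_on[where J = "L2_sq LEB h"]) (rule primitive_Hoelder)

lemma primitive_in_K:
  assumes "h \<in> L2 K LEB"
  shows "primitive h x \<in> K"
  unfolding primitive_def set_lebesgue_integral_def
proof (rule integral_in_K)
  fix t assume "t \<in> space LEB"
  then have "h t \<in> K" using assms unfolding L2_def funs_def by blast
  then show "indicat_real {a..x} t *\<^sub>R h t \<in> K"
    by (cases "t \<in> {a..x}") simp_all
qed

text \<open>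
  Up to the null set \<open>{a}\<close> the integral over a half-line is an increment of the primitive, so
  the real and the imaginary part of \<open>h\<close>, extended by \<open>0\<close>, integrate to \<open>0\<close> over every
  half-line.
\<close>

lemma AE_zero_if_primitive_zero:
  assumes int: "integrable LEB h" and zero: "\<And>x. x \<in> {a..b} \<Longrightarrow> primitive h x = 0"
  shows "AE x in LEB. h x = 0"
proof -
  have int': "integrable lborel (\<lambda>x. indicator {a..b} x *\<^sub>R h x)"
    using int unfolding leb_def by (subst (asm) integrable_restrict_space) auto
  have tail: "(LINT t:{x<..}|lborel. indicator {a..b} t *\<^sub>R h t) = 0" for x
  proof -
    have "(LINT t:{x<..}|lborel. indicator {a..b} t *\<^sub>R h t) = (LINT t|LEB. indicator {x<..} t *\<^sub>R h t)"
      unfolding integral_leb set_lebesgue_integral_def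
      by (intro Bochner_Integration.integral_cong) (auto simp: indicator_def)
    also have "\<dots> = primitive h b - primitive h (max a (min x b))"
    proof (subst primitive_increment[OF int])
      show "(LINT t|LEB. indicator {x<..} t *\<^sub>R h t) = (LINT t:{max a (min x b)<..b}|LEB. h t)"
      proof (cases "x < a")
        case True
        show ?thesis
          unfolding set_lebesgue_integral_def using True ab AE_space[of LEB] AE_leb_neq[of a] int
          by (intro integral_cong_AE; (measurable)?) (auto simp: indicator_def)
      next
        case False
        then show ?thesis
          unfolding set_lebesgue_integral_def
          by (intro Bochner_Integration.integral_cong) (auto simp: indicator_def)
      qed
    qed (use ab in auto)
    also have "\<dots> = 0" using ab by (simp add: zero)
    finally show ?thesis .
  qed
  have part: "AE x in lborel. f (indicator {a..b} x *\<^sub>R h x) = 0"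
    if f: "bounded_linear f" for f :: "complex \<Rightarrow> real"
  proof (rule AE_zero_if_interval_integrals_zero)
    show "integrable lborel (\<lambda>x. f (indicator {a..b} x *\<^sub>R h x))"
      using f int' by (rule integrable_bounded_linear)
    show "(LINT t:{x<..}|lborel. f (indicator {a..b} t *\<^sub>R h t)) = 0" for x
    proof -
      have "set_integrable lborel {x<..} (\<lambda>t. indicator {a..b} t *\<^sub>R h t)"
        unfolding set_integrable_def by (rule integrable_mult_indicator[OF _ int']) simp
      from integral_bounded_linear[OF f this[unfolded set_integrable_def]]
      show ?thesis
        using tail[of x] f
        by (simp add: set_lebesgue_integral_def linear_simps(3)[OF f] linear_simps(5)[OF f] mult.assoc)
    qed
  qed
  have "AE x in lborel. indicator {a..b} x *\<^sub>R h x = 0"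
    using part[OF bounded_linear_Re] part[OF bounded_linear_Im]
    by eventually_elim (rule complex_eqI; simp)
  then show ?thesis
    unfolding leb_def by (subst AE_restrict_space_iff) (auto elim!: eventually_mono simp: indicator_def)
qed

lemma test_functionsD:
  assumes "\<phi> \<in> test_functions a b"
  shows "smooth \<phi>" "\<phi> a = 0" "\<phi> b = 0"
proof -
  have "x \<in> {a<..<b}" if "\<phi> x \<noteq> 0" for x
    using assms that closure_subset[of "{x. \<phi> x \<noteq> 0}"] by (auto simp: test_functions_def)
  then show "\<phi> a = 0" "\<phi> b = 0" by force+
  show "smooth \<phi>" using assms by (simp add: test_functions_def smooth_def)
qed

lemma integral_deriv_smooth:
  assumes "smooth \<phi>" "a \<le> x" "x \<le> y" "y \<le> b"
  shows "(LINT t:{x..y}|LEB. deriv \<phi> t) = \<phi> y - \<phi> x"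
proof -
  have "(LINT t:{x..y}|LEB. deriv \<phi> t) = (LINT t:{x..y}|lborel. deriv \<phi> t)"
    unfolding set_lebesgue_integral_def integral_leb using assms
    by (intro Bochner_Integration.integral_cong) (auto simp: indicator_def)
  also have "\<dots> = \<phi> y - \<phi> x"
    unfolding set_lebesgue_integral_def
    using assms smooth_has_deriv[OF assms(1)]
    by (intro integral_FTC_atLeastAtMost smooth_imp_continuous_on smooth_deriv)
       (auto simp: has_real_derivative_iff_has_vector_derivative intro: has_vector_derivative_at_within)
  finally show ?thesis .
qed

text \<open>
  Since \<open>h\<close> is merely integrable, integration by parts is Fubini's theorem for
  \<open>h(t) \<phi>'(x)\<close> on the triangle \<open>t \<le> x\<close>: the inner integral of \<open>\<phi>'\<close> over \<open>[t,b]\<close> is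
  \<open>\<phi>(b) - \<phi>(t) = - \<phi>(t)\<close>.
\<close>

lemma primitive_integration_by_parts:
  fixes h :: "real \<Rightarrow> complex"
  assumes int: "integrable LEB h" and \<phi>: "\<phi> \<in> test_functions a b"
  shows "(LINT x|LEB. primitive h x * of_real (deriv \<phi> x)) = - (LINT x|LEB. h x * of_real (\<phi> x))"
proof -
  interpret P: pair_sigma_finite LEB LEB ..
  note smooth = test_functionsD(1)[OF \<phi>]
  have cont: "continuous_on A (deriv \<phi>)" for A
    using smooth by (intro smooth_imp_continuous_on smooth_deriv)
  obtain B where B: "\<forall>x\<in>{a..b}. \<bar>deriv \<phi> x\<bar> \<le> B"
    using compact_imp_bounded[OF compact_continuous_image[OF cont[of "{a..b}"] compact_Icc]]
    unfolding bounded_iff by auto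
  have [measurable]: "h \<in> borel_measurable LEB" "deriv \<phi> \<in> borel_measurable LEB"
    by (rule borel_measurable_integrable[OF int], rule continuous_measurable_leb[OF cont])
  define F where "F t x = (if t \<le> x then h t * of_real (deriv \<phi> x) else 0)" for t x
  have "integrable (LEB \<Otimes>\<^sub>M LEB) (\<lambda>(t, x). B * cmod (h t))"
  proof (rule P.Fubini_integrable)
    show "(\<lambda>(t, x). B * cmod (h t)) \<in> borel_measurable (LEB \<Otimes>\<^sub>M LEB)" by measurable
    have "integrable LEB (\<lambda>t. (\<bar>B\<bar> * measure LEB {a..b}) * cmod (h t))"
      by (intro integrable_mult_right integrable_norm int)
    then show "integrable LEB (\<lambda>t. LINT x|LEB. norm (case (t, x) of (t, x) \<Rightarrow> B * cmod (h t)))"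
      by (simp add: abs_mult mult_ac)
    show "AE t in LEB. integrable LEB (\<lambda>x. case (t, x) of (t, x) \<Rightarrow> B * cmod (h t))"
      by simp
  qed
  then have F_int: "integrable (LEB \<Otimes>\<^sub>M LEB) (case_prod F)"
  proof (rule Bochner_Integration.integrable_bound)
    show "case_prod F \<in> borel_measurable (LEB \<Otimes>\<^sub>M LEB)" unfolding F_def by measurable
    show "AE p in LEB \<Otimes>\<^sub>M LEB. norm (case_prod F p) \<le> norm (case p of (t, x) \<Rightarrow> B * cmod (h t))"
    proof (rule AE_I2)
      fix p assume "p \<in> space (LEB \<Otimes>\<^sub>M LEB)"
      then obtain t x where p: "p = (t, x)" "x \<in> {a..b}" by (auto simp: space_pair_measure)
      have "norm (F t x) \<le> cmod (h t) * \<bar>deriv \<phi> x\<bar>" by (simp add: F_def norm_mult)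
      also have "\<dots> \<le> cmod (h t) * B" using B p(2) by (intro mult_left_mono) auto
      also have "\<dots> \<le> norm (B * cmod (h t))" by (simp add: mult.commute)
      finally show "norm (case_prod F p) \<le> norm (case p of (t, x) \<Rightarrow> B * cmod (h t))"
        by (simp add: p)
    qed
  qed
  have "(LINT x|LEB. primitive h x * of_real (deriv \<phi> x)) = (LINT x|LEB. LINT t|LEB. F t x)"
  proof (rule Bochner_Integration.integral_cong[OF refl])
    fix x assume "x \<in> space LEB"
    have "(LINT t|LEB. F t x) = (LINT t|LEB. (indicator {a..x} t *\<^sub>R h t) * of_real (deriv \<phi> x))"
      by (intro Bochner_Integration.integral_cong) (auto simp: F_def indicator_def)
    then show "primitive h x * of_real (deriv \<phi> x) = (LINT t|LEB. F t x)"
      by (simp only: primitive_def set_lebesgue_integral_def integral_mult_left_zero)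
  qed
  also have "\<dots> = (LINT t|LEB. LINT x|LEB. F t x)"
    by (rule P.Fubini_integral[OF F_int])
  also have "\<dots> = (LINT t|LEB. - (h t * of_real (\<phi> t)))"
  proof (rule Bochner_Integration.integral_cong[OF refl])
    fix t assume t: "t \<in> space LEB"
    have "(LINT x|LEB. F t x) = (LINT x|LEB. h t * of_real (indicator {t..b} x * deriv \<phi> x))"
      by (intro Bochner_Integration.integral_cong) (auto simp: F_def indicator_def)
    also have "\<dots> = h t * of_real (LINT x:{t..b}|LEB. deriv \<phi> x)"
      by (simp only: set_lebesgue_integral_def real_scaleR_def integral_mult_right_zero
          integral_complex_of_real)
    also have "\<dots> = - (h t * of_real (\<phi> t))"
      using t test_functionsD(3)[OF \<phi>] by (subst integral_deriv_smooth[OF smooth]) auto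
    finally show "(LINT x|LEB. F t x) = - (h t * of_real (\<phi> t))" .
  qed
  finally show ?thesis by simp
qed

lemma integral_deriv_test_function:
  assumes "\<phi> \<in> test_functions a b"
  shows "(LINT x|LEB. deriv \<phi> x) = 0"
proof -
  have "(LINT x|LEB. deriv \<phi> x) = (LINT x:{a..b}|LEB. deriv \<phi> x)"
    unfolding set_lebesgue_integral_def by (intro Bochner_Integration.integral_cong) auto
  also have "\<dots> = 0"
    using integral_deriv_smooth[OF test_functionsD(1)[OF assms], of a b] test_functionsD[OF assms] ab
    by simp
  finally show ?thesis .
qed

lemma continuous_times_deriv_integrable:
  fixes u :: "real \<Rightarrow> complex"
  assumes "continuous_on {a..b} u" "\<phi> \<in> test_functions a b"
  shows "integrable LEB (\<lambda>x. u x * of_real (deriv \<phi> x))"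
  by (intro sq_integrable_imp_integrable[OF finite_leb] continuous_sq_integrable continuous_intros
      assms smooth_imp_continuous_on smooth_deriv test_functionsD(1))

proposition primitive_has_weak_deriv:
  assumes h: "h \<in> L2 K LEB" and u: "\<And>x. x \<in> {a..b} \<Longrightarrow> u x = \<alpha> + primitive h x"
  shows "has_weak_deriv K a b u h"
  unfolding has_weak_deriv_def
proof (intro conjI ballI h)
  fix \<phi> assume \<phi>: "\<phi> \<in> test_functions a b"
  have "sq_integrable LEB h" using h by (simp add: L2_iff)
  have "(LINT x|LEB. u x * of_real (deriv \<phi> x))
      = (LINT x|LEB. \<alpha> * of_real (deriv \<phi> x) + primitive h x * of_real (deriv \<phi> x))"
    by (intro Bochner_Integration.integral_cong) (auto simp: u algebra_simps)
  also have "\<dots> = (LINT x|LEB. \<alpha> * of_real (deriv \<phi> x)) + (LINT x|LEB. primitive h x * of_real (deriv \<phi> x))"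
    using \<phi> \<open>sq_integrable LEB h\<close>
    by (intro Bochner_Integration.integral_add continuous_times_deriv_integrable primitive_continuous) auto
  finally show "(LINT x|LEB. u x * of_real (deriv \<phi> x)) = - (LINT x|LEB. h x * of_real (\<phi> x))"
    using \<phi> h by (simp add: integral_deriv_test_function primitive_integration_by_parts L2_integrable)
qed

text \<open>
  For two interior points \<open>y, z\<close> test with the difference of the steps at \<open>y\<close> and at \<open>z\<close> of
  width \<open>e\<close>.  Its derivative is a bump of mass \<open>c\<close> next to \<open>y\<close> minus a bump of mass \<open>c\<close> next
  to \<open>z\<close>, so as \<open>e\<close> tends to \<open>0\<close> the integral of \<open>v\<close> against it approaches
  \<open>c (v(y) - v(z))\<close>, which is therefore \<open>0\<close>.
\<close>

lemma du_Bois_Reymond: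
  fixes v :: "real \<Rightarrow> complex"
  assumes cont: "continuous_on {a..b} v"
    and zero: "\<And>\<phi>. \<phi> \<in> test_functions a b \<Longrightarrow> (LINT x|LEB. v x * of_real (deriv \<phi> x)) = 0"
    and x: "x \<in> {a..b}"
  shows "v x = v a"
proof -
  obtain S \<beta> c where S: "smooth S" "\<And>x. (S has_real_derivative \<beta> x) (at x)" "continuous_on UNIV \<beta>"
    "\<And>x. 0 \<le> \<beta> x" "\<And>x. x \<le> 0 \<or> 1 \<le> x \<Longrightarrow> \<beta> x = 0"
    "\<And>x. x \<le> 0 \<Longrightarrow> S x = 0" "\<And>x. 1 \<le> x \<Longrightarrow> S x = c" "0 < c"
    by (rule smooth_step_exists) blast
  have inner: "v y = v z" if y: "y \<in> {a<..<b}" and z: "z \<in> {a<..<b}" for y z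
  proof -
    have small: "c * cmod (v y - v z) \<le> 2 * \<eta> * c" if "0 < \<eta>" for \<eta>
    proof -
      have "\<exists>d>0. \<forall>x\<in>{a..b}. dist x p < d \<longrightarrow> dist (v x) (v p) < \<eta>" if "p \<in> {a<..<b}" for p
        using cont[unfolded continuous_on_iff, rule_format, of p \<eta>] that \<open>0 < \<eta>\<close> by auto
      then obtain d1 d2 where d: "0 < d1" "0 < d2"
        "\<And>x. x \<in> {a..b} \<Longrightarrow> dist x y < d1 \<Longrightarrow> dist (v x) (v y) < \<eta>"
        "\<And>x. x \<in> {a..b} \<Longrightarrow> dist x z < d2 \<Longrightarrow> dist (v x) (v z) < \<eta>"
        using y z by metis
      \<comment> \<open>The bumps live on \<open>[y, y + e]\<close> and \<open>[z, z + e]\<close>, which have to stay inside \<open>(a, b)\<close> and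
        inside the neighbourhoods where \<open>v\<close> varies by less than \<open>\<eta>\<close>.\<close>
      define e where "e = min (min d1 d2) (min (b - y) (b - z)) / 2"
      have e: "0 < e" "e < d1" "e < d2" "y + e < b" "z + e < b"
      proof -
        define m where "m = min (min d1 d2) (min (b - y) (b - z))"
        have "0 < m" "m \<le> d1" "m \<le> d2" "m \<le> b - y" "m \<le> b - z"
          using d(1,2) y z by (auto simp: m_def)
        moreover have "e = m / 2" by (simp add: e_def m_def)
        ultimately show "0 < e" "e < d1" "e < d2" "y + e < b" "z + e < b" by linarith+
      qed
      define T where "T p x = S (1 / e * x + (- p / e))" for p x
      define \<gamma> where "\<gamma> p x = \<beta> (1 / e * x + (- p / e)) * (1 / e)" for p x
      have T_smooth: "smooth (T p)" for p
        unfolding T_def by (intro smooth_affine S(1))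
      have T_deriv: "(T p has_real_derivative \<gamma> p x) (at x)" for p x
        unfolding T_def \<gamma>_def by (rule DERIV_chain'[OF _ S(2)]) (use e(1) in \<open>auto intro!: derivative_eq_intros\<close>)
      have deriv_T: "deriv (T p) = \<gamma> p" for p
        by (intro ext DERIV_imp_deriv T_deriv)
      have arg: "1 / e * x + (- p / e) = (x - p) / e" for x p
        by (simp add: diff_divide_distrib)
      have T_val: "x \<le> p \<Longrightarrow> T p x = 0" "p + e \<le> x \<Longrightarrow> T p x = c" for p x
        unfolding T_def arg using e(1) by (auto intro!: S simp: divide_le_0_iff le_divide_eq)
      have \<gamma>_nonneg: "0 \<le> \<gamma> p x" for p x unfolding \<gamma>_def using S(4) e(1) by simp
      have \<gamma>_zero: "\<gamma> p x = 0" if "x \<le> p \<or> p + e \<le> x" for p x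
        unfolding \<gamma>_def arg using e(1) that S(5)[of "(x - p) / e"]
        by (auto simp: divide_le_0_iff le_divide_eq)
      define \<phi> where "\<phi> = (\<lambda>x. T y x - T z x)"
      have \<phi>_smooth: "smooth \<phi>" unfolding \<phi>_def by (intro smooth_diff T_smooth)
      have "{x. \<phi> x \<noteq> 0} \<subseteq> {min y z..max y z + e}"
      proof (rule subsetI, rule ccontr)
        fix x assume "x \<in> {x. \<phi> x \<noteq> 0}" "x \<notin> {min y z..max y z + e}"
        then show False using T_val[of x y] T_val[of y x] T_val[of x z] T_val[of z x]
          by (auto simp: \<phi>_def min_def max_def split: if_splits)
      qed
      then have "closure {x. \<phi> x \<noteq> 0} \<subseteq> {min y z..max y z + e}"
        by (intro closure_minimal) auto
      also have "\<dots> \<subseteq> {a<..<b}" using y z e by auto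
      finally have \<phi>: "\<phi> \<in> test_functions a b"
        using \<phi>_smooth by (simp add: test_functions_def smooth_def)
      have deriv_\<phi>: "deriv \<phi> x = \<gamma> y x - \<gamma> z x" for x
        unfolding \<phi>_def by (intro DERIV_imp_deriv DERIV_diff T_deriv)
      have \<gamma>_cont: "continuous_on A (\<gamma> p)" for A p
        unfolding deriv_T[symmetric] by (intro smooth_imp_continuous_on smooth_deriv T_smooth)
      have int: "integrable LEB (\<lambda>x. f x * of_real (\<gamma> p x))"
        if "continuous_on {a..b} f" for p and f :: "real \<Rightarrow> complex"
        by (intro sq_integrable_imp_integrable[OF finite_leb] continuous_sq_integrable continuous_intros that \<gamma>_cont)
      have mass: "(LINT x|LEB. \<gamma> p x) = c" if "a < p" "p + e < b" for p
      proof -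
        have "(LINT x|LEB. \<gamma> p x) = (LINT x:{a..b}|LEB. deriv (T p) x)"
          unfolding set_lebesgue_integral_def deriv_T by (intro Bochner_Integration.integral_cong) auto
        also have "\<dots> = T p b - T p a" using ab by (intro integral_deriv_smooth T_smooth) auto
        finally show ?thesis using that by (simp add: T_val)
      qed
      have approx: "cmod ((LINT x|LEB. v x * of_real (\<gamma> p x)) - c * v p) \<le> \<eta> * c"
        if p: "a < p" "p + e < b" and near: "\<And>x. x \<in> {a..b} \<Longrightarrow> \<bar>x - p\<bar> < e \<Longrightarrow> cmod (v x - v p) \<le> \<eta>" for p
      proof -
        have int_\<gamma>: "integrable LEB (\<gamma> p)"
          using integrable_bounded_linear[OF bounded_linear_Re int[of "\<lambda>_. 1" p]] by simp
        have "(LINT x|LEB. v x * of_real (\<gamma> p x)) - c * v p = (LINT x|LEB. v x * of_real (\<gamma> p x)) - (LINT x|LEB. v p * of_real (\<gamma> p x))"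
          using mass[OF p] by simp
        also have "\<dots> = (LINT x|LEB. v x * of_real (\<gamma> p x) - v p * of_real (\<gamma> p x))"
          by (intro Bochner_Integration.integral_diff[symmetric] int cont continuous_on_const)
        also have "cmod \<dots> \<le> (LINT x|LEB. cmod (v x * of_real (\<gamma> p x) - v p * of_real (\<gamma> p x)))"
          by (rule integral_norm_bound)
        also have "\<dots> \<le> (LINT x|LEB. \<eta> * \<gamma> p x)"
        proof (rule integral_mono)
          show "integrable LEB (\<lambda>x. cmod (v x * of_real (\<gamma> p x) - v p * of_real (\<gamma> p x)))"
            by (intro integrable_norm Bochner_Integration.integrable_diff int cont continuous_on_const)
          show "integrable LEB (\<lambda>x. \<eta> * \<gamma> p x)" using int_\<gamma> by simp
          fix x assume x: "x \<in> space LEB"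
          have "cmod (v x * of_real (\<gamma> p x) - v p * of_real (\<gamma> p x)) = cmod (v x - v p) * \<gamma> p x"
            using \<gamma>_nonneg by (simp add: left_diff_distrib[symmetric] norm_mult)
          also have "\<dots> \<le> \<eta> * \<gamma> p x"
          proof (cases "\<bar>x - p\<bar> < e")
            case True
            then show ?thesis using near x \<gamma>_nonneg by (intro mult_right_mono) auto
          next
            case False
            then have "x \<le> p \<or> p + e \<le> x" by linarith
            then show ?thesis by (simp add: \<gamma>_zero)
          qed
          finally show "cmod (v x * of_real (\<gamma> p x) - v p * of_real (\<gamma> p x)) \<le> \<eta> * \<gamma> p x" .
        qed
        also have "\<dots> = \<eta> * c" using mass[OF p] by simp
        finally show ?thesis .
      qed
      have "(LINT x|LEB. v x * of_real (deriv \<phi> x)) = (LINT x|LEB. v x * of_real (\<gamma> y x) - v x * of_real (\<gamma> z x))"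
        by (simp add: deriv_\<phi> algebra_simps)
      also have "\<dots> = (LINT x|LEB. v x * of_real (\<gamma> y x)) - (LINT x|LEB. v x * of_real (\<gamma> z x))"
        by (intro Bochner_Integration.integral_diff int cont)
      finally have eq: "(LINT x|LEB. v x * of_real (\<gamma> y x)) = (LINT x|LEB. v x * of_real (\<gamma> z x))"
        using zero[OF \<phi>] by simp
      have near_y: "cmod (v x - v y) \<le> \<eta>" if "x \<in> {a..b}" "\<bar>x - y\<bar> < e" for x
        using d(3)[OF that(1)] that(2) e(2) by (simp add: dist_norm)
      have near_z: "cmod (v x - v z) \<le> \<eta>" if "x \<in> {a..b}" "\<bar>x - z\<bar> < e" for x
        using d(4)[OF that(1)] that(2) e(3) by (simp add: dist_norm)
      define Iy where "Iy = (LINT x|LEB. v x * of_real (\<gamma> y x))"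
      have "cmod (Iy - c * v y) \<le> \<eta> * c"
        unfolding Iy_def by (rule approx) (use y e near_y in auto)
      moreover have "cmod (Iy - c * v z) \<le> \<eta> * c"
        unfolding Iy_def eq by (rule approx) (use z e near_z in auto)
      moreover have "cmod (c * v y - c * v z) \<le> cmod (Iy - c * v z) + cmod (Iy - c * v y)"
        using norm_triangle_ineq4[of "Iy - c * v z" "Iy - c * v y"] by simp
      ultimately have "cmod (c * v y - c * v z) \<le> 2 * \<eta> * c" by linarith
      then show ?thesis using S(8) by (simp add: right_diff_distrib[symmetric] norm_mult)
    qed
    have "cmod (v y - v z) \<le> 2 * \<eta>" if "0 < \<eta>" for \<eta>
      using small[OF that] S(8) by (simp add: mult.commute)
    \<comment> \<open>Half of a positive number is smaller than the number itself.\<close>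
    from this[of "cmod (v y - v z) / 4"] show "v y = v z" by (cases "v y = v z") auto
  qed
  have closure: "closure {a<..<b} = {a..b}" using ab by simp
  have "v x = v ((a + b) / 2)" if "x \<in> {a..b}" for x
  proof (rule continuous_constant_on_closure[of "{a<..<b}" v])
    show "continuous_on (closure {a<..<b}) v" using cont by (simp only: closure)
    show "v y = v ((a + b) / 2)" if "y \<in> {a<..<b}" for y
      using that ab by (intro inner) auto
    show "x \<in> closure {a<..<b}" using that by (simp only: closure)
  qed
  from this[OF x] this[of a] ab show ?thesis by simp
qed

text \<open>
  Both \<open>u\<close> and the primitive of \<open>h\<close> have weak derivative \<open>h\<close>, so the difference is constant by
  the du Bois-Reymond lemma.  Uniqueness of weak derivatives and Hoelder continuity are read off
  from this representation.
\<close>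

theorem weak_deriv_fundamental:
  assumes u: "u \<in> C_on K a b" and h: "has_weak_deriv K a b u h" and x: "x \<in> {a..b}"
  shows "u x = u a + primitive h x"
proof -
  have hL2: "h \<in> L2 K LEB" using h by (simp add: has_weak_deriv_def)
  then have sq: "sq_integrable LEB h" by (simp add: L2_iff)
  have cont: "continuous_on {a..b} u" using u by (simp add: C_on_def)
  have "u x - primitive h x = u a - primitive h a"
  proof (rule du_Bois_Reymond[where v = "\<lambda>x. u x - primitive h x"])
    show "continuous_on {a..b} (\<lambda>x. u x - primitive h x)"
      by (intro continuous_on_diff cont primitive_continuous sq)
    fix \<phi> assume \<phi>: "\<phi> \<in> test_functions a b"
    have "(LINT x|LEB. (u x - primitive h x) * of_real (deriv \<phi> x))
        = (LINT x|LEB. u x * of_real (deriv \<phi> x)) - (LINT x|LEB. primitive h x * of_real (deriv \<phi> x))"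
      unfolding left_diff_distrib
      by (intro Bochner_Integration.integral_diff continuous_times_deriv_integrable cont primitive_continuous sq \<phi>)
    also have "\<dots> = 0"
      using h \<phi> L2_integrable[OF hL2] by (simp add: has_weak_deriv_def primitive_integration_by_parts)
    finally show "(LINT x|LEB. (u x - primitive h x) * of_real (deriv \<phi> x)) = 0" .
  qed (fact x)
  then show ?thesis by (simp add: algebra_simps)
qed

lemma has_weak_deriv_diff_C_on:
  assumes "u \<in> C_on K a b" "has_weak_deriv K a b u h" "v \<in> C_on K a b" "has_weak_deriv K a b v k"
  shows "has_weak_deriv K a b (\<lambda>x. u x - v x) (\<lambda>x. h x - k x)"
proof (rule primitive_has_weak_deriv)
  have hk: "h \<in> L2 K LEB" "k \<in> L2 K LEB" using assms by (auto simp: has_weak_deriv_def)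
  then show "(\<lambda>x. h x - k x) \<in> L2 K LEB" by (rule L2_diff)
  show "u x - v x = (u a - v a) + primitive (\<lambda>x. h x - k x) x" if "x \<in> {a..b}" for x
    using weak_deriv_fundamental[OF assms(1,2) that] weak_deriv_fundamental[OF assms(3,4) that]
    by (simp add: primitive_diff[OF L2_integrable[OF hk(1)] L2_integrable[OF hk(2)] that])
qed

lemma weak_deriv_unique:
  assumes u: "u \<in> C_on K a b" and h: "has_weak_deriv K a b u h" and k: "has_weak_deriv K a b u k"
  shows "AE x in LEB. h x = k x"
proof -
  have hk: "integrable LEB h" "integrable LEB k"
    using h k L2_integrable by (auto simp: has_weak_deriv_def)
  have "AE x in LEB. h x - k x = 0"
  proof (rule AE_zero_if_primitive_zero)
    show "integrable LEB (\<lambda>x. h x - k x)" using hk by simp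
    show "primitive (\<lambda>x. h x - k x) x = 0" if "x \<in> {a..b}" for x
      using weak_deriv_fundamental[OF u h that] weak_deriv_fundamental[OF u k that]
      by (simp add: primitive_diff[OF hk that])
  qed
  then show ?thesis by simp
qed

lemma has_weak_deriv_weak_deriv: "u \<in> W12 K a b \<Longrightarrow> has_weak_deriv K a b u (weak_deriv K a b u)"
  unfolding W12_def weak_deriv_def using someI_ex[of "has_weak_deriv K a b u"] by blast

text \<open>
  The Dirichlet integral.  It is formed with the representative chosen by \<^const>\<open>weak_deriv\<close>;
  by uniqueness of weak derivatives any other weak derivative gives the same value, which is
  the content of the lemma \<open>energy_eq\<close>.
\<close>

definition energy :: "(real \<Rightarrow> complex) \<Rightarrow> real" where
  "energy u = L2_sq LEB (weak_deriv K a b u)"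

lemma energy_nonneg [simp]: "0 \<le> energy u"
  by (simp add: energy_def)

lemma energy_eq:
  assumes "u \<in> C_on K a b" "has_weak_deriv K a b u h"
  shows "energy u = L2_sq LEB h"
proof -
  have "u \<in> W12 K a b" using assms C_on_subset_L2 by (auto simp: W12_def)
  note wd = has_weak_deriv_weak_deriv[OF this]
  from weak_deriv_unique[OF assms(1) wd assms(2)] wd assms(2) show ?thesis
    unfolding energy_def by (intro L2_sq_cong_AE) (auto simp: has_weak_deriv_def L2_def)
qed

lemma Sobolev_Hoelder:
  assumes "u \<in> W12 K a b" "u \<in> C_on K a b" "x \<in> {a..b}" "y \<in> {a..b}"
  shows "(cmod (u y - u x))\<^sup>2 \<le> \<bar>y - x\<bar> * energy u"
proof -
  note h = has_weak_deriv_weak_deriv[OF assms(1)]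
  have "sq_integrable LEB (weak_deriv K a b u)" using h by (simp add: has_weak_deriv_def L2_iff)
  from primitive_Hoelder[OF this assms(3,4)] show ?thesis
    using weak_deriv_fundamental[OF assms(2) h assms(3)] weak_deriv_fundamental[OF assms(2) h assms(4)]
    by (simp add: energy_def)
qed

lemma primitive_W12:
  assumes "h \<in> L2 K LEB" "\<alpha> \<in> K"
  defines "u \<equiv> \<lambda>x. if x \<in> {a..b} then \<alpha> + primitive h x else 0"
  shows "u \<in> C_on K a b" "u \<in> W12 K a b" "has_weak_deriv K a b u h"
proof -
  have "continuous_on {a..b} (\<lambda>x. \<alpha> + primitive h x)"
    using assms(1) by (intro continuous_intros primitive_continuous) (simp add: L2_iff)
  then have "continuous_on {a..b} u"
    by (rule continuous_on_eq) (simp add: u_def)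
  then show C: "u \<in> C_on K a b"
    using assms primitive_in_K by (auto simp: C_on_def funs_def)
  show h: "has_weak_deriv K a b u h"
    using assms(1) by (rule primitive_has_weak_deriv) (simp add: u_def)
  from C h show "u \<in> W12 K a b" using C_on_subset_L2 by (auto simp: W12_def)
qed

end

section \<open>The map \<open>\<iota>\<close> on a single edge\<close>

locale edge = interval K a b for K a b +
  fixes M :: "real measure"
  assumes finite_M: "finite_measure M"
    and space_M [simp]: "space M = {a..b}"
    and sets_M: "sets M = sets (restrict_space borel {a..b})"
    and ends_in_spt: "a \<in> spt M" "b \<in> spt M"
begin

sublocale M: finite_measure M
  by (rule finite_M)

lemma in_sets_M: "A \<in> sets borel \<Longrightarrow> A \<subseteq> {a..b} \<Longrightarrow> A \<in> sets M"
  unfolding sets_M by (subst sets_restrict_space_iff) auto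

lemma continuous_measurable_M:
  fixes f :: "real \<Rightarrow> 'a::topological_space"
  shows "continuous_on {a..b} f \<Longrightarrow> f \<in> borel_measurable M"
  unfolding measurable_cong_sets[OF sets_M refl]
  by (rule borel_measurable_continuous_on_restrict)

lemma C_on_subset_L2_M: "C_on K a b \<subseteq> L2 K M"
proof
  fix f assume f: "f \<in> C_on K a b"
  then have cont: "continuous_on {a..b} f" by (simp add: C_on_def)
  obtain B where "\<forall>x\<in>{a..b}. cmod (f x) \<le> B"
    using compact_imp_bounded[OF compact_continuous_image[OF cont compact_Icc]]
    unfolding bounded_iff by auto
  then have "sq_integrable M f"
    by (intro sq_integrable_bounded(1)[OF finite_M continuous_measurable_M[OF cont], of B]) simp
  with f show "f \<in> L2 K M" by (simp add: C_on_def L2_iff)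
qed

lemma spt_subset: "spt M \<subseteq> {a..b}"
  by (auto simp: spt_def)

lemma closed_spt: "closed (spt M)"
proof -
  have "\<exists>T. open T \<and> x \<in> T \<and> T \<subseteq> - spt M" if x: "x \<in> - spt M" for x
  proof (cases "x \<in> {a..b}")
    case True
    with x obtain U where "open U" "x \<in> U" "\<not> emeasure M (U \<inter> {a..b}) > 0"
      by (auto simp: spt_def)
    then show ?thesis by (intro exI[of _ U]) (auto simp: spt_def)
  next
    case False
    then show ?thesis
      using spt_subset by (intro exI[of _ "- {a..b}"]) auto
  qed
  then show ?thesis
    unfolding closed_def by (subst open_subopen) auto
qed

text \<open>
  The complement of the support is a union of open null sets; by Lindelof's theorem countably
  many of them suffice.
\<close>

lemma AE_in_spt: "AE x in M. x \<in> spt M"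
proof -
  define \<U> where "\<U> = {U. open U \<and> emeasure M (U \<inter> {a..b}) = 0}"
  obtain \<V> where \<V>: "\<V> \<subseteq> \<U>" "countable \<V>" "\<Union>\<V> = \<Union>\<U>"
    by (rule Lindelof[of \<U>]) (auto simp: \<U>_def)
  have "(\<Union>U\<in>\<V>. U \<inter> {a..b}) \<in> null_sets M"
    using \<V>(1,2) by (intro null_sets_UN') (auto simp: \<U>_def null_sets_def intro!: in_sets_M)
  moreover have "{x \<in> space M. x \<notin> spt M} \<subseteq> (\<Union>U\<in>\<V>. U \<inter> {a..b})"
  proof
    fix x assume "x \<in> {x \<in> space M. x \<notin> spt M}"
    then have "x \<in> {a..b}" "x \<in> \<Union>\<U>" by (auto simp: spt_def \<U>_def)
    then show "x \<in> (\<Union>U\<in>\<V>. U \<inter> {a..b})" using \<V>(3) by auto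
  qed
  ultimately show ?thesis by (rule AE_I')
qed

text \<open>
  Continuous functions do not see the measure beyond its support: where they differ, they differ
  on an open set, and an open set that meets the support is not null.
\<close>

lemma AE_eq_iff_eq_on_spt:
  assumes "f \<in> C_on K a b" "g \<in> C_on K a b"
  shows "(AE x in M. f x = g x) \<longleftrightarrow> (\<forall>x\<in>spt M. f x = g x)"
proof
  assume "\<forall>x\<in>spt M. f x = g x"
  with AE_in_spt show "AE x in M. f x = g x" by (auto elim: eventually_mono)
next
  assume AE: "AE x in M. f x = g x"
  have cont: "continuous_on {a..b} (\<lambda>x. f x - g x)"
    using assms by (auto simp: C_on_def intro: continuous_on_diff)
  show "\<forall>x\<in>spt M. f x = g x"
  proof (rule ballI, rule ccontr)
    fix x assume x: "x \<in> spt M" and neq: "f x \<noteq> g x"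
    have "x \<in> {a..b}" using x spt_subset by auto
    then obtain d where d: "0 < d" "\<And>y. y \<in> {a..b} \<Longrightarrow> dist y x < d \<Longrightarrow> dist (f y - g y) (f x - g x) < dist (f x - g x) 0"
      using cont[unfolded continuous_on_iff, rule_format, of x "dist (f x - g x) 0"] neq by auto
    have "AE y in M. y \<notin> ball x d"
      using AE AE_space[of M]
    proof eventually_elim
      case (elim y)
      with d(2)[of y] show ?case by (auto simp: dist_commute)
    qed
    then have "emeasure M {y \<in> space M. \<not> y \<notin> ball x d} = 0" by (rule AE_E2)
    moreover have "{y \<in> space M. \<not> y \<notin> ball x d} = ball x d \<inter> space M" by auto
    moreover have "0 < emeasure M (ball x d \<inter> space M)"
      using x open_ball[of x d] centre_in_ball[of x d] d(1) unfolding spt_def by blast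
    ultimately show False by simp
  qed
qed

text \<open>
  The last point of the support to the left of \<open>x\<close>.  This map collapses every component of the
  complement of the support to its left end point and is injective on the support, so its
  level sets encode the gaps of the support without any enumeration of them.
\<close>

definition left_spt :: "real \<Rightarrow> real" where
  "left_spt x = Sup (spt M \<inter> {a..x})"

lemma left_spt:
  assumes "x \<in> {a..b}"
  shows "left_spt x \<in> spt M" "left_spt x \<le> x"
    "\<And>y. y \<in> spt M \<Longrightarrow> y \<le> x \<Longrightarrow> y \<le> left_spt x"
proof -
  have ne: "spt M \<inter> {a..x} \<noteq> {}" using ends_in_spt(1) assms by auto
  have bdd: "bdd_above (spt M \<inter> {a..x})" by (meson bdd_above_Icc bdd_above_mono inf_le2)
  have "left_spt x \<in> spt M \<inter> {a..x}"
    unfolding left_spt_def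
    using ne bdd by (intro closed_contains_Sup closed_Int closed_spt) auto
  then show "left_spt x \<in> spt M" "left_spt x \<le> x" by auto
  show "y \<le> left_spt x" if "y \<in> spt M" "y \<le> x" for y
    unfolding left_spt_def using that spt_subset by (intro cSup_upper bdd) auto
qed

lemma gap_exists:
  assumes x: "x \<in> {a..b} - spt M"
  obtains p q where "p \<in> spt M" "q \<in> spt M" "p < x" "x < q" "{p<..<q} \<subseteq> {a..b} - spt M"
proof -
  define q where "q = Inf (spt M \<inter> {x..b})"
  have ne: "spt M \<inter> {x..b} \<noteq> {}" using ends_in_spt(2) x by auto
  have bdd: "bdd_below (spt M \<inter> {x..b})" by (meson bdd_below_Icc bdd_below_mono inf_le2)
  have q: "q \<in> spt M \<inter> {x..b}"
    unfolding q_def using ne bdd by (intro closed_contains_Inf closed_Int closed_spt) auto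
  have q_le: "q \<le> y" if "y \<in> spt M" "x \<le> y" for y
    unfolding q_def using that spt_subset by (intro cInf_lower bdd) auto
  have p: "left_spt x \<in> spt M" "left_spt x \<le> x" "\<And>y. y \<in> spt M \<Longrightarrow> y \<le> x \<Longrightarrow> y \<le> left_spt x"
    using left_spt x by auto
  show thesis
  proof (rule that[of "left_spt x" q])
    show "left_spt x < x" "x < q" using p q x by (auto simp: order_less_le)
    show "{left_spt x<..<q} \<subseteq> {a..b} - spt M"
    proof
      fix y assume y: "y \<in> {left_spt x<..<q}"
      then have "y \<notin> spt M" using p(3)[of y] q_le[of y] by (cases "y \<le> x") auto
      moreover have "y \<in> {a..b}" using y p(1) q spt_subset by auto
      ultimately show "y \<in> {a..b} - spt M" by simp
    qed
  qed (use p q in auto)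
qed

text \<open>
  On a gap the function is affine, and by continuity it vanishes at both end points of the gap,
  which belong to the support because \<open>a\<close> and \<open>b\<close> do.
\<close>

lemma C_mu_zero_if_zero_on_spt:
  assumes f: "f \<in> C_mu K a b M" and zero: "\<And>x. x \<in> spt M \<Longrightarrow> f x = 0"
  shows "f x = 0"
proof -
  have C: "f \<in> C_on K a b" using f by (simp add: C_mu_def)
  consider "x \<in> spt M" | "x \<notin> {a..b}" | "x \<in> {a..b} - spt M" by auto
  then show ?thesis
  proof cases
    case 3
    obtain p q where pq: "p \<in> spt M" "q \<in> spt M" "p < x" "x < q" "{p<..<q} \<subseteq> {a..b} - spt M"
      using gap_exists[OF 3] by blast
    define I where "I = connected_component_set ({a..b} - spt M) x"
    have sub: "{p<..<q} \<subseteq> I"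
      unfolding I_def using pq by (intro connected_component_maximal) auto
    have "I \<in> components ({a..b} - spt M)" using 3 by (auto simp: I_def components_def)
    then obtain \<alpha> \<beta> where aff: "\<And>y. y \<in> I \<Longrightarrow> f y = \<alpha> + \<beta> * of_real y"
      using f by (auto simp: C_mu_def)
    have "p \<in> {a..b}" "q \<in> {a..b}" using pq spt_subset by auto
    then have pq_sub: "{p..q} \<subseteq> {a..b}" by auto
    have closure: "closure {p<..<q} = {p..q}" using pq by simp
    have cont: "continuous_on {p..q} (\<lambda>y. f y - (\<alpha> + \<beta> * of_real y))"
      using C pq_sub by (intro continuous_intros) (auto simp: C_on_def intro: continuous_on_subset)
    have ext: "f y - (\<alpha> + \<beta> * of_real y) = 0" if "y \<in> {p..q}" for y
    proof (rule continuous_constant_on_closure[of "{p<..<q}" "\<lambda>y. f y - (\<alpha> + \<beta> * of_real y)"])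
      show "continuous_on (closure {p<..<q}) (\<lambda>y. f y - (\<alpha> + \<beta> * of_real y))"
        using cont by (simp only: closure)
      show "f y - (\<alpha> + \<beta> * of_real y) = 0" if "y \<in> {p<..<q}" for y
        using aff sub that by auto
      show "y \<in> closure {p<..<q}" using that by (simp only: closure)
    qed
    have "\<alpha> + \<beta> * of_real p = 0" "\<alpha> + \<beta> * of_real q = 0"
      using ext[of p] ext[of q] zero pq by auto
    then have "\<beta> * (of_real q - of_real p) = 0"
      by (metis add_diff_cancel_left diff_self right_diff_distrib')
    then have "\<beta> = 0" using pq by auto
    with \<open>\<alpha> + \<beta> * of_real p = 0\<close> have "\<alpha> = 0" by simp
    with \<open>\<beta> = 0\<close> ext[of x] pq show ?thesis by simp
  qed (use zero C in \<open>auto simp: C_on_def funs_def\<close>)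
qed

lemma left_spt_eq_on_component:
  assumes I: "I \<in> components ({a..b} - spt M)" and "x \<in> I" "y \<in> I"
  shows "left_spt x = left_spt y"
  using assms(2,3)
proof (induction x y rule: linorder_wlog)
  case (le x y)
  have sub: "{x..y} \<subseteq> I"
    using in_components_connected[OF I] le by (intro connected_contains_Icc)
  have "z \<le> x" if "z \<in> spt M" "z \<le> y" for z
  proof (rule ccontr)
    assume "\<not> z \<le> x"
    then have "z \<in> I" using sub that by auto
    then show False using in_components_subset[OF I] that by blast
  qed
  then have "spt M \<inter> {a..x} = spt M \<inter> {a..y}" using le(1) by auto
  then show ?case by (simp add: left_spt_def)
qed simp

lemma left_spt_less_iff:
  assumes "x \<in> spt M" "y \<in> {a..b}"
  shows "left_spt y < x \<longleftrightarrow> y < x"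
  using left_spt[OF assms(2)] assms(1) by (meson not_le order_le_less_trans)

lemma set_integral_Icc_Ico:
  fixes h :: "real \<Rightarrow> 'a::{banach, second_countable_topology}"
  assumes [measurable]: "h \<in> borel_measurable LEB"
  shows "(LINT t:{a..x}|LEB. h t) = (LINT t:{a..<x}|LEB. h t)"
  unfolding set_lebesgue_integral_def
proof (rule integral_cong_AE)
  show "AE t in LEB. indicat_real {a..x} t *\<^sub>R h t = indicat_real {a..<x} t *\<^sub>R h t"
    using AE_leb_neq[of x] by eventually_elim (auto simp: indicator_def)
qed measurable

text \<open>
  The function \<open>k\<close> replaces \<open>h\<close> on every gap by its mean value.  It is the conditional
  expectation of \<open>h\<close> given the sigma algebra generated by \<^const>\<open>left_spt\<close>: measurability
  makes it constant on level sets, Jensen's inequality keeps it square integrable, and the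
  interval \<open>[a,x)\<close> is a union of level sets if \<open>x\<close> lies in the support, so integrals over it
  are preserved.
\<close>

lemma gap_average:
  fixes h :: "real \<Rightarrow> real"
  assumes h: "integrable LEB h" and h_sq: "integrable LEB (\<lambda>x. (h x)\<^sup>2)"
  obtains k where "k \<in> borel_measurable LEB" "integrable LEB (\<lambda>x. (k x)\<^sup>2)"
    "\<And>x y. x \<in> {a..b} \<Longrightarrow> y \<in> {a..b} \<Longrightarrow> left_spt x = left_spt y \<Longrightarrow> k x = k y"
    "\<And>x. x \<in> spt M \<Longrightarrow> (LINT t:{a..x}|LEB. k t) = (LINT t:{a..x}|LEB. h t)"
proof -
  define F where "F = vimage_algebra {a..b} left_spt borel"
  have sets_F: "sets F = {left_spt -` A \<inter> {a..b} | A. A \<in> sets borel}"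
    unfolding F_def by (rule sets_vimage_algebra2) simp
  have mono: "mono_on {a..b} left_spt"
    by (rule mono_onI) (use left_spt in \<open>metis order_trans\<close>)
  have meas: "left_spt \<in> borel_measurable LEB"
    unfolding measurable_cong_sets[OF sets_leb refl]
    by (rule borel_measurable_mono_on_fnc[OF mono])
  have "subalgebra LEB F"
    unfolding subalgebra_def
  proof
    show "space F = space LEB" by (simp add: F_def)
    show "sets F \<subseteq> sets LEB"
      using measurable_sets[OF meas] by (auto simp: sets_F)
  qed
  then interpret F: finite_measure_subalgebra LEB F
    by unfold_locales
  define k where "k = real_cond_exp LEB F h"
  have k_int: "integrable LEB k" unfolding k_def by (rule F.real_cond_exp_int(1)[OF h])
  show thesis
  proof
    show k_meas: "k \<in> borel_measurable LEB" using k_int by simp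
    show "integrable LEB (\<lambda>x. (k x)\<^sup>2)"
      unfolding k_def
      by (rule F.integrable_convex_cond_exp[where I = UNIV and q = "\<lambda>x. x\<^sup>2"])
         (use h h_sq convex_power2 in auto)
    show "k x = k y" if "x \<in> {a..b}" "y \<in> {a..b}" "left_spt x = left_spt y" for x y
    proof -
      have "k \<in> borel_measurable F" by (simp add: k_def)
      then have "k -` {k x} \<inter> space F \<in> sets F" by (rule measurable_sets) simp
      then obtain A where "k -` {k x} \<inter> space F = left_spt -` A \<inter> {a..b}"
        unfolding sets_F by blast
      then have A: "k -` {k x} \<inter> {a..b} = left_spt -` A \<inter> {a..b}" by (simp add: F_def)
      have "x \<in> left_spt -` A \<inter> {a..b}" unfolding A[symmetric] using that by simp
      then have "y \<in> left_spt -` A \<inter> {a..b}" using that by simp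
      then show ?thesis unfolding A[symmetric] by simp
    qed
    show "(LINT t:{a..x}|LEB. k t) = (LINT t:{a..x}|LEB. h t)" if x: "x \<in> spt M" for x
    proof -
      have "left_spt -` {..<x} \<inter> {a..b} = {a..<x}"
        using left_spt_less_iff[OF x] x spt_subset by auto
      then have "{a..<x} \<in> sets F" unfolding sets_F by (intro CollectI exI[of _ "{..<x}"]) auto
      from F.real_cond_exp_intA[OF h this]
      show ?thesis
        using k_meas h by (simp add: set_integral_Icc_Ico k_def)
    qed
  qed
qed

lemma Re_primitive:
  assumes "integrable LEB h" "x \<in> {a..b}"
  shows "Re (primitive h x) = (LINT t:{a..x}|LEB. Re (h t))"
    and "Im (primitive h x) = (LINT t:{a..x}|LEB. Im (h t))"
proof -
  have "integrable LEB (\<lambda>t. indicat_real {a..x} t *\<^sub>R h t)"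
    using set_integrable_leb[OF assms(1), of "{a..x}"] assms(2) by (auto simp: set_integrable_def)
  then show "Re (primitive h x) = (LINT t:{a..x}|LEB. Re (h t))"
    "Im (primitive h x) = (LINT t:{a..x}|LEB. Im (h t))"
    unfolding primitive_def set_lebesgue_integral_def by (simp_all flip: integral_Re integral_Im)
qed

text \<open>
  Averaging the derivative of \<open>g\<close> over the gaps produces the derivative of the function that
  agrees with \<open>g\<close> on the support and interpolates linearly across the gaps.  This is the
  existence half of the definition of \<open>\<iota>\<^sub>e\<close>.
\<close>

theorem gap_linearization:
  assumes g: "g \<in> W12 K a b" "g \<in> C_on K a b"
  obtains u where "u \<in> W12_mu K a b M" "\<And>x. x \<in> spt M \<Longrightarrow> u x = g x"
proof -
  define h where "h = weak_deriv K a b g"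
  have h_deriv: "has_weak_deriv K a b g h" unfolding h_def by (rule has_weak_deriv_weak_deriv[OF g(1)])
  then have h: "h \<in> L2 K LEB" by (simp add: has_weak_deriv_def)
  then have h_int: "integrable LEB h" and h_meas [measurable]: "h \<in> borel_measurable LEB"
    and h_sq: "integrable LEB (\<lambda>x. (cmod (h x))\<^sup>2)"
    by (auto simp: L2_def L2_integrable)
  have Re_sq: "integrable LEB (\<lambda>x. (Re (h x))\<^sup>2)" and Im_sq: "integrable LEB (\<lambda>x. (Im (h x))\<^sup>2)"
    by (rule Bochner_Integration.integrable_bound[OF h_sq]; simp add: cmod_power2)+
  obtain kr where kr: "kr \<in> borel_measurable LEB" "integrable LEB (\<lambda>x. (kr x)\<^sup>2)"
      "\<And>x y. x \<in> {a..b} \<Longrightarrow> y \<in> {a..b} \<Longrightarrow> left_spt x = left_spt y \<Longrightarrow> kr x = kr y"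
      "\<And>x. x \<in> spt M \<Longrightarrow> (LINT t:{a..x}|LEB. kr t) = (LINT t:{a..x}|LEB. Re (h t))"
    by (fact gap_average[OF integrable_Re[OF h_int] Re_sq])
  obtain ki where ki: "ki \<in> borel_measurable LEB" "integrable LEB (\<lambda>x. (ki x)\<^sup>2)"
      "\<And>x y. x \<in> {a..b} \<Longrightarrow> y \<in> {a..b} \<Longrightarrow> left_spt x = left_spt y \<Longrightarrow> ki x = ki y"
      "\<And>x. x \<in> spt M \<Longrightarrow> (LINT t:{a..x}|LEB. ki t) = (LINT t:{a..x}|LEB. Im (h t))"
    by (fact gap_average[OF integrable_Im[OF h_int] Im_sq])
  \<comment> \<open>For \<open>K = \<real>\<close> the averaged imaginary part vanishes only almost everywhere, so it is
    discarded in order that \<open>k\<close> be real everywhere.\<close>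
  define k where "k x = (if x \<in> {a..b} then Complex (kr x) (if K = UNIV then ki x else 0) else 0)" for x
  have Re_k: "Re (k x) = kr x" and Im_k: "Im (k x) = (if K = UNIV then ki x else 0)" if "x \<in> {a..b}" for x
    using that by (simp_all add: k_def)
  have k_meas: "k \<in> borel_measurable LEB"
  proof -
    have "(\<lambda>x. Complex (kr x) (if K = UNIV then ki x else 0)) \<in> borel_measurable LEB"
      unfolding Complex_eq using kr(1) ki(1) by (cases "K = UNIV") simp_all
    then show ?thesis
      by (rule measurable_cong[THEN iffD1, rotated]) (simp add: k_def)
  qed
  have k: "k \<in> L2 K LEB"
  proof -
    have "integrable LEB (\<lambda>x. (kr x)\<^sup>2 + (ki x)\<^sup>2)" using kr(2) ki(2) by simp
    then have "integrable LEB (\<lambda>x. (cmod (k x))\<^sup>2)"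
    proof (rule Bochner_Integration.integrable_bound)
      show "(\<lambda>x. (cmod (k x))\<^sup>2) \<in> borel_measurable LEB" using k_meas by simp
      show "AE x in LEB. norm ((cmod (k x))\<^sup>2) \<le> norm ((kr x)\<^sup>2 + (ki x)\<^sup>2)"
        by (rule AE_I2) (simp add: cmod_power2 Re_k Im_k)
    qed
    moreover have "k \<in> funs K {a..b}"
      using K by (auto simp: funs_def k_def complex_is_Real_iff)
    ultimately show ?thesis using k_meas by (simp add: L2_def)
  qed
  have k_int: "integrable LEB k" by (rule L2_integrable[OF k])
  have k_gap: "k x = k y" if "x \<in> {a..b}" "y \<in> {a..b}" "left_spt x = left_spt y" for x y
    unfolding k_def using kr(3)[OF that] ki(3)[OF that] that by simp
  have k_spt: "primitive k x = primitive h x" if x: "x \<in> spt M" for x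
  proof (rule complex_eqI)
    have x': "x \<in> {a..b}" using x spt_subset by auto
    have *: "(LINT t:{a..x}|LEB. f t) = (LINT t:{a..x}|LEB. f' t)"
      if "\<And>t. t \<in> {a..b} \<Longrightarrow> f t = f' t" for f f' :: "real \<Rightarrow> real"
      unfolding set_lebesgue_integral_def using that by (intro Bochner_Integration.integral_cong) auto
    show "Re (primitive k x) = Re (primitive h x)"
      unfolding Re_primitive(1)[OF h_int x'] Re_primitive(1)[OF k_int x'] kr(4)[OF x, symmetric]
      by (rule *) (rule Re_k)
    show "Im (primitive k x) = Im (primitive h x)"
    proof (cases "K = UNIV")
      case True
      show ?thesis
        unfolding Re_primitive(2)[OF h_int x'] Re_primitive(2)[OF k_int x'] ki(4)[OF x, symmetric]
        by (rule *) (simp add: Im_k True)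
    next
      case False
      then have "K = \<real>" using K by simp
      have "Im (k t) = Im (h t)" if "t \<in> {a..b}" for t
      proof -
        have "h t \<in> \<real>" using h \<open>K = \<real>\<close> that by (simp add: L2_def funs_def)
        then show ?thesis using False that by (simp add: Im_k complex_is_Real_iff)
      qed
      then show ?thesis
        unfolding Re_primitive(2)[OF h_int x'] Re_primitive(2)[OF k_int x'] by (rule *)
    qed
  qed
  have ga: "g a \<in> K" using g(2) ab by (simp add: C_on_def funs_def)
  define u where "u = (\<lambda>x. if x \<in> {a..b} then g a + primitive k x else 0)"
  have u: "u \<in> C_on K a b" "u \<in> W12 K a b"
    unfolding u_def by (rule primitive_W12[OF k ga])+
  have "\<exists>\<alpha>\<in>K. \<exists>\<beta>\<in>K. \<forall>x\<in>I. u x = \<alpha> + \<beta> * of_real x" if I: "I \<in> components ({a..b} - spt M)" for I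
  proof -
    obtain x0 where x0: "x0 \<in> I" using in_components_nonempty[OF I] by auto
    have I_sub: "I \<subseteq> {a..b}" using in_components_subset[OF I] by auto
    define \<beta> where "\<beta> = k x0"
    have k_const: "k t = \<beta>" if "t \<in> I" for t
      unfolding \<beta>_def using I_sub that x0 left_spt_eq_on_component[OF I that x0] by (intro k_gap) auto
    have incr: "primitive k y - primitive k x = \<beta> * (of_real y - of_real x)"
      if "x \<in> I" "y \<in> I" for x y
      using that
    proof (induction x y rule: linorder_wlog)
      case (le x y)
      have sub: "{x..y} \<subseteq> I"
        using in_components_connected[OF I] le by (intro connected_contains_Icc)
      have xy: "a \<le> x" "y \<le> b" using le I_sub by auto
      have "primitive k y - primitive k x = (LINT t:{x<..y}|LEB. k t)"
        using le xy by (intro primitive_increment k_int) auto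
      also have "\<dots> = (LINT t:{x<..y}|LEB. \<beta>)"
      proof -
        have "k t = \<beta>" if "t \<in> {x<..y}" for t using sub that by (intro k_const) auto
        then show ?thesis
          unfolding set_lebesgue_integral_def
          by (intro Bochner_Integration.integral_cong) (auto simp: indicator_def)
      qed
      also have "\<dots> = measure LEB {x<..y} *\<^sub>R \<beta>"
        unfolding set_lebesgue_integral_def using xy
        by (simp add: Int_absorb2 subset_eq in_sets_leb leb.emeasure_eq_measure)
      also have "measure LEB {x<..y} = y - x"
        using le xy by (subst measure_def, subst emeasure_leb) auto
      finally show ?case by (simp add: scaleR_conv_of_real mult.commute)
    next
      case (sym x y)
      then have "primitive k x - primitive k y = \<beta> * (of_real x - of_real y)" by simp
      then show ?case by (metis minus_diff_eq mult_minus_right)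
    qed
    have "u x = (u x0 - \<beta> * of_real x0) + \<beta> * of_real x" if "x \<in> I" for x
    proof -
      have "u x - u x0 = primitive k x - primitive k x0"
        using that x0 I_sub by (auto simp: u_def)
      then show ?thesis using incr[OF x0 that] by (simp add: algebra_simps)
    qed
    moreover have "\<beta> \<in> K" "u x0 \<in> K"
      using k u(1) x0 I_sub by (auto simp: \<beta>_def L2_def C_on_def funs_def)
    ultimately show ?thesis
      by (intro bexI[of _ "u x0 - \<beta> * of_real x0"] bexI[of _ \<beta>]) auto
  qed
  with u have "u \<in> W12_mu K a b M" by (simp add: W12_mu_def C_mu_def)
  moreover have "u x = g x" if "x \<in> spt M" for x
  proof -
    have "x \<in> {a..b}" using that spt_subset by auto
    then show ?thesis
      using weak_deriv_fundamental[OF g(2) h_deriv \<open>x \<in> {a..b}\<close>] k_spt[OF that]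
      by (simp add: u_def)
  qed
  ultimately show thesis by (rule that)
qed

lemma W12_mu_C_on: "u \<in> W12_mu K a b M \<Longrightarrow> u \<in> C_on K a b"
  and W12_mu_W12: "u \<in> W12_mu K a b M \<Longrightarrow> u \<in> W12 K a b"
  by (auto simp: W12_mu_def C_mu_def)

lemma W12_diff:
  assumes "u \<in> W12 K a b" "u \<in> C_on K a b" "v \<in> W12 K a b" "v \<in> C_on K a b"
  shows "(\<lambda>x. u x - v x) \<in> W12 K a b"
  using has_weak_deriv_diff_C_on[OF assms(2) has_weak_deriv_weak_deriv[OF assms(1)]
      assms(4) has_weak_deriv_weak_deriv[OF assms(3)]] C_on_diff[OF assms(2,4)] C_on_subset_L2
  by (auto simp: W12_def)

lemma C_muD:
  "u \<in> C_mu K a b M \<Longrightarrow> I \<in> components ({a..b} - spt M) \<Longrightarrow>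
    \<exists>\<alpha>\<in>K. \<exists>\<beta>\<in>K. \<forall>x\<in>I. u x = \<alpha> + \<beta> * of_real x"
  by (simp add: C_mu_def)

lemma C_mu_diff:
  assumes "u \<in> C_mu K a b M" "v \<in> C_mu K a b M"
  shows "(\<lambda>x. u x - v x) \<in> C_mu K a b M"
proof -
  have "\<exists>\<alpha>\<in>K. \<exists>\<beta>\<in>K. \<forall>x\<in>I. u x - v x = \<alpha> + \<beta> * of_real x" if I: "I \<in> components ({a..b} - spt M)" for I
  proof -
    obtain \<alpha> \<beta> where u: "\<alpha> \<in> K" "\<beta> \<in> K" "\<forall>x\<in>I. u x = \<alpha> + \<beta> * of_real x"
      using C_muD[OF assms(1) I] by (elim bexE)
    obtain \<alpha>' \<beta>' where v: "\<alpha>' \<in> K" "\<beta>' \<in> K" "\<forall>x\<in>I. v x = \<alpha>' + \<beta>' * of_real x"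
      using C_muD[OF assms(2) I] by (elim bexE)
    have "u x - v x = (\<alpha> - \<alpha>') + (\<beta> - \<beta>') * of_real x" if "x \<in> I" for x
      using u(3)[rule_format, OF that] v(3)[rule_format, OF that] by (simp add: algebra_simps)
    moreover have "\<alpha> - \<alpha>' \<in> K" "\<beta> - \<beta>' \<in> K" using u v by simp_all
    ultimately show ?thesis by blast
  qed
  then show ?thesis using assms by (simp add: C_mu_def C_on_diff)
qed

lemma W12_mu_diff:
  "u \<in> W12_mu K a b M \<Longrightarrow> v \<in> W12_mu K a b M \<Longrightarrow> (\<lambda>x. u x - v x) \<in> W12_mu K a b M"
  using W12_diff[OF W12_mu_W12 W12_mu_C_on W12_mu_W12 W12_mu_C_on] C_mu_diff
  by (simp add: W12_mu_def)

abbreviation "D \<equiv> D_iota_e K a b M"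
abbreviation "\<iota> \<equiv> iota_e K a b M"

lemma iota_unique:
  assumes "u \<in> W12_mu K a b M" "AE x in M. u x = f x"
  shows "\<iota> f = u"
  unfolding iota_e_def
proof (rule the_equality)
  fix v assume v: "v \<in> W12_mu K a b M \<and> (AE x in M. v x = f x)"
  then have "AE x in M. v x = u x" using assms(2) by (auto elim: eventually_elim2)
  then have "\<forall>x\<in>spt M. v x = u x"
    using AE_eq_iff_eq_on_spt[OF W12_mu_C_on W12_mu_C_on] v assms(1) by blast
  moreover have "(\<lambda>x. v x - u x) \<in> C_mu K a b M"
    using v assms(1) by (intro C_mu_diff) (simp_all add: W12_mu_def)
  ultimately have "v x - u x = 0" for x
    using C_mu_zero_if_zero_on_spt[of "\<lambda>x. v x - u x" x] by simp
  then show "v = u" by (intro ext) simp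
qed (use assms in simp)

lemma iota_spec:
  assumes "f \<in> D"
  shows "\<iota> f \<in> W12_mu K a b M" "AE x in M. \<iota> f x = f x"
proof -
  obtain g where g: "g \<in> W12 K a b" "g \<in> C_on K a b" "AE x in M. g x = f x"
    using assms by (auto simp: D_iota_e_def)
  obtain u where u: "u \<in> W12_mu K a b M" "\<And>x. x \<in> spt M \<Longrightarrow> u x = g x"
    using gap_linearization[OF g(1,2)] by blast
  have "AE x in M. u x = g x"
    using u by (subst AE_eq_iff_eq_on_spt[OF W12_mu_C_on g(2)]) auto
  then have "AE x in M. u x = f x" using g(3) by (auto elim: eventually_elim2)
  with iota_unique[OF u(1)] u(1) show "\<iota> f \<in> W12_mu K a b M" "AE x in M. \<iota> f x = f x" by simp_all
qed

lemmas iota_C_on = W12_mu_C_on[OF iota_spec(1)]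
lemmas iota_W12 = W12_mu_W12[OF iota_spec(1)]

lemma D_sq_integrable: "f \<in> D \<Longrightarrow> sq_integrable M f"
  by (simp add: D_iota_e_def L2_iff)

lemma iota_diff:
  assumes "f \<in> D" "g \<in> D"
  shows "(\<lambda>x. f x - g x) \<in> D" "\<iota> (\<lambda>x. f x - g x) = (\<lambda>x. \<iota> f x - \<iota> g x)"
proof -
  have W: "(\<lambda>x. \<iota> f x - \<iota> g x) \<in> W12_mu K a b M"
    using assms by (intro W12_mu_diff iota_spec)
  have AE: "AE x in M. \<iota> f x - \<iota> g x = f x - g x"
    using iota_spec(2)[OF assms(1)] iota_spec(2)[OF assms(2)] by eventually_elim simp
  have "(\<lambda>x. f x - g x) \<in> L2 K M" using assms by (intro L2_diff) (auto simp: D_iota_e_def)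
  with W AE show "(\<lambda>x. f x - g x) \<in> D"
    by (auto simp: D_iota_e_def W12_mu_def C_mu_def intro!: bexI[of _ "\<lambda>x. \<iota> f x - \<iota> g x"])
  show "\<iota> (\<lambda>x. f x - g x) = (\<lambda>x. \<iota> f x - \<iota> g x)" using W AE by (rule iota_unique)
qed

text \<open>
  The point evaluation at a point \<open>p\<close> of the support has relative form bound \<open>0\<close>.  Within
  distance \<open>\<epsilon>/2\<close> of \<open>p\<close> the value at \<open>p\<close> differs from the value at \<open>y\<close> by at most the square
  root of \<open>\<epsilon>/2 \<cdot> energy\<close>; averaging over such \<open>y\<close> with respect to \<open>M\<close>, which charges
  every neighbourhood of \<open>p\<close>, gives the estimate.
\<close>

lemma trace_bound:
  assumes p: "p \<in> spt M" and \<epsilon>: "0 < \<epsilon>"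
  obtains C where "0 \<le> C"
    "\<And>f. f \<in> D \<Longrightarrow> (cmod (\<iota> f p))\<^sup>2 \<le> \<epsilon> * energy (\<iota> f) + C * L2_sq M f"
proof -
  define A where "A = ball p (\<epsilon> / 2) \<inter> {a..b}"
  have A: "A \<in> sets M" by (auto simp: A_def intro!: in_sets_M)
  define m where "m = measure M A"
  have "0 < emeasure M A"
    using p open_ball[of p "\<epsilon> / 2"] centre_in_ball[of p "\<epsilon> / 2"] \<epsilon> unfolding spt_def A_def space_M by simp
  then have m: "0 < m" by (simp add: m_def M.emeasure_eq_measure)
  have "(cmod (\<iota> f p))\<^sup>2 \<le> \<epsilon> * energy (\<iota> f) + 2 / m * L2_sq M f" if f: "f \<in> D" for f
  proof -
    define g where "g = \<iota> f"
    have g: "g \<in> W12 K a b" "g \<in> C_on K a b" unfolding g_def using f by (rule iota_W12, rule iota_C_on)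
    have sq: "sq_integrable M g" using C_on_subset_L2_M g(2) by (auto simp: L2_iff)
    have point: "(cmod (g p))\<^sup>2 \<le> 2 * (cmod (g y))\<^sup>2 + \<epsilon> * energy g" if y: "y \<in> A" for y
    proof -
      have "y \<in> {a..b}" "\<bar>y - p\<bar> \<le> \<epsilon> / 2" using y by (auto simp: A_def dist_real_def abs_minus_commute)
      moreover have "p \<in> {a..b}" using p spt_subset by auto
      ultimately have "(cmod (g y - g p))\<^sup>2 \<le> \<epsilon> / 2 * energy g"
        using Sobolev_Hoelder[OF g] by (meson energy_nonneg mult_right_mono order_trans)
      then show ?thesis using cmod_diff_sq_le[of "g y" "g y - g p"] by simp
    qed
    have int_A: "integrable M (\<lambda>y. indicator A y :: real)"
      using A by (simp add: M.emeasure_eq_measure)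
    have "m * ((cmod (g p))\<^sup>2 - \<epsilon> * energy g) = (LINT y|M. indicator A y * ((cmod (g p))\<^sup>2 - \<epsilon> * energy g))"
      using A sets.sets_into_space[OF A] by (simp add: m_def Int_absorb2)
    also have "\<dots> \<le> (LINT y|M. 2 * (cmod (g y))\<^sup>2)"
    proof (rule integral_mono)
      show "integrable M (\<lambda>y. indicator A y * ((cmod (g p))\<^sup>2 - \<epsilon> * energy g))"
        using int_A by (rule integrable_mult_left)
      show "integrable M (\<lambda>y. 2 * (cmod (g y))\<^sup>2)" using sq by (simp add: sq_integrable_def)
      show "indicator A y * ((cmod (g p))\<^sup>2 - \<epsilon> * energy g) \<le> 2 * (cmod (g y))\<^sup>2" for y
        using point[of y] by (cases "y \<in> A") auto
    qed
    also have "\<dots> = 2 * L2_sq M g" by (simp add: L2_sq_def)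
    also have "L2_sq M g = L2_sq M f"
      using iota_spec(2)[OF f] D_sq_integrable[OF f] sq
      by (intro L2_sq_cong_AE) (auto simp: g_def sq_integrable_def)
    finally have "(cmod (g p))\<^sup>2 - \<epsilon> * energy g \<le> 2 * L2_sq M f / m"
      using m by (simp add: pos_le_divide_eq mult.commute)
    then show ?thesis by (simp add: g_def)
  qed
  with m show thesis by (intro that[of "2 / m"]) auto
qed

end

text \<open>
  Affine functions are characterised by equations between triples of their values, so
  they are stable under pointwise limits, and the coefficients of the limit automatically lie
  in \<open>K\<close>.
\<close>

lemma (in scalar_field) affine_on_iff:
  fixes f :: "real \<Rightarrow> complex"
  assumes "\<And>x. x \<in> I \<Longrightarrow> f x \<in> K" "x0 \<in> I"
  shows "(\<exists>\<alpha>\<in>K. \<exists>\<beta>\<in>K. \<forall>x\<in>I. f x = \<alpha> + \<beta> * of_real x) \<longleftrightarrow>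
    (\<forall>x\<in>I. \<forall>y\<in>I. \<forall>z\<in>I. (f y - f x) * of_real (z - x) = (f z - f x) * of_real (y - x))"
    (is "?affine \<longleftrightarrow> ?cross")
proof
  assume ?affine
  then obtain \<alpha> \<beta> where "\<forall>x\<in>I. f x = \<alpha> + \<beta> * of_real x" by (elim bexE)
  then have "f y - f x = \<beta> * of_real (y - x)" if "x \<in> I" "y \<in> I" for x y
    using that by (simp add: algebra_simps)
  then show ?cross by simp
next
  assume cross: ?cross
  show ?affine
  proof (cases "\<exists>y\<in>I. y \<noteq> x0")
    case True
    then obtain y where y: "y \<in> I" "y \<noteq> x0" by blast
    define \<beta> where "\<beta> = (f y - f x0) / of_real (y - x0)"
    have "f x = (f x0 - \<beta> * of_real x0) + \<beta> * of_real x" if "x \<in> I" for x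
    proof -
      have "(f y - f x0) * of_real (x - x0) = (f x - f x0) * of_real (y - x0)"
        using cross assms(2) y that by blast
      then have "\<beta> * of_real (x - x0) = f x - f x0"
        using y(2) by (simp add: \<beta>_def divide_eq_eq)
      then show ?thesis by (simp add: algebra_simps)
    qed
    then have aff: "\<forall>x\<in>I. f x = (f x0 - \<beta> * of_real x0) + \<beta> * of_real x" by blast
    have \<beta>: "\<beta> \<in> K" unfolding \<beta>_def by (intro K_simps assms(1) assms(2) y(1))
    then have "f x0 - \<beta> * of_real x0 \<in> K" by (intro K_simps assms(1) assms(2))
    with aff \<beta> show ?thesis by (intro bexI)
  next
    case False
    then have aff: "\<forall>x\<in>I. f x = f x0 + 0 * of_real x" by simp
    from aff K_simps(1) assms(1)[OF assms(2)] show ?thesis by (intro bexI)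
  qed
qed

context edge
begin

lemma C_mu_pointwise_limit:
  assumes g: "\<And>n. g n \<in> C_mu K a b M" and u: "u \<in> C_on K a b"
    and lim: "\<And>x. x \<in> {a..b} \<Longrightarrow> (\<lambda>n. g n x) \<longlonglongrightarrow> u x"
  shows "u \<in> C_mu K a b M"
proof -
  have "\<exists>\<alpha>\<in>K. \<exists>\<beta>\<in>K. \<forall>x\<in>I. u x = \<alpha> + \<beta> * of_real x" if I: "I \<in> components ({a..b} - spt M)" for I
  proof -
    obtain x0 where x0: "x0 \<in> I" using in_components_nonempty[OF I] by auto
    have I_sub: "I \<subseteq> {a..b}" using in_components_subset[OF I] by auto
    have in_K: "f x \<in> K" if "f \<in> C_on K a b" "x \<in> I" for f x
      using that I_sub by (auto simp: C_on_def funs_def)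
    have g_cross: "(g n y - g n x) * of_real (z - x) = (g n z - g n x) * of_real (y - x)"
      if "x \<in> I" "y \<in> I" "z \<in> I" for n x y z
    proof -
      have "g n \<in> C_on K a b" "\<exists>\<alpha>\<in>K. \<exists>\<beta>\<in>K. \<forall>x\<in>I. g n x = \<alpha> + \<beta> * of_real x"
        using g[of n] I by (auto simp: C_mu_def)
      then show ?thesis using affine_on_iff[of I "g n" x0] in_K x0 that by blast
    qed
    have "(u y - u x) * of_real (z - x) = (u z - u x) * of_real (y - x)"
      if "x \<in> I" "y \<in> I" "z \<in> I" for x y z
    proof (rule LIMSEQ_unique)
      have *: "(\<lambda>n. g n x) \<longlonglongrightarrow> u x" "(\<lambda>n. g n y) \<longlonglongrightarrow> u y" "(\<lambda>n. g n z) \<longlonglongrightarrow> u z"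
        using lim I_sub that by auto
      show "(\<lambda>n. (g n y - g n x) * of_real (z - x)) \<longlonglongrightarrow> (u y - u x) * of_real (z - x)"
        by (intro tendsto_intros *)
      show "(\<lambda>n. (g n y - g n x) * of_real (z - x)) \<longlonglongrightarrow> (u z - u x) * of_real (y - x)"
        unfolding g_cross[OF that] by (intro tendsto_intros *)
    qed
    then show ?thesis using affine_on_iff[of I u x0] in_K[OF u] x0 by blast
  qed
  then show ?thesis using u by (simp add: C_mu_def)
qed

text \<open>
  Completeness of \<open>D(\<iota>\<^sub>e)\<close> for the norm made of the energy and the norm of \<open>L2 K M\<close>.  The
  derivatives converge in \<open>L2\<close> to some \<open>k\<close>, and the values at \<open>a\<close> converge by the trace bound.
  These data determine a limit \<open>u\<close>, towards which the sequence converges uniformly by Hoelder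
  continuity; uniform convergence gives convergence in \<open>L2 K M\<close>, convergence of all values, and
  affinity of \<open>u\<close> on the gaps.
\<close>

theorem iota_complete:
  assumes s: "\<And>n. s n \<in> D"
    and cauchy: "\<And>\<epsilon>. \<epsilon> > 0 \<Longrightarrow> \<exists>N. \<forall>m\<ge>N. \<forall>n\<ge>N.
      energy (\<iota> (\<lambda>x. s m x - s n x)) + L2_sq M (\<lambda>x. s m x - s n x) < \<epsilon>"
  obtains f where "f \<in> D" "(\<lambda>n. energy (\<iota> (\<lambda>x. s n x - f x))) \<longlonglongrightarrow> 0"
    "(\<lambda>n. L2_sq M (\<lambda>x. s n x - f x)) \<longlonglongrightarrow> 0"
    "\<And>x. x \<in> {a..b} \<Longrightarrow> (\<lambda>n. \<iota> (s n) x) \<longlonglongrightarrow> \<iota> f x"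
proof -
  define g where "g n = \<iota> (s n)" for n
  define h where "h n = weak_deriv K a b (g n)" for n
  have g_mu: "g n \<in> W12_mu K a b M" for n unfolding g_def by (rule iota_spec(1)[OF s])
  note g = W12_mu_W12[OF g_mu] W12_mu_C_on[OF g_mu]
  have h: "has_weak_deriv K a b (g n) (h n)" for n
    unfolding h_def by (rule has_weak_deriv_weak_deriv[OF g(1)])
  then have h_L2: "h n \<in> L2 K LEB" for n by (simp add: has_weak_deriv_def)
  have diff: "\<iota> (\<lambda>x. s m x - s n x) = (\<lambda>x. g m x - g n x)" for m n
    unfolding g_def by (rule iota_diff(2)[OF s s])
  have energy_diff: "energy (\<lambda>x. g m x - g n x) = L2_sq LEB (\<lambda>x. h m x - h n x)" for m n
    by (rule energy_eq[OF C_on_diff[OF g(2) g(2)] has_weak_deriv_diff_C_on[OF g(2) h g(2) h]])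
  have "\<exists>N. \<forall>m\<ge>N. \<forall>n\<ge>N. L2_sq LEB (\<lambda>x. h m x - h n x) < \<epsilon>" if pos: "0 < \<epsilon>" for \<epsilon>
  proof -
    obtain N where N: "\<And>m n. m \<ge> N \<Longrightarrow> n \<ge> N \<Longrightarrow>
        energy (\<iota> (\<lambda>x. s m x - s n x)) + L2_sq M (\<lambda>x. s m x - s n x) < \<epsilon>"
      using cauchy[OF pos] by blast
    show ?thesis
    proof (intro exI[of _ N] allI impI)
      fix m n assume "N \<le> m" "N \<le> n"
      from N[OF this] show "L2_sq LEB (\<lambda>x. h m x - h n x) < \<epsilon>"
        using L2_sq_nonneg[of M "\<lambda>x. s m x - s n x"] unfolding diff energy_diff by linarith
    qed
  qed
  then obtain k where k: "k \<in> L2 K LEB" "(\<lambda>n. L2_sq LEB (\<lambda>x. h n x - k x)) \<longlonglongrightarrow> 0"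
    using L2_complete[OF finite_leb closed_K K_simps(1), of h] h_L2 by blast
  obtain C where C: "0 \<le> C"
    "\<And>f. f \<in> D \<Longrightarrow> (cmod (\<iota> f a))\<^sup>2 \<le> 1 * energy (\<iota> f) + C * L2_sq M f"
    using trace_bound[OF ends_in_spt(1), of 1] by auto
  have "Cauchy (\<lambda>n. g n a)"
  proof (rule metric_CauchyI)
    fix e :: real assume e: "0 < e"
    have "0 < e\<^sup>2 / (1 + C)" using e C(1) by simp
    then obtain N where N: "\<And>m n. m \<ge> N \<Longrightarrow> n \<ge> N \<Longrightarrow>
        energy (\<iota> (\<lambda>x. s m x - s n x)) + L2_sq M (\<lambda>x. s m x - s n x) < e\<^sup>2 / (1 + C)"
      using cauchy by blast
    show "\<exists>N. \<forall>m\<ge>N. \<forall>n\<ge>N. dist (g m a) (g n a) < e"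
    proof (intro exI[of _ N] allI impI)
      fix m n assume mn: "N \<le> m" "N \<le> n"
      let ?d = "\<lambda>x. s m x - s n x"
      have "(cmod (g m a - g n a))\<^sup>2 \<le> energy (\<iota> ?d) + C * L2_sq M ?d"
        using C(2)[OF iota_diff(1)[OF s[of m] s[of n]]] by (simp add: diff)
      also have "\<dots> \<le> (1 + C) * (energy (\<iota> ?d) + L2_sq M ?d)"
        using C(1) by (simp add: algebra_simps)
      also have "\<dots> < (1 + C) * (e\<^sup>2 / (1 + C))"
        using N[OF mn] C(1) by (intro mult_strict_left_mono) auto
      also have "\<dots> = e\<^sup>2" using C(1) by simp
      finally show "dist (g m a) (g n a) < e"
        using e by (simp add: dist_norm power_less_imp_less_base)
    qed
  qed
  then obtain \<alpha> where \<alpha>: "(\<lambda>n. g n a) \<longlonglongrightarrow> \<alpha>"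
    using Cauchy_convergent_iff convergent_def by blast
  have "g n a \<in> K" for n using g(2)[of n] ab by (simp add: C_on_def funs_def)
  then have \<alpha>_K: "\<alpha> \<in> K" using \<alpha> by (rule lim_in_K)
  define u where "u = (\<lambda>x. if x \<in> {a..b} then \<alpha> + primitive k x else 0)"
  have u: "u \<in> C_on K a b" "u \<in> W12 K a b" "has_weak_deriv K a b u k"
    unfolding u_def by (rule primitive_W12[OF k(1) \<alpha>_K])+
  have u_a: "u a = \<alpha>" using ab by (simp add: u_def)
  have energy_u: "energy (\<lambda>x. g n x - u x) = L2_sq LEB (\<lambda>x. h n x - k x)" for n
    by (rule energy_eq[OF C_on_diff[OF g(2) u(1)] has_weak_deriv_diff_C_on[OF g(2) h u(1,3)]])
  define r where "r n = 2 * (cmod (g n a - \<alpha>))\<^sup>2 + 2 * ((b - a) * L2_sq LEB (\<lambda>x. h n x - k x))" for n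
  have "r \<longlonglongrightarrow> 2 * (cmod (\<alpha> - \<alpha>))\<^sup>2 + 2 * ((b - a) * 0)"
    unfolding r_def by (intro tendsto_intros \<alpha> k(2))
  then have r0: "r \<longlonglongrightarrow> 0" by simp
  have r_nonneg: "0 \<le> r n" for n using ab by (simp add: r_def)
  have unif: "(cmod (g n x - u x))\<^sup>2 \<le> r n" if x: "x \<in> {a..b}" for n x
  proof -
    have "(cmod ((g n x - u x) - (g n a - u a)))\<^sup>2 \<le> \<bar>x - a\<bar> * energy (\<lambda>x. g n x - u x)"
      using x ab by (intro Sobolev_Hoelder W12_diff C_on_diff g u) auto
    also have "\<dots> \<le> (b - a) * energy (\<lambda>x. g n x - u x)"
      using x by (intro mult_right_mono) auto
    finally show ?thesis
      using cmod_diff_sq_le[of "g n a - u a" "(g n a - u a) - (g n x - u x)"]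
        norm_minus_commute[of "g n a - u a" "g n x - u x"]
      by (simp add: r_def u_a energy_u)
  qed
  have lim: "(\<lambda>n. g n x) \<longlonglongrightarrow> u x" if x: "x \<in> {a..b}" for x
  proof -
    have "(\<lambda>n. sqrt (r n)) \<longlonglongrightarrow> 0" using tendsto_real_sqrt[OF r0] by simp
    then have "(\<lambda>n. g n x - u x) \<longlonglongrightarrow> 0"
      by (rule Lim_null_comparison[rotated]) (use unif[OF x] in \<open>auto intro!: real_le_rsqrt always_eventually\<close>)
    then show ?thesis by (rule LIM_zero_cancel)
  qed
  have u_mu: "u \<in> W12_mu K a b M"
    unfolding W12_mu_def
  proof
    have "g n \<in> C_mu K a b M" for n using g_mu[of n] by (simp add: W12_mu_def)
    then show "u \<in> C_mu K a b M" using u(1) lim by (rule C_mu_pointwise_limit)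
  qed (fact u(2))
  have iota_u: "\<iota> u = u" by (rule iota_unique[OF u_mu]) simp
  have u_D: "u \<in> D"
    using u C_on_subset_L2_M by (auto simp: D_iota_e_def)
  show thesis
  proof (rule that[OF u_D])
    show "(\<lambda>n. energy (\<iota> (\<lambda>x. s n x - u x))) \<longlonglongrightarrow> 0"
      using k(2) by (simp add: iota_diff(2)[OF s u_D] iota_u energy_u flip: g_def)
    show "(\<lambda>n. \<iota> (s n) x) \<longlonglongrightarrow> \<iota> u x" if "x \<in> {a..b}" for x
      using lim[OF that] by (simp add: iota_u g_def)
    have le: "L2_sq M (\<lambda>x. s n x - u x) \<le> r n * measure M (space M)" for n
    proof -
      have d: "(\<lambda>x. g n x - u x) \<in> L2 K M"
        using C_on_diff[OF g(2) u(1)] C_on_subset_L2_M by blast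
      have "AE x in M. s n x - u x = g n x - u x"
        using iota_spec(2)[OF s[of n]] by eventually_elim (simp add: g_def)
      then have "L2_sq M (\<lambda>x. s n x - u x) = L2_sq M (\<lambda>x. g n x - u x)"
        using d D_sq_integrable[OF iota_diff(1)[OF s[of n] u_D]]
        by (intro L2_sq_cong_AE) (auto simp: L2_def sq_integrable_def)
      also have "\<dots> \<le> (sqrt (r n))\<^sup>2 * measure M (space M)"
      proof (rule sq_integrable_bounded(2)[OF finite_M])
        show "(\<lambda>x. g n x - u x) \<in> borel_measurable M" using d by (simp add: L2_def)
        show "cmod (g n x - u x) \<le> sqrt (r n)" if "x \<in> space M" for x
          using unif[of x n] that by (intro real_le_rsqrt) simp
      qed
      finally show ?thesis using r_nonneg by simp
    qed
    show "(\<lambda>n. L2_sq M (\<lambda>x. s n x - u x)) \<longlonglongrightarrow> 0"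
    proof (rule tendsto_sandwich[where f = "\<lambda>_. 0" and h = "\<lambda>n. r n * measure M (space M)"])
      show "(\<lambda>n. r n * measure M (space M)) \<longlonglongrightarrow> 0"
        using tendsto_mult_right[OF r0, of "measure M (space M)"] by simp
      show "\<forall>\<^sub>F n in sequentially. L2_sq M (\<lambda>x. s n x - u x) \<le> r n * measure M (space M)"
        by (intro always_eventually allI le)
    qed simp_all
  qed
qed

end

section \<open>Finite-dimensional subspaces\<close>

context scalar_field
begin

lemma subspace_add: "is_subspace K Y X \<Longrightarrow> \<xi> \<in> X \<Longrightarrow> \<eta> \<in> X \<Longrightarrow> (\<lambda>i. \<xi> i + \<eta> i) \<in> X"
  by (auto simp: is_subspace_def plus_fun_def)

lemma subspace_scale: "is_subspace K Y X \<Longrightarrow> k \<in> K \<Longrightarrow> \<xi> \<in> X \<Longrightarrow> (\<lambda>i. k * \<xi> i) \<in> X"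
  by (simp add: is_subspace_def)

lemma subspace_value: "is_subspace K (funs K S) X \<Longrightarrow> \<xi> \<in> X \<Longrightarrow> \<xi> i \<in> K"
  unfolding is_subspace_def funs_def by (cases "i \<in> S") auto

lemma subspace_eliminate:
  assumes X: "is_subspace K Y X" and "\<xi> \<in> X" "\<eta> \<in> X" "k \<in> K"
  shows "(\<lambda>i. \<xi> i - k * \<eta> i) \<in> X"
  using subspace_add[OF X assms(2) subspace_scale[OF X _ assms(3), of "- k"]] assms(4) by simp

lemma subspace_diff:
  assumes "is_subspace K Y X" "\<xi> \<in> X" "\<eta> \<in> X"
  shows "(\<lambda>i. \<xi> i - \<eta> i) \<in> X"
  using subspace_eliminate[OF assms, of 1] by simp

lemma subspace_slice:
  assumes "is_subspace K (funs K (insert s S)) X"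
  shows "is_subspace K (funs K S) {\<xi> \<in> X. \<xi> s = 0}"
  using assms by (auto simp: is_subspace_def funs_def plus_fun_def subset_eq)

text \<open>
  The induction on the number of coordinates splits off the coordinate \<open>s\<close>: either all members
  of \<open>X\<close> vanish there, or some \<open>\<eta> \<in> X\<close> with \<open>\<eta>(s) = 1\<close> can be used for elimination.
\<close>

lemma subspace_slice_trivial:
  assumes "is_subspace K (funs K (insert s S)) X"
  obtains "X = {\<xi> \<in> X. \<xi> s = 0}" | \<eta> where "\<eta> \<in> X" "\<eta> s = 1"
proof (cases "\<exists>\<zeta>\<in>X. \<zeta> s \<noteq> 0")
  case True
  then obtain \<zeta> where \<zeta>: "\<zeta> \<in> X" "\<zeta> s \<noteq> 0" by blast
  have "(\<lambda>i. (1 / \<zeta> s) * \<zeta> i) \<in> X"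
    using subspace_value[OF assms \<zeta>(1)] by (intro subspace_scale[OF assms] \<zeta> K_simps)
  then show thesis by (rule that(2)) (simp add: \<zeta>(2))
next
  case False
  then show thesis by (intro that(1)) auto
qed

text \<open>
  Seminorms on finite-dimensional spaces are continuous.  Eliminating the coordinate \<open>s\<close> writes
  \<open>\<xi> = (\<xi> - \<xi>(s) \<eta>) + \<xi>(s) \<eta>\<close>, where the first summand has one coordinate less.
\<close>

lemma seminorm_bounded:
  fixes N :: "('i \<Rightarrow> complex) \<Rightarrow> real"
  assumes "finite S" "is_subspace K (funs K S) X"
    and "\<And>\<xi> \<eta>. \<xi> \<in> X \<Longrightarrow> \<eta> \<in> X \<Longrightarrow> N (\<lambda>i. \<xi> i + \<eta> i) \<le> N \<xi> + N \<eta>"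
    and "\<And>k \<xi>. k \<in> K \<Longrightarrow> \<xi> \<in> X \<Longrightarrow> N (\<lambda>i. k * \<xi> i) = cmod k * N \<xi>"
    and "\<And>\<xi>. \<xi> \<in> X \<Longrightarrow> 0 \<le> N \<xi>"
  shows "\<exists>C\<ge>0. \<forall>\<xi>\<in>X. N \<xi> \<le> C * (\<Sum>s\<in>S. cmod (\<xi> s))"
  using assms
proof (induction S arbitrary: X rule: finite_induct)
  case (empty X)
  have "N \<xi> \<le> 0" if "\<xi> \<in> X" for \<xi>
  proof -
    have "\<xi> i = 0" for i using empty(1) that by (auto simp: is_subspace_def funs_def)
    then have "(\<lambda>i. 0 * \<xi> i) = \<xi>" by auto
    with empty(3)[of 0 \<xi>] that show ?thesis by simp
  qed
  then show ?case by (intro exI[of _ 0]) auto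
next
  case (insert s S X)
  note X = insert.prems(1)
  let ?X' = "{\<xi> \<in> X. \<xi> s = 0}"
  obtain C where C: "0 \<le> C" "\<And>\<xi>. \<xi> \<in> X \<Longrightarrow> \<xi> s = 0 \<Longrightarrow> N \<xi> \<le> C * (\<Sum>s\<in>S. cmod (\<xi> s))"
    using insert.IH[OF subspace_slice[OF X]] insert.prems(2-4) by auto
  from X show ?case
  proof (cases rule: subspace_slice_trivial)
    case 1
    have "N \<xi> \<le> C * (\<Sum>s\<in>insert s S. cmod (\<xi> s))" if "\<xi> \<in> X" for \<xi>
    proof -
      have "\<xi> s = 0" using 1 that by blast
      with C(2)[OF that] show ?thesis using insert.hyps by simp
    qed
    with C(1) show ?thesis by blast
  next
    case (2 \<eta>)
    define B where "B = (\<Sum>s\<in>S. cmod (\<eta> s))"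
    have B: "0 \<le> B" by (simp add: B_def sum_nonneg)
    have \<eta>N: "0 \<le> N \<eta>" using insert.prems(4) 2(1) .
    have "N \<xi> \<le> (C + C * B + N \<eta>) * (\<Sum>s\<in>insert s S. cmod (\<xi> s))" if \<xi>: "\<xi> \<in> X" for \<xi>
    proof -
      define \<zeta> where "\<zeta> i = \<xi> i - \<xi> s * \<eta> i" for i
      have \<xi>s: "\<xi> s \<in> K" by (rule subspace_value[OF X \<xi>])
      have \<zeta>: "\<zeta> \<in> X" "\<zeta> s = 0"
        unfolding \<zeta>_def using subspace_eliminate[OF X \<xi> 2(1) \<xi>s] 2(2) by simp_all
      define T where "T = (\<Sum>s\<in>S. cmod (\<xi> s))"
      have T: "0 \<le> T" by (simp add: T_def sum_nonneg)
      have "(\<Sum>i\<in>S. cmod (\<zeta> i)) \<le> (\<Sum>i\<in>S. cmod (\<xi> i) + cmod (\<xi> s) * cmod (\<eta> i))"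
        unfolding \<zeta>_def by (intro sum_mono order_trans[OF norm_triangle_ineq4]) (simp add: norm_mult)
      also have "\<dots> = T + cmod (\<xi> s) * B"
        by (simp add: T_def B_def sum.distrib sum_distrib_left)
      finally have "N \<zeta> \<le> C * (T + cmod (\<xi> s) * B)"
        using C(2)[OF \<zeta>] C(1) by (meson mult_left_mono order_trans)
      moreover have "N (\<lambda>i. \<zeta> i + \<xi> s * \<eta> i) \<le> N \<zeta> + N (\<lambda>i. \<xi> s * \<eta> i)"
        using insert.prems(2)[OF \<zeta>(1) subspace_scale[OF X \<xi>s 2(1)]] .
      moreover have "(\<lambda>i. \<zeta> i + \<xi> s * \<eta> i) = \<xi>" by (simp add: \<zeta>_def)
      moreover have "N (\<lambda>i. \<xi> s * \<eta> i) = cmod (\<xi> s) * N \<eta>"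
        using insert.prems(3)[OF \<xi>s 2(1)] .
      ultimately have "N \<xi> \<le> C * (T + cmod (\<xi> s) * B) + cmod (\<xi> s) * N \<eta>" by simp
      also have "\<dots> = C * T + (C * B + N \<eta>) * cmod (\<xi> s)" by (simp add: algebra_simps)
      also have "\<dots> \<le> (C + C * B + N \<eta>) * T + (C + C * B + N \<eta>) * cmod (\<xi> s)"
        using C(1) B T \<eta>N by (intro add_mono mult_right_mono) auto
      also have "\<dots> = (C + C * B + N \<eta>) * (\<Sum>s\<in>insert s S. cmod (\<xi> s))"
        using insert.hyps by (simp add: T_def algebra_simps)
      finally show ?thesis .
    qed
    moreover have "0 \<le> C + C * B + N \<eta>" using C(1) B \<eta>N by simp
    ultimately show ?thesis by blast
  qed
qed

text \<open>
  Finite-dimensional subspaces are closed; the elimination is as in the preceding lemma.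
\<close>

lemma subspace_closed:
  assumes "finite S" "is_subspace K (funs K S) X" "\<And>n. \<xi> n \<in> X" "\<And>i. (\<lambda>n. \<xi> n i) \<longlonglongrightarrow> \<zeta> i"
  shows "\<zeta> \<in> X"
  using assms
proof (induction S arbitrary: X \<xi> \<zeta> rule: finite_induct)
  case (empty X \<xi> \<zeta>)
  have "\<xi> n i = 0" for n i using empty(1,2) by (auto simp: is_subspace_def funs_def)
  then have "\<zeta> i = 0" for i using empty(3)[of i] by (simp add: LIMSEQ_const_iff)
  then have "\<zeta> = 0" by auto
  moreover have "0 \<in> X" using empty(1) by (simp only: is_subspace_def)
  ultimately show ?case by (simp only:)
next
  case (insert s S X \<xi> \<zeta>)
  note X = insert.prems(1)
  from X show ?case
  proof (cases rule: subspace_slice_trivial)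
    case 1
    then have "is_subspace K (funs K S) X" using subspace_slice[OF X] by simp
    then show ?thesis using insert.IH insert.prems by blast
  next
    case (2 \<eta>)
    have \<zeta>s: "\<zeta> s \<in> K"
      using lim_in_K[OF subspace_value[OF X insert.prems(2)] insert.prems(3)[of s]] .
    have "(\<lambda>i. \<zeta> i - \<zeta> s * \<eta> i) \<in> {\<xi> \<in> X. \<xi> s = 0}"
    proof (rule insert.IH[OF subspace_slice[OF X]])
      show "(\<lambda>i. \<xi> n i - \<xi> n s * \<eta> i) \<in> {\<xi> \<in> X. \<xi> s = 0}" for n
        using subspace_eliminate[OF X insert.prems(2) 2(1) subspace_value[OF X insert.prems(2)], of n n s] 2(2)
        by simp
      show "(\<lambda>n. \<xi> n i - \<xi> n s * \<eta> i) \<longlonglongrightarrow> \<zeta> i - \<zeta> s * \<eta> i" for i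
        by (intro tendsto_intros insert.prems(3))
    qed
    then have "(\<lambda>i. (\<zeta> i - \<zeta> s * \<eta> i) + \<zeta> s * \<eta> i) \<in> X"
      using subspace_add[OF X _ subspace_scale[OF X \<zeta>s 2(1)]] by blast
    then show ?thesis by simp
  qed
qed

end

section \<open>The form on the graph\<close>

locale graph_form = scalar_field K for K +
  fixes \<Gamma> :: "('v, 'e) measure_graph"
    and X :: "(('e \<times> nat) + 'v \<Rightarrow> complex) set"
    and L :: "(('e \<times> nat) + 'v \<Rightarrow> complex) \<Rightarrow> ('e \<times> nat) + 'v \<Rightarrow> complex"
  assumes graph: "is_measure_graph \<Gamma>"
    and X: "is_subspace K (funs K (bd \<Gamma>)) X"
    and L: "is_self_adjoint K (bd_inner \<Gamma>) X L"
begin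

lemma finite_E1: "finite (E1 \<Gamma>)" and finite_V1: "finite (V1 \<Gamma>)"
proof -
  interpret fin_digraph "pre_digraph.truncate \<Gamma>" using graph by (simp add: is_measure_graph_def)
  show "finite (E1 \<Gamma>)" "finite (V1 \<Gamma>)"
    using finite_arcs finite_verts by (simp_all add: E1_def V1_def pre_digraph.truncate_def)
qed

lemma finite_bd: "finite (bd \<Gamma>)"
  unfolding bd_def using finite_E1 finite_V1 by simp

lemma vwt_pos: "v \<in> V1 \<Gamma> \<Longrightarrow> 0 < vwt \<Gamma> v"
  using graph by (auto simp: is_measure_graph_def V1_def order_less_le)

lemma edge:
  assumes "e \<in> E1 \<Gamma>"
  shows "edge K (lo \<Gamma> e) (hi \<Gamma> e) (emeas \<Gamma> e)"
proof -
  have "e \<in> arcs \<Gamma>" "emeasure (emeas \<Gamma> e) (space (emeas \<Gamma> e)) \<noteq> 0" using assms by (simp_all add: E1_def)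
  with graph have "lo \<Gamma> e < hi \<Gamma> e \<and> finite_measure (emeas \<Gamma> e) \<and> space (emeas \<Gamma> e) = {lo \<Gamma> e..hi \<Gamma> e} \<and>
      sets (emeas \<Gamma> e) = sets (restrict_space borel {lo \<Gamma> e..hi \<Gamma> e}) \<and>
      lo \<Gamma> e \<in> spt (emeas \<Gamma> e) \<and> hi \<Gamma> e \<in> spt (emeas \<Gamma> e)"
    unfolding is_measure_graph_def by blast
  then show ?thesis
    by (intro edge.intro interval.intro interval_axioms.intro edge_axioms.intro scalar_field_axioms) blast+
qed

abbreviation edge_D :: "'e \<Rightarrow> (real \<Rightarrow> complex) set" where
  "edge_D e \<equiv> D_iota_e K (lo \<Gamma> e) (hi \<Gamma> e) (emeas \<Gamma> e)"

abbreviation edge_iota :: "'e \<Rightarrow> (real \<Rightarrow> complex) \<Rightarrow> real \<Rightarrow> complex" where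
  "edge_iota e \<equiv> iota_e K (lo \<Gamma> e) (hi \<Gamma> e) (emeas \<Gamma> e)"

text \<open>
  The energy of the representative \<open>\<iota>\<^sub>e f\<close>, so that the sum over the edges is the first summand
  of \<open>\<tau>(f,f)\<close>.
\<close>

definition edge_energy :: "'e \<Rightarrow> (real \<Rightarrow> complex) \<Rightarrow> real" where
  "edge_energy e f = interval.energy K (lo \<Gamma> e) (hi \<Gamma> e) (edge_iota e f)"

lemma edge_energy_eq:
  assumes "e \<in> E1 \<Gamma>"
  shows "edge_energy e f = L2_sq (leb (lo \<Gamma> e) (hi \<Gamma> e)) (weak_deriv K (lo \<Gamma> e) (hi \<Gamma> e) (edge_iota e f))"
proof -
  interpret edge K "lo \<Gamma> e" "hi \<Gamma> e" "emeas \<Gamma> e" by (rule edge[OF assms])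
  show ?thesis by (simp add: edge_energy_def energy_def)
qed

lemma edge_energy_nonneg: "e \<in> E1 \<Gamma> \<Longrightarrow> 0 \<le> edge_energy e f"
  by (simp add: edge_energy_eq)

definition total_energy :: "('v, 'e) elem \<Rightarrow> real" where
  "total_energy f = (\<Sum>e\<in>E1 \<Gamma>. edge_energy e (fst f e))"

lemma total_energy_nonneg: "0 \<le> total_energy f"
  unfolding total_energy_def by (intro sum_nonneg edge_energy_nonneg)

definition HG_sq :: "('v, 'e) elem \<Rightarrow> real" where
  "HG_sq f = (\<Sum>e\<in>E1 \<Gamma>. L2_sq (emeas \<Gamma> e) (fst f e)) + (\<Sum>v\<in>V1 \<Gamma>. (cmod (snd f v))\<^sup>2 * vwt \<Gamma> v)"

lemma HG_sq_summands_nonneg: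
  "0 \<le> (\<Sum>e\<in>E1 \<Gamma>. L2_sq (emeas \<Gamma> e) (fst f e))" "0 \<le> (\<Sum>v\<in>V1 \<Gamma>. (cmod (snd f v))\<^sup>2 * vwt \<Gamma> v)"
  using vwt_pos by (auto intro!: sum_nonneg mult_nonneg_nonneg simp: less_imp_le)

lemma HG_sq_nonneg: "0 \<le> HG_sq f"
  using HG_sq_summands_nonneg[of f] by (simp add: HG_sq_def)

lemma HG_norm_sq: "(HG_norm \<Gamma> f)\<^sup>2 = HG_sq f"
proof -
  have "HG_inner \<Gamma> f f = of_real (HG_sq f)"
    unfolding HG_inner_def HG_sq_def L2_inner_def L2_sq_def
    by (simp add: complex_norm_square[symmetric] flip: of_real_power of_real_mult of_real_sum of_real_add)
  then show ?thesis using HG_sq_nonneg by (simp add: HG_norm_def)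
qed

lemma edge_le_total:
  assumes "e \<in> E1 \<Gamma>"
  shows "edge_energy e (fst f e) \<le> total_energy f" "L2_sq (emeas \<Gamma> e) (fst f e) \<le> HG_sq f"
proof -
  show "edge_energy e (fst f e) \<le> total_energy f"
    unfolding total_energy_def using assms finite_E1 by (intro member_le_sum edge_energy_nonneg) auto
  have "L2_sq (emeas \<Gamma> e) (fst f e) \<le> (\<Sum>e\<in>E1 \<Gamma>. L2_sq (emeas \<Gamma> e) (fst f e))"
    using assms finite_E1 by (intro member_le_sum) auto
  then show "L2_sq (emeas \<Gamma> e) (fst f e) \<le> HG_sq f"
    using HG_sq_summands_nonneg(2)[of f] by (simp add: HG_sq_def)
qed

lemma vertex_le_total:
  assumes "v \<in> V1 \<Gamma>"
  shows "(cmod (snd f v))\<^sup>2 * vwt \<Gamma> v \<le> HG_sq f"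
proof -
  have "(cmod (snd f v))\<^sup>2 * vwt \<Gamma> v \<le> (\<Sum>v\<in>V1 \<Gamma>. (cmod (snd f v))\<^sup>2 * vwt \<Gamma> v)"
    using assms finite_V1 vwt_pos by (intro member_le_sum) (auto simp: less_imp_le)
  then show ?thesis using HG_sq_summands_nonneg(1)[of f] by (simp add: HG_sq_def)
qed

abbreviation trace :: "('v, 'e) elem \<Rightarrow> ('e \<times> nat) + 'v \<Rightarrow> complex" where
  "trace f \<equiv> tr \<Gamma> (iota K \<Gamma> f)"

abbreviation D\<tau> :: "('v, 'e) elem set" where
  "D\<tau> \<equiv> D_tau K \<Gamma> X"

lemma D_tauD:
  assumes "f \<in> D\<tau>"
  shows "trace f \<in> X" "e \<in> E1 \<Gamma> \<Longrightarrow> fst f e \<in> edge_D e"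
  using assms by (auto simp: D_tau_def D_iota_def)

lemma trace_simps:
  "e \<in> E1 \<Gamma> \<Longrightarrow> trace f (Inl (e, 0)) = edge_iota e (fst f e) (lo \<Gamma> e)"
  "e \<in> E1 \<Gamma> \<Longrightarrow> trace f (Inl (e, Suc 0)) = edge_iota e (fst f e) (hi \<Gamma> e)"
  "v \<in> V1 \<Gamma> \<Longrightarrow> trace f (Inr v) = snd f v"
  by (auto simp: tr_def bd_def iota_def)

lemma trace_outside: "i \<notin> bd \<Gamma> \<Longrightarrow> trace f i = 0"
  by (simp add: tr_def)

lemma fst_diff_apply: "fst (f - g) e = (\<lambda>x. fst f e x - fst g e x)"
  for f g :: "('v, 'e) elem"
  by (simp add: fun_diff_def)

lemma snd_diff_apply: "snd (f - g) = (\<lambda>v. snd f v - snd g v)"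
  for f g :: "('v, 'e) elem"
  by (simp add: fun_diff_def)

lemma bd_cases:
  assumes "i \<in> bd \<Gamma>"
  obtains e where "e \<in> E1 \<Gamma>" "i = Inl (e, 0)" | e where "e \<in> E1 \<Gamma>" "i = Inl (e, Suc 0)"
    | v where "v \<in> V1 \<Gamma>" "i = Inr v"
  using assms unfolding bd_def by auto

lemma D_iota_diff:
  assumes "f \<in> D_iota K \<Gamma>" "g \<in> D_iota K \<Gamma>"
  shows "f - g \<in> D_iota K \<Gamma>" "trace (f - g) = (\<lambda>i. trace f i - trace g i)"
proof -
  have edge_diff: "(\<lambda>x. fst f e x - fst g e x) \<in> edge_D e"
    "edge_iota e (\<lambda>x. fst f e x - fst g e x) = (\<lambda>x. edge_iota e (fst f e) x - edge_iota e (fst g e) x)"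
    if e: "e \<in> E1 \<Gamma>" for e
  proof -
    interpret edge K "lo \<Gamma> e" "hi \<Gamma> e" "emeas \<Gamma> e" by (rule edge[OF e])
    have "fst f e \<in> edge_D e" "fst g e \<in> edge_D e" using assms e by (auto simp: D_iota_def)
    from iota_diff[OF this] show "(\<lambda>x. fst f e x - fst g e x) \<in> edge_D e"
      "edge_iota e (\<lambda>x. fst f e x - fst g e x) = (\<lambda>x. edge_iota e (fst f e) x - edge_iota e (fst g e) x)"
      by simp_all
  qed
  have "fst (f - g) e = 0" if "e \<notin> E1 \<Gamma>" for e
    using assms that by (simp add: D_iota_def HG_def)
  moreover have "snd (f - g) \<in> funs K (V1 \<Gamma>)"
    unfolding snd_diff_apply using assms by (intro funs_diff) (auto simp: D_iota_def HG_def)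
  moreover have "fst (f - g) e \<in> edge_D e" if "e \<in> E1 \<Gamma>" for e
    unfolding fst_diff_apply using that by (rule edge_diff(1))
  ultimately show "f - g \<in> D_iota K \<Gamma>"
    by (auto simp: D_iota_def HG_def D_iota_e_def)
  show "trace (f - g) = (\<lambda>i. trace f i - trace g i)"
  proof
    fix i
    show "trace (f - g) i = trace f i - trace g i"
    proof (cases "i \<in> bd \<Gamma>")
      case True
      then show ?thesis
        by (cases rule: bd_cases) (simp_all only: trace_simps fst_diff_apply snd_diff_apply edge_diff(2))
    qed (simp add: trace_outside)
  qed
qed

lemma D_tau_diff: "f \<in> D\<tau> \<Longrightarrow> g \<in> D\<tau> \<Longrightarrow> f - g \<in> D\<tau>"
  using D_iota_diff[of f g] subspace_diff[OF X, of "trace f" "trace g"] by (simp add: D_tau_def)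

definition bd_weight :: "('e \<times> nat) + 'v \<Rightarrow> real" where
  "bd_weight = case_sum (\<lambda>_. 1) (vwt \<Gamma>)"

lemma bd_weight_nonneg: "i \<in> bd \<Gamma> \<Longrightarrow> 0 \<le> bd_weight i"
  using vwt_pos by (auto simp: bd_weight_def bd_def less_imp_le)

lemma bd_inner_eq: "bd_inner \<Gamma> \<xi> \<eta> = (\<Sum>i\<in>bd \<Gamma>. \<xi> i * cnj (\<eta> i) * of_real (bd_weight i))"
  unfolding bd_inner_def bd_def using finite_E1 finite_V1
  by (simp add: sum.Plus bd_weight_def)

lemma bd_inner_L_real:
  assumes "\<xi> \<in> X"
  shows "bd_inner \<Gamma> (L \<xi>) \<xi> \<in> \<real>"
proof -
  have "cnj (bd_inner \<Gamma> (L \<xi>) \<xi>) = bd_inner \<Gamma> \<xi> (L \<xi>)"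
    by (simp add: bd_inner_eq mult.commute)
  also have "\<dots> = bd_inner \<Gamma> (L \<xi>) \<xi>" using L assms by (simp add: is_self_adjoint_def)
  finally show ?thesis by (simp add: Reals_cnj_iff)
qed

lemma bd_inner_L_bounded:
  obtains B where "0 \<le> B"
    "\<And>\<xi>. \<xi> \<in> X \<Longrightarrow> cmod (bd_inner \<Gamma> (L \<xi>) \<xi>) \<le> B * (\<Sum>i\<in>bd \<Gamma>. (cmod (\<xi> i))\<^sup>2)"
proof -
  define N where "N \<xi> = (\<Sum>i\<in>bd \<Gamma>. cmod (L \<xi> i) * bd_weight i)" for \<xi>
  have N_nonneg: "0 \<le> N \<xi>" for \<xi>
    unfolding N_def by (intro sum_nonneg mult_nonneg_nonneg bd_weight_nonneg) auto
  have "\<exists>C\<ge>0. \<forall>\<xi>\<in>X. N \<xi> \<le> C * (\<Sum>i\<in>bd \<Gamma>. cmod (\<xi> i))"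
  proof (rule seminorm_bounded[OF finite_bd X])
    show "N (\<lambda>i. \<xi> i + \<eta> i) \<le> N \<xi> + N \<eta>" if "\<xi> \<in> X" "\<eta> \<in> X" for \<xi> \<eta>
    proof -
      have "L (\<lambda>i. \<xi> i + \<eta> i) = (\<lambda>i. L \<xi> i + L \<eta> i)"
        using L that by (simp add: is_self_adjoint_def plus_fun_def)
      then show ?thesis
        unfolding N_def sum.distrib[symmetric] distrib_right[symmetric]
        by (intro sum_mono mult_right_mono bd_weight_nonneg) (auto intro: norm_triangle_ineq)
    qed
    show "N (\<lambda>i. k * \<xi> i) = cmod k * N \<xi>" if "k \<in> K" "\<xi> \<in> X" for k \<xi>
    proof -
      have "L (\<lambda>i. k * \<xi> i) = (\<lambda>i. k * L \<xi> i)" using L that by (simp add: is_self_adjoint_def)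
      then show ?thesis by (simp add: N_def norm_mult sum_distrib_left mult.assoc)
    qed
  qed (rule N_nonneg)
  then obtain C where C: "0 \<le> C" "\<And>\<xi>. \<xi> \<in> X \<Longrightarrow> N \<xi> \<le> C * (\<Sum>i\<in>bd \<Gamma>. cmod (\<xi> i))" by blast
  have "cmod (bd_inner \<Gamma> (L \<xi>) \<xi>) \<le> (C * card (bd \<Gamma>)) * (\<Sum>i\<in>bd \<Gamma>. (cmod (\<xi> i))\<^sup>2)"
    if \<xi>: "\<xi> \<in> X" for \<xi>
  proof -
    define T where "T = (\<Sum>i\<in>bd \<Gamma>. cmod (\<xi> i))"
    have T: "0 \<le> T" by (simp add: T_def sum_nonneg)
    have "cmod (bd_inner \<Gamma> (L \<xi>) \<xi>) \<le> (\<Sum>i\<in>bd \<Gamma>. cmod (L \<xi> i * cnj (\<xi> i) * of_real (bd_weight i)))"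
      unfolding bd_inner_eq by (rule norm_sum)
    also have "\<dots> \<le> (\<Sum>i\<in>bd \<Gamma>. (cmod (L \<xi> i) * bd_weight i) * T)"
    proof (rule sum_mono)
      fix i assume i: "i \<in> bd \<Gamma>"
      have "cmod (L \<xi> i * cnj (\<xi> i) * of_real (bd_weight i)) = (cmod (L \<xi> i) * bd_weight i) * cmod (\<xi> i)"
        using bd_weight_nonneg[OF i] by (simp add: norm_mult)
      also have "\<dots> \<le> (cmod (L \<xi> i) * bd_weight i) * T"
        unfolding T_def using i finite_bd bd_weight_nonneg[OF i]
        by (intro mult_left_mono member_le_sum mult_nonneg_nonneg) auto
      finally show "cmod (L \<xi> i * cnj (\<xi> i) * of_real (bd_weight i)) \<le> (cmod (L \<xi> i) * bd_weight i) * T" .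
    qed
    also have "\<dots> = N \<xi> * T" by (simp add: N_def sum_distrib_right)
    also have "\<dots> \<le> C * T * T"
      using C(2)[OF \<xi>] T by (intro mult_right_mono) (simp_all add: T_def)
    also have "\<dots> = C * T\<^sup>2" by (simp add: power2_eq_square)
    also have "\<dots> \<le> C * ((\<Sum>i\<in>bd \<Gamma>. (cmod (\<xi> i))\<^sup>2) * card (bd \<Gamma>))"
      unfolding T_def using C(1) by (intro mult_left_mono sum_squared_le_sum_of_squares) auto
    finally show ?thesis by (simp add: mult_ac)
  qed
  with C(1) show thesis by (intro that[of "C * card (bd \<Gamma>)"]) auto
qed

lemma edge_trace_bound:
  assumes e: "e \<in> E1 \<Gamma>" and "0 < \<epsilon>"
  shows "\<exists>C\<ge>0. \<forall>f\<in>edge_D e. (cmod (edge_iota e f (lo \<Gamma> e)))\<^sup>2 + (cmod (edge_iota e f (hi \<Gamma> e)))\<^sup>2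
    \<le> \<epsilon> * edge_energy e f + C * L2_sq (emeas \<Gamma> e) f"
proof -
  interpret edge K "lo \<Gamma> e" "hi \<Gamma> e" "emeas \<Gamma> e" by (rule edge[OF e])
  have half: "0 < \<epsilon> / 2" using \<open>0 < \<epsilon>\<close> by simp
  obtain C1 where C1: "0 \<le> C1" "\<And>f. f \<in> edge_D e \<Longrightarrow>
      (cmod (edge_iota e f (lo \<Gamma> e)))\<^sup>2 \<le> \<epsilon> / 2 * energy (edge_iota e f) + C1 * L2_sq (emeas \<Gamma> e) f"
    by (rule trace_bound[OF ends_in_spt(1) half]) blast
  obtain C2 where C2: "0 \<le> C2" "\<And>f. f \<in> edge_D e \<Longrightarrow>
      (cmod (edge_iota e f (hi \<Gamma> e)))\<^sup>2 \<le> \<epsilon> / 2 * energy (edge_iota e f) + C2 * L2_sq (emeas \<Gamma> e) f"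
    by (rule trace_bound[OF ends_in_spt(2) half]) blast
  show ?thesis
  proof (intro exI[of _ "C1 + C2"] conjI ballI)
    fix f assume "f \<in> edge_D e"
    from C1(2)[OF this] C2(2)[OF this]
    show "(cmod (edge_iota e f (lo \<Gamma> e)))\<^sup>2 + (cmod (edge_iota e f (hi \<Gamma> e)))\<^sup>2
      \<le> \<epsilon> * edge_energy e f + (C1 + C2) * L2_sq (emeas \<Gamma> e) f"
      by (simp add: edge_energy_def algebra_simps)
  qed (use C1(1) C2(1) in simp)
qed

text \<open>
  The trace has relative form bound \<open>0\<close> with respect to the total energy.  The vertex part is
  controlled by the Hilbert space norm alone, since the finitely many weights on \<open>V\<^sub>1\<close> are
  positive.
\<close>

lemma total_trace_bound:
  assumes \<epsilon>: "0 < \<epsilon>"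
  obtains C where "0 \<le> C"
    "\<And>f. f \<in> D\<tau> \<Longrightarrow> (\<Sum>i\<in>bd \<Gamma>. (cmod (trace f i))\<^sup>2) \<le> \<epsilon> * total_energy f + C * HG_sq f"
proof -
  have "\<forall>e\<in>E1 \<Gamma>. \<exists>C\<ge>0. \<forall>f\<in>edge_D e. (cmod (edge_iota e f (lo \<Gamma> e)))\<^sup>2 + (cmod (edge_iota e f (hi \<Gamma> e)))\<^sup>2
    \<le> \<epsilon> * edge_energy e f + C * L2_sq (emeas \<Gamma> e) f"
    using edge_trace_bound[OF _ \<epsilon>] by (intro ballI)
  then obtain c where c: "\<And>e. e \<in> E1 \<Gamma> \<Longrightarrow> 0 \<le> c e"
    "\<And>e f. e \<in> E1 \<Gamma> \<Longrightarrow> f \<in> edge_D e \<Longrightarrow>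
      (cmod (edge_iota e f (lo \<Gamma> e)))\<^sup>2 + (cmod (edge_iota e f (hi \<Gamma> e)))\<^sup>2
      \<le> \<epsilon> * edge_energy e f + c e * L2_sq (emeas \<Gamma> e) f"
    by metis
  define C where "C = (\<Sum>e\<in>E1 \<Gamma>. c e) + (\<Sum>v\<in>V1 \<Gamma>. 1 / vwt \<Gamma> v)"
  have nonneg: "0 \<le> (\<Sum>e\<in>E1 \<Gamma>. c e)" "0 \<le> (\<Sum>v\<in>V1 \<Gamma>. 1 / vwt \<Gamma> v)"
    using c(1) vwt_pos by (auto intro!: sum_nonneg simp: less_imp_le)
  have c_le: "c e \<le> C" if "e \<in> E1 \<Gamma>" for e
    using member_le_sum[of e "E1 \<Gamma>" c] c(1) that finite_E1 nonneg(2) by (simp add: C_def)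
  have w_le: "1 / vwt \<Gamma> v \<le> C" if "v \<in> V1 \<Gamma>" for v
    using member_le_sum[of v "V1 \<Gamma>" "\<lambda>v. 1 / vwt \<Gamma> v"] vwt_pos that finite_V1 nonneg(1)
    by (simp add: C_def less_imp_le)
  show thesis
  proof (rule that)
    show "0 \<le> C" using nonneg by (simp add: C_def)
    fix f assume f: "f \<in> D\<tau>"
    have "(\<Sum>i\<in>bd \<Gamma>. (cmod (trace f i))\<^sup>2)
        = (\<Sum>e\<in>E1 \<Gamma>. (cmod (trace f (Inl (e, 0))))\<^sup>2 + (cmod (trace f (Inl (e, Suc 0))))\<^sup>2) + (\<Sum>v\<in>V1 \<Gamma>. (cmod (trace f (Inr v)))\<^sup>2)"
    proof -
      have "(\<Sum>p\<in>E1 \<Gamma> \<times> {0, 1}. (cmod (trace f (Inl p)))\<^sup>2)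
          = (\<Sum>e\<in>E1 \<Gamma>. \<Sum>j\<in>{0, 1}. (cmod (trace f (Inl (e, j))))\<^sup>2)"
        by (simp only: sum.cartesian_product split_def prod.collapse)
      then show ?thesis
        unfolding bd_def using finite_E1 finite_V1 by (simp add: sum.Plus)
    qed
    also have "\<dots> \<le> (\<Sum>e\<in>E1 \<Gamma>. \<epsilon> * edge_energy e (fst f e) + C * L2_sq (emeas \<Gamma> e) (fst f e))
        + (\<Sum>v\<in>V1 \<Gamma>. C * ((cmod (snd f v))\<^sup>2 * vwt \<Gamma> v))"
    proof (rule add_mono; rule sum_mono)
      fix e assume e: "e \<in> E1 \<Gamma>"
      have "c e * L2_sq (emeas \<Gamma> e) (fst f e) \<le> C * L2_sq (emeas \<Gamma> e) (fst f e)"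
        using c_le[OF e] by (rule mult_right_mono) simp
      with c(2)[OF e D_tauD(2)[OF f e]]
      show "(cmod (trace f (Inl (e, 0))))\<^sup>2 + (cmod (trace f (Inl (e, Suc 0))))\<^sup>2
          \<le> \<epsilon> * edge_energy e (fst f e) + C * L2_sq (emeas \<Gamma> e) (fst f e)"
        unfolding trace_simps(1,2)[OF e] by linarith
    next
      fix v assume v: "v \<in> V1 \<Gamma>"
      have "(cmod (snd f v))\<^sup>2 = 1 / vwt \<Gamma> v * ((cmod (snd f v))\<^sup>2 * vwt \<Gamma> v)"
        using vwt_pos[OF v] by simp
      also have "\<dots> \<le> C * ((cmod (snd f v))\<^sup>2 * vwt \<Gamma> v)"
        using w_le[OF v] vwt_pos[OF v] by (intro mult_right_mono) auto
      finally show "(cmod (trace f (Inr v)))\<^sup>2 \<le> C * ((cmod (snd f v))\<^sup>2 * vwt \<Gamma> v)"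
        unfolding trace_simps(3)[OF v] .
    qed
    also have "\<dots> = \<epsilon> * total_energy f + C * HG_sq f"
      by (simp add: total_energy_def HG_sq_def sum.distrib sum_distrib_left distrib_left)
    finally show "(\<Sum>i\<in>bd \<Gamma>. (cmod (trace f i))\<^sup>2) \<le> \<epsilon> * total_energy f + C * HG_sq f" .
  qed
qed

lemma boundary_form_bound:
  obtains C where "0 \<le> C"
    "\<And>f. f \<in> D\<tau> \<Longrightarrow> cmod (bd_inner \<Gamma> (L (trace f)) (trace f)) \<le> 1 / 2 * total_energy f + C * HG_sq f"
proof -
  obtain B where B: "0 \<le> B"
    "\<And>\<xi>. \<xi> \<in> X \<Longrightarrow> cmod (bd_inner \<Gamma> (L \<xi>) \<xi>) \<le> B * (\<Sum>i\<in>bd \<Gamma>. (cmod (\<xi> i))\<^sup>2)"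
    by (rule bd_inner_L_bounded) blast
  \<comment> \<open>With \<open>B + 1\<close> instead of \<open>B\<close> the case \<open>B = 0\<close> needs no separate treatment.\<close>
  define \<epsilon> where "\<epsilon> = 1 / (2 * (B + 1))"
  have \<epsilon>: "0 < \<epsilon>" "B * \<epsilon> \<le> 1 / 2" using B(1) by (simp_all add: \<epsilon>_def field_simps)
  obtain C where C: "0 \<le> C"
    "\<And>f. f \<in> D\<tau> \<Longrightarrow> (\<Sum>i\<in>bd \<Gamma>. (cmod (trace f i))\<^sup>2) \<le> \<epsilon> * total_energy f + C * HG_sq f"
    by (rule total_trace_bound[OF \<epsilon>(1)]) blast
  show thesis
  proof (rule that[of "B * C"])
    show "0 \<le> B * C" using B C by simp
    fix f assume f: "f \<in> D\<tau>"
    have "cmod (bd_inner \<Gamma> (L (trace f)) (trace f)) \<le> B * (\<epsilon> * total_energy f + C * HG_sq f)"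
      using B(2)[OF D_tauD(1)[OF f]] mult_left_mono[OF C(2)[OF f] B(1)] by linarith
    also have "\<dots> = (B * \<epsilon>) * total_energy f + B * C * HG_sq f" by (simp add: algebra_simps)
    also have "\<dots> \<le> 1 / 2 * total_energy f + B * C * HG_sq f"
      using \<epsilon>(2) total_energy_nonneg by (intro add_right_mono mult_right_mono)
    finally show "cmod (bd_inner \<Gamma> (L (trace f)) (trace f)) \<le> 1 / 2 * total_energy f + B * C * HG_sq f" .
  qed
qed

lemma tau_eq: "tau K \<Gamma> L f f = of_real (total_energy f) + bd_inner \<Gamma> (L (trace f)) (trace f)"
proof -
  have "(LINT x|leb (lo \<Gamma> e) (hi \<Gamma> e). h x * cnj (h x)) = of_real (L2_sq (leb (lo \<Gamma> e) (hi \<Gamma> e)) h)" for e h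
    unfolding L2_sq_def
    by (simp add: complex_norm_square[symmetric] flip: of_real_power)
  then show ?thesis
    by (simp add: tau_def total_energy_def edge_energy_eq iota_def)
qed

lemma tau_real:
  assumes "f \<in> D\<tau>"
  shows "tau K \<Gamma> L f f \<in> \<real>"
  unfolding tau_eq using bd_inner_L_real[OF D_tauD(1)[OF assms]] by simp

text \<open>
  The boundary term is absorbed by half of the energy.  Hence \<open>\<tau>\<close> plus a multiple of the squared
  norm of the Hilbert space is comparable with the total energy plus this squared norm, which
  does not involve \<open>L\<close>; boundedness below and closedness both follow from this comparison.
\<close>

lemma tau_comparable:
  obtains C where "0 \<le> C"
    "\<And>f. f \<in> D\<tau> \<Longrightarrow> total_energy f \<le> 2 * (Re (tau K \<Gamma> L f f) + C * HG_sq f)"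
    "\<And>f. f \<in> D\<tau> \<Longrightarrow> Re (tau K \<Gamma> L f f) \<le> 2 * total_energy f + C * HG_sq f"
proof -
  obtain C where C: "0 \<le> C"
    "\<And>f. f \<in> D\<tau> \<Longrightarrow> cmod (bd_inner \<Gamma> (L (trace f)) (trace f)) \<le> 1 / 2 * total_energy f + C * HG_sq f"
    by (rule boundary_form_bound) blast
  show thesis
  proof (rule that[OF C(1)])
    fix f assume f: "f \<in> D\<tau>"
    have "\<bar>Re (bd_inner \<Gamma> (L (trace f)) (trace f))\<bar> \<le> 1 / 2 * total_energy f + C * HG_sq f"
      using C(2)[OF f] abs_Re_le_cmod order_trans by blast
    then show "total_energy f \<le> 2 * (Re (tau K \<Gamma> L f f) + C * HG_sq f)"
      "Re (tau K \<Gamma> L f f) \<le> 2 * total_energy f + C * HG_sq f"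
      using total_energy_nonneg[of f] by (auto simp: tau_eq)
  qed
qed

theorem bounded_below: "form_bounded_below (HG_norm \<Gamma>) D\<tau> (tau K \<Gamma> L)"
proof -
  obtain C where C: "\<And>f. f \<in> D\<tau> \<Longrightarrow> total_energy f \<le> 2 * (Re (tau K \<Gamma> L f f) + C * HG_sq f)"
    by (rule tau_comparable) blast
  have "(- C) * (HG_norm \<Gamma> f)\<^sup>2 \<le> Re (tau K \<Gamma> L f f)" if "f \<in> D\<tau>" for f
    using C[OF that] total_energy_nonneg[of f] by (simp add: HG_norm_sq)
  then show ?thesis
    unfolding form_bounded_below_def form_lower_bound_def using tau_real by blast
qed

text \<open>
  The edges are treated one by one; as the traces converge and \<open>X\<close> is closed, the boundary
  condition passes to the limit.
\<close>

theorem energy_complete: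
  assumes s: "\<And>n. s n \<in> D\<tau>"
    and cauchy: "\<And>\<epsilon>. \<epsilon> > 0 \<Longrightarrow> \<exists>N. \<forall>m\<ge>N. \<forall>n\<ge>N.
      total_energy (s m - s n) + HG_sq (s m - s n) < \<epsilon>"
  obtains f where "f \<in> D\<tau>" "(\<lambda>n. total_energy (s n - f)) \<longlonglongrightarrow> 0" "(\<lambda>n. HG_sq (s n - f)) \<longlonglongrightarrow> 0"
proof -
  have "\<forall>e\<in>E1 \<Gamma>. \<exists>F. F \<in> edge_D e \<and> (\<lambda>n. edge_energy e (\<lambda>x. fst (s n) e x - F x)) \<longlonglongrightarrow> 0 \<and>
      (\<lambda>n. L2_sq (emeas \<Gamma> e) (\<lambda>x. fst (s n) e x - F x)) \<longlonglongrightarrow> 0 \<and>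
      (\<forall>x\<in>{lo \<Gamma> e..hi \<Gamma> e}. (\<lambda>n. edge_iota e (fst (s n) e) x) \<longlonglongrightarrow> edge_iota e F x)"
  proof
    fix e assume e: "e \<in> E1 \<Gamma>"
    interpret edge K "lo \<Gamma> e" "hi \<Gamma> e" "emeas \<Gamma> e" by (rule edge[OF e])
    have "\<exists>N. \<forall>m\<ge>N. \<forall>n\<ge>N. energy (edge_iota e (\<lambda>x. fst (s m) e x - fst (s n) e x))
        + L2_sq (emeas \<Gamma> e) (\<lambda>x. fst (s m) e x - fst (s n) e x) < \<epsilon>" if pos: "0 < \<epsilon>" for \<epsilon>
    proof -
      obtain N where N: "\<forall>m\<ge>N. \<forall>n\<ge>N. total_energy (s m - s n) + HG_sq (s m - s n) < \<epsilon>"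
        using cauchy[OF pos] by blast
      show ?thesis
      proof (intro exI[of _ N] allI impI)
        fix m n assume "N \<le> m" "N \<le> n"
        with N have "total_energy (s m - s n) + HG_sq (s m - s n) < \<epsilon>" by blast
        with edge_le_total[OF e, of "s m - s n"]
        show "energy (edge_iota e (\<lambda>x. fst (s m) e x - fst (s n) e x))
            + L2_sq (emeas \<Gamma> e) (\<lambda>x. fst (s m) e x - fst (s n) e x) < \<epsilon>"
          unfolding fst_diff_apply edge_energy_def by linarith
      qed
    qed
    note edge_cauchy = this
    show "\<exists>F. F \<in> edge_D e \<and> (\<lambda>n. edge_energy e (\<lambda>x. fst (s n) e x - F x)) \<longlonglongrightarrow> 0 \<and>
      (\<lambda>n. L2_sq (emeas \<Gamma> e) (\<lambda>x. fst (s n) e x - F x)) \<longlonglongrightarrow> 0 \<and>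
      (\<forall>x\<in>{lo \<Gamma> e..hi \<Gamma> e}. (\<lambda>n. edge_iota e (fst (s n) e) x) \<longlonglongrightarrow> edge_iota e F x)"
    proof (rule iota_complete[where s = "\<lambda>n. fst (s n) e"])
      show "fst (s n) e \<in> edge_D e" for n by (rule D_tauD(2)[OF s e])
      show "\<exists>N. \<forall>m\<ge>N. \<forall>n\<ge>N. energy (edge_iota e (\<lambda>x. fst (s m) e x - fst (s n) e x))
        + L2_sq (emeas \<Gamma> e) (\<lambda>x. fst (s m) e x - fst (s n) e x) < \<epsilon>" if "0 < \<epsilon>" for \<epsilon>
        using that by (rule edge_cauchy)
    qed (auto simp: edge_energy_def)
  qed
  from bchoice[OF this] obtain F where F: "\<And>e. e \<in> E1 \<Gamma> \<Longrightarrow> F e \<in> edge_D e"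
    "\<And>e. e \<in> E1 \<Gamma> \<Longrightarrow> (\<lambda>n. edge_energy e (\<lambda>x. fst (s n) e x - F e x)) \<longlonglongrightarrow> 0"
    "\<And>e. e \<in> E1 \<Gamma> \<Longrightarrow> (\<lambda>n. L2_sq (emeas \<Gamma> e) (\<lambda>x. fst (s n) e x - F e x)) \<longlonglongrightarrow> 0"
    "\<And>e x. e \<in> E1 \<Gamma> \<Longrightarrow> x \<in> {lo \<Gamma> e..hi \<Gamma> e} \<Longrightarrow> (\<lambda>n. edge_iota e (fst (s n) e) x) \<longlonglongrightarrow> edge_iota e (F e) x"
    by blast
  have vertex_funs: "snd (s n) \<in> funs K (V1 \<Gamma>)" for n
    using s[of n] by (simp add: D_tau_def D_iota_def HG_def)
  have "\<exists>y\<in>K. (\<lambda>n. snd (s n) v) \<longlonglongrightarrow> y" if v: "v \<in> V1 \<Gamma>" for v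
  proof -
    have "Cauchy (\<lambda>n. snd (s n) v)"
    proof (rule metric_CauchyI)
      fix e :: real assume e: "0 < e"
      then have "0 < e\<^sup>2 * vwt \<Gamma> v" using vwt_pos[OF v] by simp
      then obtain N where N: "\<forall>m\<ge>N. \<forall>n\<ge>N. total_energy (s m - s n) + HG_sq (s m - s n) < e\<^sup>2 * vwt \<Gamma> v"
        using cauchy by blast
      show "\<exists>N. \<forall>m\<ge>N. \<forall>n\<ge>N. dist (snd (s m) v) (snd (s n) v) < e"
      proof (intro exI[of _ N] allI impI)
        fix m n assume "N \<le> m" "N \<le> n"
        with N have "total_energy (s m - s n) + HG_sq (s m - s n) < e\<^sup>2 * vwt \<Gamma> v" by blast
        with vertex_le_total[OF v, of "s m - s n"] total_energy_nonneg[of "s m - s n"]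
        have "(cmod (snd (s m) v - snd (s n) v))\<^sup>2 * vwt \<Gamma> v < e\<^sup>2 * vwt \<Gamma> v"
          unfolding snd_diff_apply by linarith
        then have "(cmod (snd (s m) v - snd (s n) v))\<^sup>2 < e\<^sup>2" using vwt_pos[OF v] by simp
        then show "dist (snd (s m) v) (snd (s n) v) < e"
          using e by (simp add: dist_norm power_less_imp_less_base)
      qed
    qed
    then obtain y where y: "(\<lambda>n. snd (s n) v) \<longlonglongrightarrow> y"
      unfolding Cauchy_convergent_iff convergent_def by blast
    have "snd (s n) v \<in> K" for n using vertex_funs[of n] v by (simp add: funs_def)
    then have "y \<in> K" using y by (rule lim_in_K)
    with y show ?thesis by blast
  qed
  then obtain G where G: "\<And>v. v \<in> V1 \<Gamma> \<Longrightarrow> G v \<in> K" "\<And>v. v \<in> V1 \<Gamma> \<Longrightarrow> (\<lambda>n. snd (s n) v) \<longlonglongrightarrow> G v"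
    by metis
  define f :: "('v, 'e) elem" where
    "f = (\<lambda>e. if e \<in> E1 \<Gamma> then F e else 0, \<lambda>v. if v \<in> V1 \<Gamma> then G v else 0)"
  have f_edge: "fst f e = F e" if "e \<in> E1 \<Gamma>" for e using that by (simp add: f_def)
  have f_vertex: "snd f v = G v" if "v \<in> V1 \<Gamma>" for v using that by (simp add: f_def)
  have f_iota: "f \<in> D_iota K \<Gamma>"
    using F(1) G(1) by (auto simp: D_iota_def HG_def f_def funs_def D_iota_e_def)
  have "(\<lambda>n. trace (s n) i) \<longlonglongrightarrow> trace f i" for i
  proof (cases "i \<in> bd \<Gamma>")
    case True
    then show ?thesis
    proof (cases rule: bd_cases)
      case (1 e)
      interpret edge K "lo \<Gamma> e" "hi \<Gamma> e" "emeas \<Gamma> e" by (rule edge[OF 1(1)])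
      show ?thesis unfolding 1(2) trace_simps(1)[OF 1(1)] f_edge[OF 1(1)] using ab by (intro F(4) 1) auto
    next
      case (2 e)
      interpret edge K "lo \<Gamma> e" "hi \<Gamma> e" "emeas \<Gamma> e" by (rule edge[OF 2(1)])
      show ?thesis unfolding 2(2) trace_simps(2)[OF 2(1)] f_edge[OF 2(1)] using ab by (intro F(4) 2) auto
    next
      case (3 v)
      show ?thesis unfolding 3(2) trace_simps(3)[OF 3(1)] f_vertex[OF 3(1)] by (rule G(2)[OF 3(1)])
    qed
  qed (simp add: trace_outside)
  then have "trace f \<in> X"
    by (rule subspace_closed[OF finite_bd X, where \<xi> = "\<lambda>n. trace (s n)", OF D_tauD(1)[OF s]])
  with f_iota have "f \<in> D\<tau>" by (simp add: D_tau_def)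
  moreover have "(\<lambda>n. total_energy (s n - f)) \<longlonglongrightarrow> (\<Sum>e\<in>E1 \<Gamma>. 0)"
    unfolding total_energy_def fst_diff_apply
    by (intro tendsto_sum) (simp add: f_edge F(2))
  moreover have "(\<lambda>n. HG_sq (s n - f)) \<longlonglongrightarrow> (\<Sum>e\<in>E1 \<Gamma>. 0) + (\<Sum>v\<in>V1 \<Gamma>. 0)"
    unfolding HG_sq_def fst_diff_apply snd_diff_apply
  proof (intro tendsto_add tendsto_sum)
    show "(\<lambda>n. L2_sq (emeas \<Gamma> e) (\<lambda>x. fst (s n) e x - fst f e x)) \<longlonglongrightarrow> 0" if "e \<in> E1 \<Gamma>" for e
      using F(3)[OF that] by (simp add: f_edge that)
    show "(\<lambda>n. (cmod (snd (s n) v - snd f v))\<^sup>2 * vwt \<Gamma> v) \<longlonglongrightarrow> 0" if "v \<in> V1 \<Gamma>" for v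
    proof -
      have "(\<lambda>n. (cmod (snd (s n) v - G v))\<^sup>2 * vwt \<Gamma> v) \<longlonglongrightarrow> (cmod (G v - G v))\<^sup>2 * vwt \<Gamma> v"
        by (intro tendsto_intros G(2) that)
      then show ?thesis by (simp add: f_vertex that)
    qed
  qed
  ultimately show thesis using that by simp
qed

text \<open>
  For every lower bound \<open>c\<close> the square \<open>q\<close> of the form norm dominates the squared norm of the
  Hilbert space, and is therefore equivalent to the total energy plus this squared norm, for
  which completeness is known.
\<close>

theorem closed_form: "form_closed (HG_norm \<Gamma>) D\<tau> (tau K \<Gamma> L)"
  unfolding form_closed_def
proof (intro conjI allI impI bounded_below)
  fix c assume lower: "form_lower_bound (HG_norm \<Gamma>) D\<tau> (tau K \<Gamma> L) c"
  define q where "q f = Re (tau K \<Gamma> L f f) + (1 - c) * HG_sq f" for f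
  have norm_eq: "form_norm (HG_norm \<Gamma>) (tau K \<Gamma> L) c f = sqrt (q f)" for f
    by (simp add: form_norm_def q_def HG_norm_sq)
  obtain C where C: "0 \<le> C"
    "\<And>f. f \<in> D\<tau> \<Longrightarrow> total_energy f \<le> 2 * (Re (tau K \<Gamma> L f f) + C * HG_sq f)"
    "\<And>f. f \<in> D\<tau> \<Longrightarrow> Re (tau K \<Gamma> L f f) \<le> 2 * total_energy f + C * HG_sq f"
    by (rule tau_comparable) blast
  define A where "A = 3 + 2 * C + 2 * \<bar>1 - c\<bar>"
  have A: "0 < A" unfolding A_def using C(1) by (intro add_pos_nonneg) auto
  have q_lower: "HG_sq f \<le> q f" if "f \<in> D\<tau>" for f
    using lower that by (simp add: form_lower_bound_def q_def HG_norm_sq algebra_simps)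
  have abs_c: "\<bar>(1 - c) * HG_sq f\<bar> = \<bar>1 - c\<bar> * HG_sq f" for f
    by (simp add: abs_mult HG_sq_nonneg)
  have energy_le: "total_energy f + HG_sq f \<le> A * q f" if f: "f \<in> D\<tau>" for f
  proof -
    have "C * HG_sq f \<le> C * q f" "\<bar>1 - c\<bar> * HG_sq f \<le> \<bar>1 - c\<bar> * q f"
      using q_lower[OF f] C(1) by (auto intro: mult_left_mono)
    then show ?thesis
      using C(2)[OF f] q_lower[OF f] abs_c[of f] abs_le_D2[of "(1 - c) * HG_sq f"]
      by (auto simp: A_def q_def[of f] algebra_simps)
  qed
  have q_upper: "q f \<le> A * (total_energy f + HG_sq f)" if f: "f \<in> D\<tau>" for f
  proof -
    have "q f \<le> 2 * total_energy f + C * HG_sq f + \<bar>1 - c\<bar> * HG_sq f"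
      using C(3)[OF f] abs_c[of f] by (simp add: q_def)
    also have "\<dots> = 2 * total_energy f + (C + \<bar>1 - c\<bar>) * HG_sq f" by (simp add: algebra_simps)
    also have "\<dots> \<le> A * total_energy f + A * HG_sq f"
    proof (rule add_mono; rule mult_right_mono)
      show "2 \<le> A" "C + \<bar>1 - c\<bar> \<le> A" unfolding A_def using C(1) by auto
    qed (rule total_energy_nonneg HG_sq_nonneg)+
    finally show ?thesis by (simp add: distrib_left)
  qed
  show "form_complete (HG_norm \<Gamma>) D\<tau> (tau K \<Gamma> L) c"
    unfolding form_complete_def norm_eq
  proof (intro allI impI, elim conjE)
    fix s :: "nat \<Rightarrow> ('v, 'e) elem"
    assume s: "\<forall>n. s n \<in> D\<tau>" and cauchy: "\<forall>\<epsilon>>0. \<exists>M. \<forall>m\<ge>M. \<forall>n\<ge>M. sqrt (q (s m - s n)) < \<epsilon>"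
    have "\<exists>N. \<forall>m\<ge>N. \<forall>n\<ge>N. total_energy (s m - s n) + HG_sq (s m - s n) < \<epsilon>" if pos: "0 < \<epsilon>" for \<epsilon>
    proof -
      have "0 < sqrt (\<epsilon> / A)" using pos A by simp
      then obtain N where N: "\<forall>m\<ge>N. \<forall>n\<ge>N. sqrt (q (s m - s n)) < sqrt (\<epsilon> / A)" using cauchy by blast
      show ?thesis
      proof (intro exI[of _ N] allI impI)
        fix m n assume "N \<le> m" "N \<le> n"
        with N have "q (s m - s n) < \<epsilon> / A" by simp
        then have "A * q (s m - s n) < \<epsilon>" using A by (simp add: field_simps)
        with energy_le[of "s m - s n"] s D_tau_diff
        show "total_energy (s m - s n) + HG_sq (s m - s n) < \<epsilon>" by fastforce
      qed
    qed
    with s obtain f where f: "f \<in> D\<tau>" "(\<lambda>n. total_energy (s n - f)) \<longlonglongrightarrow> 0" "(\<lambda>n. HG_sq (s n - f)) \<longlonglongrightarrow> 0"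
      by (metis energy_complete)
    have diff: "s n - f \<in> D\<tau>" for n using s f(1) D_tau_diff by blast
    have "(\<lambda>n. q (s n - f)) \<longlonglongrightarrow> 0"
    proof (rule tendsto_sandwich[where f = "\<lambda>_. 0" and h = "\<lambda>n. A * (total_energy (s n - f) + HG_sq (s n - f))"])
      show "\<forall>\<^sub>F n in sequentially. 0 \<le> q (s n - f)"
        using q_lower[OF diff] HG_sq_nonneg by (intro always_eventually allI) (rule order_trans)
      show "\<forall>\<^sub>F n in sequentially. q (s n - f) \<le> A * (total_energy (s n - f) + HG_sq (s n - f))"
        by (intro always_eventually allI q_upper diff)
      have "(\<lambda>n. A * (total_energy (s n - f) + HG_sq (s n - f))) \<longlonglongrightarrow> A * (0 + 0)"
        by (intro tendsto_intros f)
      then show "(\<lambda>n. A * (total_energy (s n - f) + HG_sq (s n - f))) \<longlonglongrightarrow> 0" by simp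
    qed simp
    then have "(\<lambda>n. sqrt (q (s n - f))) \<longlonglongrightarrow> 0" using tendsto_real_sqrt by fastforce
    with f(1) show "\<exists>f\<in>D\<tau>. (\<lambda>n. sqrt (q (s n - f))) \<longlonglongrightarrow> 0" by blast
  qed
qed

end

theorem theorem2p5:
  fixes K :: "complex set"
    and \<Gamma> :: "('v, 'e) measure_graph"
    and X :: "(('e \<times> nat) + 'v \<Rightarrow> complex) set"
    and L :: "(('e \<times> nat) + 'v \<Rightarrow> complex) \<Rightarrow> ('e \<times> nat) + 'v \<Rightarrow> complex"
  assumes "K = \<real> \<or> K = UNIV"
    and "is_measure_graph \<Gamma>"
    and "is_subspace K (funs K (bd \<Gamma>)) X"
    and "is_self_adjoint K (bd_inner \<Gamma>) X L"
  shows "form_bounded_below (HG_norm \<Gamma>) (D_tau K \<Gamma> X) (tau K \<Gamma> L) \<and>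
         form_closed (HG_norm \<Gamma>) (D_tau K \<Gamma> X) (tau K \<Gamma> L)"
proof -
  interpret graph_form K \<Gamma> X L
    using assms by unfold_locales
  show ?thesis using bounded_below closed_form by simp
qed

end
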